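(* Assume $\kappa\ge 0$, $\nu\in\mathbb{C}$ and $x\in\mathbb{V}=\{x\in\mathbb{R}^n: x_1+x_2+\cdots+x_n=0\}$. Then the generalized Bessel function $J_\kappa$ for the root system $A_{n-1}$ is given by $$J_\kappa(\lambda,x)=\Phi_2^{(n)}[\underbrace{\kappa,\ldots,\kappa}_{n};\,n\kappa;\,\nu x_1,\ldots,\nu x_n]=e^{\nu x_n}\,\Phi_2^{(n-1)}[\underbrace{\kappa,\ldots,\kappa}_{n-1};\,n\kappa;\,\nu(x_1-x_n),\ldots,\nu(x_{n-1}-x_n)],$$ where $$\lambda=\left(-\frac{\nu}{n},\ldots,-\frac{\nu}{n},\frac{(n-1)\nu}{n}\right).$$
   Context: Dunkl operators (symmetric group $S_n$, root system $A_{n-1}$): for a nonnegative real number $\kappa$ and $1\le i\le n$, acting on functions on $\mathbb{R}^n$, $$D_i f(x)=\frac{\partial f}{\partial x_i}(x)+\kappa\sum_{j\ne i}\frac{f(x)-f(x(i,j))}{x_i-x_j},$$ where $x(i,j)$ is $x$ with its $i$th and $j$th coordinates exchanged. Permutations $\sigma\in S_n$ act on vectors by permuting coordinates, $x\mapsto x\sigma$. Intertwining operator: let $\mathcal{P}_m^n$ be the space of homogeneous polynomials of degree $m$ in $n$ variables. $V_\kappa$ is the unique linear operator with $V_\kappa:\mathcal{P}_m^n\to\mathcal{P}_m^n$ for all $m$, $V_\kappa 1=1$, and $D_iV_\kappa=V_\kappa\partial_i$ for $1\le i\le n$. It is applied to exponentials by $V_\kappa[e^{\langle\cdot,y\rangle}](x)=\sum_{m\ge0}\frac1{m!}V_\kappa[\langle\cdot,y\rangle^m](x)$,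 where $\langle x,y\rangle=\sum_i x_iy_i$ (bilinear, also for $y\in\mathbb{C}^n$). Dunkl kernel: $E_\kappa(x,y)=V_\kappa[e^{\langle\cdot,y\rangle}](x)$. Generalized Bessel function: $J_\kappa(\lambda,x)=\frac1{n!}\sum_{\sigma\in S_n}E_\kappa(x,\lambda\sigma)$. Humbert function of $N$ variables: $$\Phi_2^{(N)}[b_1,\ldots,b_N;c;z_1,\ldots,z_N]=\sum_{m_1,\ldots,m_N\ge0}\frac{(b_1)_{m_1}\cdots(b_N)_{m_N}}{(c)_{m_1+\cdots+m_N}}\frac{z_1^{m_1}}{m_1!}\cdots\frac{z_N^{m_N}}{m_N!},$$ with $(a)_m=a(a+1)\cdots(a+m-1)$, $(a)_0=1$.
   Formalization: At κ = 0 the Humbert functions have (nκ)_m = 0 in the denominators (terms 0/0) and are undefined; there the equalities are read as: both right-hand sides tend to J_0(λ,x) as κ → 0+. For κ > 0 the equalities are literal. *)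

theory Defs
  imports "HOL-Analysis.Analysis" "HOL-Combinatorics.Permutations"
begin

text \<open>
  A point of n-dimensional space is a function on \<open>nat\<close> of which only the
  coordinates with index in \<open>{1..n}\<close> are used. Polynomials have complex coefficients
  and are represented by the functions they induce on real points; none of the functions
  occurring below depends on coordinates outside \<open>{1..n}\<close>.
\<close>

definition multi_indices :: "nat \<Rightarrow> (nat \<Rightarrow> nat) set" where
  "multi_indices n = {1..n} \<rightarrow>\<^sub>E UNIV"

definition polys_supported :: "nat \<Rightarrow> (nat \<Rightarrow> nat) set \<Rightarrow> ((nat \<Rightarrow> real) \<Rightarrow> complex) set" where
  "polys_supported n M =
     {f. \<exists>A c. finite A \<and> A \<subseteq> M \<and>
           f = (\<lambda>x. \<Sum>a\<in>A. c a * (\<Prod>i=1..n. complex_of_real (x i) ^ a i))}"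

definition polys :: "nat \<Rightarrow> ((nat \<Rightarrow> real) \<Rightarrow> complex) set" where
  "polys n = polys_supported n (multi_indices n)"

definition hom_polys :: "nat \<Rightarrow> nat \<Rightarrow> ((nat \<Rightarrow> real) \<Rightarrow> complex) set" where
  "hom_polys n m = polys_supported n {a \<in> multi_indices n. (\<Sum>i=1..n. a i) = m}"

definition partial :: "nat \<Rightarrow> ((nat \<Rightarrow> real) \<Rightarrow> complex) \<Rightarrow> (nat \<Rightarrow> real) \<Rightarrow> complex" where
  "partial i f x = vector_derivative (\<lambda>t. f (x(i := t))) (at (x i))"

text \<open>
  The difference quotient in the Dunkl operator is extended continuously to the hyperplane
  \<open>x i = x j\<close>; there its limit (for continuously differentiable \<open>f\<close>) is the difference
  of the two partial derivatives. Without this extension, division by zero would yield 0 and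
  Dunkl operators would not map polynomials to polynomials.
\<close>

definition diff_quot :: "nat \<Rightarrow> nat \<Rightarrow> ((nat \<Rightarrow> real) \<Rightarrow> complex) \<Rightarrow> (nat \<Rightarrow> real) \<Rightarrow> complex" where
  "diff_quot i j f x =
     (if x i = x j then partial i f x - partial j f x
      else (f x - f (x(i := x j, j := x i))) / complex_of_real (x i - x j))"

definition dunkl :: "nat \<Rightarrow> real \<Rightarrow> nat \<Rightarrow> ((nat \<Rightarrow> real) \<Rightarrow> complex) \<Rightarrow> (nat \<Rightarrow> real) \<Rightarrow> complex" where
  "dunkl n \<kappa> i f x =
     partial i f x + complex_of_real \<kappa> * (\<Sum>j\<in>{1..n} - {i}. diff_quot i j f x)"

text \<open>
  The intertwining operator is an operator on polynomials only; membership in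
  \<^const>\<open>extensional\<close> fixes its irrelevant values elsewhere, so that the conditions
  below determine it uniquely.
\<close>

definition is_intertwining ::
  "nat \<Rightarrow> real \<Rightarrow> (((nat \<Rightarrow> real) \<Rightarrow> complex) \<Rightarrow> ((nat \<Rightarrow> real) \<Rightarrow> complex)) \<Rightarrow> bool" where
  "is_intertwining n \<kappa> V \<longleftrightarrow>
     V \<in> extensional (polys n) \<and>
     (\<forall>f\<in>polys n. \<forall>g\<in>polys n. \<forall>a b.
        V (\<lambda>x. a * f x + b * g x) = (\<lambda>x. a * V f x + b * V g x)) \<and>
     (\<forall>m. V ` hom_polys n m \<subseteq> hom_polys n m) \<and>
     V (\<lambda>x. 1) = (\<lambda>x. 1) \<and>
     (\<forall>i\<in>{1..n}. \<forall>f\<in>polys n. dunkl n \<kappa> i (V f) = V (partial i f))"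

definition intertwining ::
  "nat \<Rightarrow> real \<Rightarrow> ((nat \<Rightarrow> real) \<Rightarrow> complex) \<Rightarrow> ((nat \<Rightarrow> real) \<Rightarrow> complex)" where
  "intertwining n \<kappa> = (THE V. is_intertwining n \<kappa> V)"

definition dunkl_kernel :: "nat \<Rightarrow> real \<Rightarrow> (nat \<Rightarrow> real) \<Rightarrow> (nat \<Rightarrow> complex) \<Rightarrow> complex" where
  "dunkl_kernel n \<kappa> x y =
     (\<Sum>m. 1 / fact m *
        intertwining n \<kappa> (\<lambda>z. (\<Sum>i=1..n. complex_of_real (z i) * y i) ^ m) x)"

definition bessel :: "nat \<Rightarrow> real \<Rightarrow> (nat \<Rightarrow> complex) \<Rightarrow> (nat \<Rightarrow> real) \<Rightarrow> complex" where
  "bessel n \<kappa> l x =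
     1 / fact n * (\<Sum>\<sigma> | \<sigma> permutes {1..n}. dunkl_kernel n \<kappa> x (l \<circ> \<sigma>))"

text \<open>
  Meaningful only if \<open>c\<close> is not a nonpositive integer. In particular, with all \<open>b i = \<kappa>\<close> and
  \<open>c = n * \<kappa>\<close> the terms become 0/0 at \<open>\<kappa> = 0\<close>; there the function has to be read as
  its limit for \<open>\<kappa>\<close> tending to 0 from the right.
\<close>

definition humbert :: "nat \<Rightarrow> (nat \<Rightarrow> complex) \<Rightarrow> complex \<Rightarrow> (nat \<Rightarrow> complex) \<Rightarrow> complex" where
  "humbert N b c z =
     (\<Sum>\<^sub>\<infinity>m\<in>multi_indices N.
        (\<Prod>i=1..N. pochhammer (b i) (m i)) / pochhammer c (\<Sum>i=1..N. m i)
          * (\<Prod>i=1..N. z i ^ m i / fact (m i)))"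

end

theory Submission
  imports Defs "HOL-Computational_Algebra.Formal_Power_Series"
begin

text \<open>
  Write \<open>s\<^sub>i\<^sub>j\<close> for the exchange of the coordinates \<open>i\<close> and \<open>j\<close>, and \<open>D\<^sub>i\<close> for the Dunkl
  operators. The proof computes the intertwining operator \<open>V\<close> on the powers of the linear forms
  that occur in the Bessel function and sums up.

  Existence and uniqueness of \<open>V\<close> (\<open>is_intertwining_intertwining\<close>). On homogeneous
  polynomials of degree \<open>m\<close> the Euler-type identity
  \<open>\<Sum>\<^sub>i x\<^sub>i D\<^sub>i = m + \<kappa>/2 \<Sum>\<^sub>i\<^sub>,\<^sub>j (1 - s\<^sub>i\<^sub>j)\<close> holds (\<open>euler_dunkl\<close>). For \<open>m > 0\<close> and \<open>\<kappa> \<ge> 0\<close> the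
  operator on the right is injective by a maximum principle on the orbits of the symmetric group
  (\<open>averaging_imp_zero\<close>), and it is inverted by a Neumann series in the group algebra
  (\<open>euler_inv_eq\<close>). Hence a homogeneous polynomial of positive degree that is annihilated by all
  \<open>D\<^sub>i\<close> is zero, which gives uniqueness and, later on, identifies values of \<open>V\<close> from their
  images under the \<open>D\<^sub>i\<close>. For existence, \<open>V\<close> is defined degree by degree by solving
  \<open>\<Sum>\<^sub>i x\<^sub>i D\<^sub>i (V f) = \<Sum>\<^sub>i x\<^sub>i V (\<partial>\<^sub>i f)\<close>; that the solution satisfies \<open>D\<^sub>i (V f) = V (\<partial>\<^sub>i f)\<close> for
  each single \<open>i\<close> follows from the commutativity of the Dunkl operators and the same maximum
  principle, applied to vectors of polynomials (\<open>dunkl_intertw_part\<close>).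

  The value of \<open>V\<close> on \<open>z\<^sub>k ^ m\<close>. Let \<open>Q = \<Prod>\<^sub>j (1 - x\<^sub>j X)\<^bsup>-\<kappa>\<^esup>\<close> as a formal power series in \<open>X\<close>,
  and let \<open>p\<^sub>k\<^sub>,\<^sub>m\<close> be the coefficient of \<open>X ^ m\<close> in \<open>Q / (1 - x\<^sub>k X)\<close>. A computation with power
  series gives \<open>D\<^sub>i p\<^sub>k\<^sub>,\<^sub>m = 0\<close> for \<open>i \<noteq> k\<close> and \<open>D\<^sub>k p\<^sub>k\<^sub>,\<^sub>m = (m + n \<kappa>) p\<^sub>k\<^sub>,\<^sub>m\<^sub>-\<^sub>1\<close>, so that
  \<open>V (z\<^sub>k ^ m) = m! / (n \<kappa> + 1)\<^sub>m \<cdot> p\<^sub>k\<^sub>,\<^sub>m\<close> (\<open>intertwining_coord_power\<close>). As \<open>V\<close> commutes with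
  multiplication by \<open>z\<^sub>1 + \<dots> + z\<^sub>n\<close>, which vanishes at \<open>x\<close>, the linear form \<open>\<nu> z\<^sub>k\<close> may be replaced
  by \<open>\<nu> z\<^sub>k - \<nu>/n \<cdot> (z\<^sub>1 + \<dots> + z\<^sub>n)\<close> (\<open>intertwining_on_hyperplane\<close>). So the Bessel function is
  the mean over \<open>k\<close> of the series \<open>\<Sum>\<^sub>m \<nu>\<^sup>m p\<^sub>k\<^sub>,\<^sub>m(x) / (n \<kappa> + 1)\<^sub>m\<close>, for every \<open>\<kappa> \<ge> 0\<close>.

  Comparison with the Humbert functions. If \<open>q\<^sub>m\<close> is the coefficient of \<open>X ^ m\<close> in \<open>Q\<close>, then
  \<open>\<kappa> \<Sum>\<^sub>k p\<^sub>k\<^sub>,\<^sub>m = (m + n \<kappa>) q\<^sub>m\<close>, which for \<open>\<kappa> > 0\<close> turns the mean into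
  \<open>\<Sum>\<^sub>m \<nu>\<^sup>m q\<^sub>m(x) / (n \<kappa>)\<^sub>m\<close>. This is the first Humbert function, summed by total degree
  (\<open>humbert_eq_series\<close>). The second form comes from substituting \<open>X / (1 - x\<^sub>n X)\<close> for \<open>X\<close> in
  the generating function and from a Cauchy product (\<open>humbert_shift\<close>). At \<open>\<kappa> = 0\<close> the \<open>m\<close>-th
  term of each of the \<open>n\<close> series is bounded by \<open>(|\<nu>| \<Sum>\<^sub>i |x\<^sub>i|)\<^sup>m / m!\<close> independently of \<open>\<kappa>\<close>, so
  dominated convergence gives the limits.
\<close>

(* The powers and indices below are written with the literal 1, and coordinate
   vectors composed with permutations are rewritten as wholes. *)
declare One_nat_def [simp del]
declare comp_apply [simp del]

section \<open>Polynomials\<close>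

abbreviation monom_fun :: "nat \<Rightarrow> (nat \<Rightarrow> nat) \<Rightarrow> (nat \<Rightarrow> real) \<Rightarrow> complex" where
  "monom_fun n a x \<equiv> (\<Prod>i=1..n. complex_of_real (x i) ^ a i)"

lemma polys_supported_monom:
  "a \<in> M \<Longrightarrow> (\<lambda>x. c * monom_fun n a x) \<in> polys_supported n M"
  unfolding polys_supported_def
  by (rule CollectI, rule exI[of _ "{a}"], rule exI[of _ "\<lambda>_. c"]) auto

lemma polys_supported_zero: "(\<lambda>x. 0) \<in> polys_supported n M"
  unfolding polys_supported_def
  by (rule CollectI, rule exI[of _ "{}"]) auto

lemma polys_supported_add:
  assumes "f \<in> polys_supported n M" "g \<in> polys_supported n M"
  shows "(\<lambda>x. f x + g x) \<in> polys_supported n M"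
proof -
  obtain A c where A: "finite A" "A \<subseteq> M" "f = (\<lambda>x. \<Sum>a\<in>A. c a * monom_fun n a x)"
    using assms(1) unfolding polys_supported_def by blast
  obtain B d where B: "finite B" "B \<subseteq> M" "g = (\<lambda>x. \<Sum>a\<in>B. d a * monom_fun n a x)"
    using assms(2) unfolding polys_supported_def by blast
  define e where "e a = (if a \<in> A then c a else 0) + (if a \<in> B then d a else 0)" for a
  have "f x + g x = (\<Sum>a\<in>A\<union>B. e a * monom_fun n a x)" for x
  proof -
    have "f x = (\<Sum>a\<in>A\<union>B. (if a \<in> A then c a else 0) * monom_fun n a x)"
      unfolding A(3) by (rule sum.mono_neutral_cong_left) (use A B in auto)
    moreover have "g x = (\<Sum>a\<in>A\<union>B. (if a \<in> B then d a else 0) * monom_fun n a x)"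
      unfolding B(3) by (rule sum.mono_neutral_cong_left) (use A B in auto)
    ultimately show ?thesis
      by (simp add: e_def sum.distrib distrib_right)
  qed
  thus ?thesis unfolding polys_supported_def using A B
    by (intro CollectI exI[of _ "A \<union> B"] exI[of _ e]) auto
qed

lemma polys_supported_cmult:
  assumes "f \<in> polys_supported n M"
  shows "(\<lambda>x. c * f x) \<in> polys_supported n M"
proof -
  obtain A d where A: "finite A" "A \<subseteq> M" "f = (\<lambda>x. \<Sum>a\<in>A. d a * monom_fun n a x)"
    using assms unfolding polys_supported_def by blast
  thus ?thesis unfolding polys_supported_def
    by (intro CollectI exI[of _ A] exI[of _ "\<lambda>a. c * d a"]) (auto simp: sum_distrib_left mult_ac)
qed

lemma polys_supported_sum:
  assumes "\<And>i. i \<in> I \<Longrightarrow> f i \<in> polys_supported n M"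
  shows "(\<lambda>x. \<Sum>i\<in>I. f i x) \<in> polys_supported n M"
  using assms
  by (induction I rule: infinite_finite_induct) (auto intro: polys_supported_zero polys_supported_add)

lemma polys_supported_induct [consumes 1, case_names zero monom add]:
  assumes "f \<in> polys_supported n M"
    and "P (\<lambda>x. 0)"
    and "\<And>a c. a \<in> M \<Longrightarrow> P (\<lambda>x. c * monom_fun n a x)"
    and "\<And>f g. f \<in> polys_supported n M \<Longrightarrow> g \<in> polys_supported n M \<Longrightarrow> P f \<Longrightarrow> P g
           \<Longrightarrow> P (\<lambda>x. f x + g x)"
  shows "P f"
proof -
  obtain A d where A: "finite A" "A \<subseteq> M" "f = (\<lambda>x. \<Sum>a\<in>A. d a * monom_fun n a x)"
    using assms unfolding polys_supported_def by blast
  have "P (\<lambda>x. \<Sum>a\<in>A. d a * monom_fun n a x)"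
    using A(1,2)
  proof (induction A)
    case empty
    then show ?case using assms(2) by simp
  next
    case (insert a A)
    have "P (\<lambda>x. d a * monom_fun n a x + (\<Sum>a\<in>A. d a * monom_fun n a x))"
      using insert by (intro assms(4) assms(3) polys_supported_monom polys_supported_sum) auto
    with insert show ?case by simp
  qed
  with A show ?thesis by simp
qed

lemma hom_polys_zero: "(\<lambda>x. 0) \<in> hom_polys n m"
  and polys_zero: "(\<lambda>x. 0) \<in> polys n"
  unfolding hom_polys_def polys_def by (rule polys_supported_zero)+

lemma hom_polys_add: "f \<in> hom_polys n m \<Longrightarrow> g \<in> hom_polys n m \<Longrightarrow> (\<lambda>x. f x + g x) \<in> hom_polys n m"
  and polys_add: "f \<in> polys n \<Longrightarrow> g \<in> polys n \<Longrightarrow> (\<lambda>x. f x + g x) \<in> polys n"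
  unfolding hom_polys_def polys_def by (rule polys_supported_add; simp)+

lemma hom_polys_cmult: "f \<in> hom_polys n m \<Longrightarrow> (\<lambda>x. c * f x) \<in> hom_polys n m"
  and polys_cmult: "f \<in> polys n \<Longrightarrow> (\<lambda>x. c * f x) \<in> polys n"
  unfolding hom_polys_def polys_def by (rule polys_supported_cmult; simp)+

lemma hom_polys_sum:
    "(\<And>i. i \<in> I \<Longrightarrow> f i \<in> hom_polys n m) \<Longrightarrow> (\<lambda>x. \<Sum>i\<in>I. f i x) \<in> hom_polys n m"
  and polys_sum: "(\<And>i. i \<in> I \<Longrightarrow> f i \<in> polys n) \<Longrightarrow> (\<lambda>x. \<Sum>i\<in>I. f i x) \<in> polys n"
  unfolding hom_polys_def polys_def by (rule polys_supported_sum; simp)+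

lemma hom_polys_diff: "f \<in> hom_polys n m \<Longrightarrow> g \<in> hom_polys n m \<Longrightarrow> (\<lambda>x. f x - g x) \<in> hom_polys n m"
  using hom_polys_add[of f n m "\<lambda>x. (-1) * g x"] hom_polys_cmult[of g n m "-1"] by simp

lemma polys_diff: "f \<in> polys n \<Longrightarrow> g \<in> polys n \<Longrightarrow> (\<lambda>x. f x - g x) \<in> polys n"
  using polys_add[of f n "\<lambda>x. (-1) * g x"] polys_cmult[of g n "-1"] by simp

lemma hom_polys_subset: "f \<in> hom_polys n m \<Longrightarrow> f \<in> polys n"
  unfolding hom_polys_def polys_def polys_supported_def by blast

lemma monom_fun_upd_Suc:
  assumes "l \<in> {1..n}"
  shows "monom_fun n (a(l := Suc k)) x = of_real (x l) * monom_fun n (a(l := k)) x"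
proof -
  have "(\<Prod>i\<in>{1..n}-{l}. complex_of_real (x i) ^ (a(l := Suc k)) i)
      = (\<Prod>i\<in>{1..n}-{l}. complex_of_real (x i) ^ (a(l := k)) i)"
    by (rule prod.cong) auto
  thus ?thesis using assms unfolding prod.remove[of "{1..n}" l, OF _ assms, simplified] by (simp add: mult_ac)
qed

lemma sum_fun_upd_Suc:
  fixes a :: "nat \<Rightarrow> nat"
  assumes "l \<in> {1..n}"
  shows "(\<Sum>i=1..n. (a(l := Suc k)) i) = Suc (\<Sum>i=1..n. (a(l := k)) i)"
proof -
  have "(\<Sum>i\<in>{1..n}-{l}. (a(l := Suc k)) i) = (\<Sum>i\<in>{1..n}-{l}. (a(l := k)) i)"
    by (rule sum.cong) auto
  thus ?thesis using assms unfolding sum.remove[of "{1..n}" l, OF _ assms, simplified] by simp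
qed

lemma multi_indices_fun_upd: "a \<in> multi_indices n \<Longrightarrow> l \<in> {1..n} \<Longrightarrow> a(l := k) \<in> multi_indices n"
  by (auto simp: multi_indices_def PiE_def extensional_def)

lemma hom_polys_const: "(\<lambda>x. c) \<in> hom_polys n 0"
proof -
  define a where "a = (\<lambda>i::nat. if i \<in> {1..n} then 0 else undefined :: nat)"
  have "(\<lambda>x. c * monom_fun n a x) \<in> hom_polys n 0"
    unfolding hom_polys_def
    by (rule polys_supported_monom) (auto simp: a_def multi_indices_def)
  thus ?thesis by (simp add: a_def)
qed

lemma polys_const: "(\<lambda>x. c) \<in> polys n"
  using hom_polys_const hom_polys_subset by blast

lemma hom_polys_coord_mult:
  assumes "f \<in> hom_polys n m" "l \<in> {1..n}"
  shows "(\<lambda>x. of_real (x l) * f x) \<in> hom_polys n (Suc m)"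
  using assms(1) unfolding hom_polys_def
proof (induction rule: polys_supported_induct)
  case zero
  then show ?case by (simp add: polys_supported_zero)
next
  case (monom a c)
  have "(\<lambda>x. c * monom_fun n (a(l := Suc (a l))) x) \<in>
          polys_supported n {a \<in> multi_indices n. sum a {1..n} = Suc m}"
    using monom assms(2) sum_fun_upd_Suc[OF assms(2), where a=a and k="a l"]
    by (intro polys_supported_monom CollectI conjI multi_indices_fun_upd) auto
  thus ?case unfolding monom_fun_upd_Suc[OF assms(2)] by (simp add: mult_ac)
next
  case (add f g)
  thus ?case by (simp add: distrib_left polys_supported_add)
qed

lemma hom_polys_coord: "l \<in> {1..n} \<Longrightarrow> (\<lambda>x. of_real (x l)) \<in> hom_polys n (Suc 0)"
  using hom_polys_coord_mult[OF hom_polys_const[of 1]] by simp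

text \<open>
  Homogeneous polynomials arise from constants by multiplication with coordinates and addition.
  This is the induction principle behind almost every closure property and identity below.
\<close>

lemma hom_polys_induct [consumes 1, case_names const coord_mult zero add]:
  assumes f: "f \<in> hom_polys n m"
    and const: "\<And>c. P 0 (\<lambda>x. c)"
    and mult: "\<And>m l f. l \<in> {1..n} \<Longrightarrow> f \<in> hom_polys n m \<Longrightarrow> P m f
           \<Longrightarrow> P (Suc m) (\<lambda>x. of_real (x l) * f x)"
    and zero: "\<And>m. P m (\<lambda>x. 0)"
    and add: "\<And>m f g. f \<in> hom_polys n m \<Longrightarrow> g \<in> hom_polys n m \<Longrightarrow> P m f \<Longrightarrow> P m g
           \<Longrightarrow> P m (\<lambda>x. f x + g x)"
  shows "P m f"
proof -
  have monomial: "P m' (\<lambda>x. c * monom_fun n a x)"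
    if "a \<in> multi_indices n" "(\<Sum>i=1..n. a i) = m'" for a c m'
    using that
  proof (induction m' arbitrary: a)
    case 0
    hence "monom_fun n a x = 1" for x by (intro prod.neutral) auto
    thus ?case using const by simp
  next
    case (Suc m)
    have "\<exists>l\<in>{1..n}. a l \<noteq> 0"
    proof (rule ccontr)
      assume "\<not> ?thesis"
      hence "(\<Sum>i=1..n. a i) = 0" by (intro sum.neutral) auto
      with Suc show False by simp
    qed
    then obtain l k where l: "l \<in> {1..n}" "a l = Suc k" by (metis not0_implies_Suc)
    define b where "b = a(l := k)"
    have ab: "a = b(l := Suc k)" using l by (auto simp: b_def)
    have b: "b \<in> multi_indices n" "b(l := k) = b"
      using Suc l by (auto simp: b_def intro: multi_indices_fun_upd)
    have sb: "(\<Sum>i=1..n. b i) = m"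
      using Suc.prems(2) sum_fun_upd_Suc[OF l(1), where a=b and k=k] ab b by simp
    have "P (Suc m) (\<lambda>x. of_real (x l) * (c * monom_fun n b x))"
      using b sb unfolding hom_polys_def
      by (intro mult[OF l(1)] Suc.IH) (auto simp: hom_polys_def intro: polys_supported_monom)
    thus ?case using monom_fun_upd_Suc[OF l(1), where a=b and k=k] b ab by (simp add: mult_ac)
  qed
  from f show ?thesis unfolding hom_polys_def
  proof (induction rule: polys_supported_induct)
    case zero thus ?case by (rule assms)
  next
    case (monom a c) thus ?case using monomial by simp
  next
    case (add f g) thus ?case using assms(5) by (simp add: hom_polys_def)
  qed
qed

lemma polys_induct_hom [consumes 1, case_names hom add]:
  assumes "f \<in> polys n"
    and "\<And>m f. f \<in> hom_polys n m \<Longrightarrow> P f"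
    and "\<And>f g. f \<in> polys n \<Longrightarrow> g \<in> polys n \<Longrightarrow> P f \<Longrightarrow> P g \<Longrightarrow> P (\<lambda>x. f x + g x)"
  shows "P f"
  using assms(1) unfolding polys_def
proof (induction rule: polys_supported_induct)
  case zero thus ?case using assms(2)[OF hom_polys_zero] .
next
  case (monom a c)
  thus ?case
    by (intro assms(2)[of _ "\<Sum>i=1..n. a i"])
       (auto simp: hom_polys_def intro: polys_supported_monom)
next
  case (add f g) thus ?case using assms(3) by (simp add: polys_def)
qed

lemma polys_coord_mult:
  assumes "f \<in> polys n" "l \<in> {1..n}"
  shows "(\<lambda>x. of_real (x l) * f x) \<in> polys n"
  using assms(1)
proof (induction rule: polys_induct_hom)
  case (hom m f) thus ?case using hom_polys_coord_mult[OF _ assms(2)] hom_polys_subset by blast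
next
  case (add f g) thus ?case by (simp add: distrib_left polys_add)
qed

lemma polys_induct [consumes 1, case_names const coord_mult add]:
  assumes f: "f \<in> polys n"
    and const: "\<And>c. P (\<lambda>x. c)"
    and mult: "\<And>l f. l \<in> {1..n} \<Longrightarrow> f \<in> polys n \<Longrightarrow> P f \<Longrightarrow> P (\<lambda>x. of_real (x l) * f x)"
    and add: "\<And>f g. f \<in> polys n \<Longrightarrow> g \<in> polys n \<Longrightarrow> P f \<Longrightarrow> P g \<Longrightarrow> P (\<lambda>x. f x + g x)"
  shows "P f"
  using f
proof (induction rule: polys_induct_hom)
  case (hom m f)
  thus ?case
    by (induction rule: hom_polys_induct) (auto intro: const mult add dest: hom_polys_subset)
qed (rule add)

lemma hom_polys_mult:
  assumes "f \<in> hom_polys n m" "g \<in> hom_polys n k"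
  shows "(\<lambda>x. f x * g x) \<in> hom_polys n (m + k)"
  using assms(1)
proof (induction rule: hom_polys_induct)
  case (const c) thus ?case using assms(2) by (simp add: hom_polys_cmult)
next
  case (coord_mult m l f)
  thus ?case using hom_polys_coord_mult[of "\<lambda>x. f x * g x" n "m + k" l] by (simp add: mult_ac)
next
  case zero thus ?case by (simp add: hom_polys_zero)
next
  case add thus ?case by (simp add: distrib_right hom_polys_add)
qed

lemma polys_mult:
  assumes "f \<in> polys n" "g \<in> polys n"
  shows "(\<lambda>x. f x * g x) \<in> polys n"
  using assms(1)
proof (induction rule: polys_induct)
  case (const c) thus ?case using assms(2) by (simp add: polys_cmult)
next
  case (coord_mult l f)
  thus ?case using polys_coord_mult[of "\<lambda>x. f x * g x" n l] by (simp add: mult_ac)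
next
  case add thus ?case by (simp add: distrib_right polys_add)
qed

lemma polys_power: "f \<in> polys n \<Longrightarrow> (\<lambda>x. f x ^ m) \<in> polys n"
  by (induction m) (auto intro: polys_const polys_mult)

lemma hom_polys_power: "f \<in> hom_polys n (Suc 0) \<Longrightarrow> (\<lambda>x. f x ^ m) \<in> hom_polys n m"
  using hom_polys_mult[of f n "Suc 0"] by (induction m) (auto intro: hom_polys_const)

lemma hom_polys_permute:
  fixes f :: "(nat \<Rightarrow> real) \<Rightarrow> complex" and \<sigma> :: "nat \<Rightarrow> nat"
  assumes "f \<in> hom_polys n m" "\<sigma> permutes {1..n}"
  shows "(\<lambda>x::nat \<Rightarrow> real. f (x \<circ> \<sigma>)) \<in> hom_polys n m"
  using assms(1)
proof (induction rule: hom_polys_induct)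
  case (coord_mult m l f)
  hence "\<sigma> l \<in> {1..n}" using assms(2) by (metis permutes_in_image)
  thus ?case using coord_mult hom_polys_coord_mult[of "\<lambda>x. f (x \<circ> \<sigma>)" n m "\<sigma> l"] by (simp add: comp_def)
qed (auto intro: hom_polys_const hom_polys_zero hom_polys_add)

lemma polys_permute:
  fixes f :: "(nat \<Rightarrow> real) \<Rightarrow> complex" and \<sigma> :: "nat \<Rightarrow> nat"
  assumes "f \<in> polys n" "\<sigma> permutes {1..n}"
  shows "(\<lambda>x::nat \<Rightarrow> real. f (x \<circ> \<sigma>)) \<in> polys n"
  using assms(1)
proof (induction rule: polys_induct_hom)
  case (hom m f)
  thus ?case using hom_polys_permute[OF hom assms(2)] hom_polys_subset by blast
qed (rule polys_add)

lemma hom_polys_0_const: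
  assumes "f \<in> hom_polys n 0"
  obtains c where "f = (\<lambda>x. c)"
proof -
  have "m = 0 \<Longrightarrow> \<exists>c. f = (\<lambda>x. c)" if "f \<in> hom_polys n m" for m
    using that by (induction rule: hom_polys_induct) auto
  thus ?thesis using assms that by blast
qed

section \<open>Partial derivatives and difference quotients\<close>

abbreviation tr :: "nat \<Rightarrow> nat \<Rightarrow> nat \<Rightarrow> nat" where
  "tr \<equiv> Transposition.transpose"

lemma swap_coords: "x(i := x j, j := x i) = x \<circ> tr i j"
  by (auto simp: fun_eq_iff comp_apply Transposition.transpose_def)

lemma tr_permutes: "i \<in> {1..n} \<Longrightarrow> j \<in> {1..n} \<Longrightarrow> tr i j permutes {1..n}"
  by (rule permutes_swap_id)

lemma polys_has_partial:
  assumes "f \<in> polys n"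
  shows "((\<lambda>t. f (x(i := t))) has_vector_derivative partial i f x) (at (x i))"
proof -
  have "(\<lambda>t. f (x(i := t))) differentiable (at (x i))"
    using assms
  proof (induction rule: polys_induct)
    case (coord_mult l f)
    have "(\<lambda>t. complex_of_real ((x(i := t)) l)) differentiable (at (x i))"
    proof (cases "l = i")
      case True
      have "(complex_of_real has_vector_derivative 1) (at (x i))"
        by (auto intro!: derivative_eq_intros)
      thus ?thesis using True by (auto simp: differentiable_def has_vector_derivative_def)
    qed auto
    with coord_mult show ?case by (intro differentiable_mult)
  qed auto
  thus ?thesis unfolding partial_def by (simp add: vector_derivative_works)
qed

lemma partial_eqI:
  "((\<lambda>t. f (x(i := t))) has_vector_derivative D) (at (x i)) \<Longrightarrow> partial i f x = D"
  unfolding partial_def by (rule vector_derivative_at)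

lemma partial_const: "partial i (\<lambda>x. c) x = 0"
  by (rule partial_eqI) auto

lemma partial_add:
  "f \<in> polys n \<Longrightarrow> g \<in> polys n \<Longrightarrow> partial i (\<lambda>x. f x + g x) x = partial i f x + partial i g x"
  by (rule partial_eqI) (intro has_vector_derivative_add polys_has_partial)

lemma partial_cmult: "f \<in> polys n \<Longrightarrow> partial i (\<lambda>x. c * f x) x = c * partial i f x"
  by (rule partial_eqI) (intro has_vector_derivative_mult_right polys_has_partial)

lemma partial_coord_mult:
  assumes "f \<in> polys n"
  shows "partial i (\<lambda>x. of_real (x l) * f x) x = of_real (x l) * partial i f x + (if i = l then f x else 0)"
proof (rule partial_eqI)
  have "((\<lambda>t. complex_of_real ((x(i := t)) l)) has_vector_derivative (if i = l then 1 else 0)) (at (x i))"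
    by (auto intro!: derivative_eq_intros)
  from has_vector_derivative_mult[OF this polys_has_partial[OF assms, of x i]]
  show "((\<lambda>t. of_real ((x(i := t)) l) * f (x(i := t))) has_vector_derivative
     of_real (x l) * partial i f x + (if i = l then f x else 0)) (at (x i))"
    by (cases "i = l") (simp_all add: add_ac)
qed

lemma diff_quot_add:
  "f \<in> polys n \<Longrightarrow> g \<in> polys n \<Longrightarrow> diff_quot i j (\<lambda>x. f x + g x) x = diff_quot i j f x + diff_quot i j g x"
  unfolding diff_quot_def by (simp add: partial_add add_divide_distrib[symmetric] algebra_simps)

lemma diff_quot_cmult:
  "f \<in> polys n \<Longrightarrow> diff_quot i j (\<lambda>x. c * f x) x = c * diff_quot i j f x"
  unfolding diff_quot_def by (simp add: partial_cmult algebra_simps)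

lemma diff_quot_coord_mult:
  assumes "f \<in> polys n" "i \<noteq> j"
  shows "diff_quot i j (\<lambda>x. of_real (x l) * f x) x = of_real (x l) * diff_quot i j f x
     + (if l = i then f (x \<circ> tr i j) else if l = j then - f (x \<circ> tr i j) else 0)"
proof (cases "x i = x j")
  case True
  hence "x \<circ> tr i j = x" by (auto simp: fun_eq_iff comp_apply Transposition.transpose_def)
  thus ?thesis using True assms(2)
    by (auto simp: diff_quot_def partial_coord_mult[OF assms(1)] right_diff_distrib)
next
  case False
  have tri: "(x \<circ> tr i j) i = x j" "(x \<circ> tr i j) j = x i" "l \<noteq> i \<Longrightarrow> l \<noteq> j \<Longrightarrow> (x \<circ> tr i j) l = x l"
    by (auto simp: comp_apply)
  from False have "complex_of_real (x i) - of_real (x j) \<noteq> 0" by simp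
  with False assms(2) show ?thesis
    unfolding diff_quot_def swap_coords by (auto simp: tri field_simps)
qed

lemma diff_quot_const: "diff_quot i j (\<lambda>x. c) x = 0"
  by (simp add: diff_quot_def partial_const)

lemma dunkl_const: "dunkl n \<kappa> i (\<lambda>x. c) = (\<lambda>x. 0)"
  by (simp add: fun_eq_iff dunkl_def diff_quot_const partial_const)

lemma dunkl_add:
  "f \<in> polys n \<Longrightarrow> g \<in> polys n \<Longrightarrow>
     dunkl n \<kappa> i (\<lambda>x. f x + g x) = (\<lambda>x. dunkl n \<kappa> i f x + dunkl n \<kappa> i g x)"
  by (simp add: fun_eq_iff dunkl_def diff_quot_add partial_add sum.distrib algebra_simps)

lemma dunkl_cmult:
  "f \<in> polys n \<Longrightarrow> dunkl n \<kappa> i (\<lambda>x. c * f x) = (\<lambda>x. c * dunkl n \<kappa> i f x)"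
  by (simp add: fun_eq_iff dunkl_def diff_quot_cmult partial_cmult sum_distrib_left algebra_simps)

lemma dunkl_diff:
  "f \<in> polys n \<Longrightarrow> g \<in> polys n \<Longrightarrow>
     dunkl n \<kappa> i (\<lambda>x. f x - g x) = (\<lambda>x. dunkl n \<kappa> i f x - dunkl n \<kappa> i g x)"
  using dunkl_add[of f n "\<lambda>x. (-1) * g x" \<kappa> i] dunkl_cmult[of g n \<kappa> i "-1"] polys_cmult[of g n "-1"]
  by simp

lemma dunkl_sum:
  "(\<And>k. k \<in> K \<Longrightarrow> f k \<in> polys n) \<Longrightarrow>
     dunkl n \<kappa> i (\<lambda>x. \<Sum>k\<in>K. f k x) = (\<lambda>x. \<Sum>k\<in>K. dunkl n \<kappa> i (f k) x)"
proof (induction K rule: infinite_finite_induct)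
  case (insert k K)
  have "dunkl n \<kappa> i (\<lambda>x. f k x + (\<Sum>k\<in>K. f k x)) =
     (\<lambda>x. dunkl n \<kappa> i (f k) x + dunkl n \<kappa> i (\<lambda>x. \<Sum>k\<in>K. f k x) x)"
    using insert by (intro dunkl_add polys_sum) auto
  thus ?case using insert by simp
qed (auto simp: dunkl_const)

section \<open>Dunkl operators commute\<close>

text \<open>
  The commutator of \<open>D\<^sub>i\<close> with the multiplication by the \<open>l\<close>-th coordinate.
\<close>

definition dunkl_comm :: "nat \<Rightarrow> real \<Rightarrow> nat \<Rightarrow> nat \<Rightarrow> ((nat \<Rightarrow> real) \<Rightarrow> complex) \<Rightarrow> (nat \<Rightarrow> real) \<Rightarrow> complex" where
  "dunkl_comm n \<kappa> i l f x =
     (if i = l then f x + of_real \<kappa> * (\<Sum>k\<in>{1..n}-{i}. f (x \<circ> tr i k))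
      else - of_real \<kappa> * f (x \<circ> tr i l))"

lemma dunkl_coord_mult:
  assumes "f \<in> polys n" "i \<in> {1..n}" "l \<in> {1..n}"
  shows "dunkl n \<kappa> i (\<lambda>x. of_real (x l) * f x) =
     (\<lambda>x. of_real (x l) * dunkl n \<kappa> i f x + dunkl_comm n \<kappa> i l f x)"
proof
  fix x
  let ?g = "\<lambda>j. if l = i then f (x \<circ> tr i j) else if l = j then - f (x \<circ> tr i j) else 0"
  have "(\<Sum>j\<in>{1..n}-{i}. diff_quot i j (\<lambda>x. of_real (x l) * f x) x) =
     (\<Sum>j\<in>{1..n}-{i}. of_real (x l) * diff_quot i j f x + ?g j)"
    by (intro sum.cong diff_quot_coord_mult[OF assms(1)]) auto
  also have "\<dots> = of_real (x l) * (\<Sum>j\<in>{1..n}-{i}. diff_quot i j f x) + (\<Sum>j\<in>{1..n}-{i}. ?g j)"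
    by (simp only: sum.distrib sum_distrib_left)
  also have "(\<Sum>j\<in>{1..n}-{i}. ?g j) =
     (if l = i then (\<Sum>j\<in>{1..n}-{i}. f (x \<circ> tr i j)) else - f (x \<circ> tr i l))"
    using assms by (auto simp: sum.delta)
  finally show "dunkl n \<kappa> i (\<lambda>x. of_real (x l) * f x) x =
      of_real (x l) * dunkl n \<kappa> i f x + dunkl_comm n \<kappa> i l f x"
    unfolding dunkl_def dunkl_comm_def partial_coord_mult[OF assms(1)]
    by (simp add: algebra_simps)
qed

lemma dunkl_comm_hom:
  assumes "f \<in> hom_polys n m" "i \<in> {1..n}" "l \<in> {1..n}"
  shows "dunkl_comm n \<kappa> i l f \<in> hom_polys n m"
proof (cases "i = l")
  case True
  have "(\<lambda>x. f x + of_real \<kappa> * (\<Sum>k\<in>{1..n}-{i}. f (x \<circ> tr i k))) \<in> hom_polys n m"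
    using assms by (intro hom_polys_add hom_polys_cmult hom_polys_sum hom_polys_permute tr_permutes) auto
  thus ?thesis using True unfolding dunkl_comm_def by simp
next
  case False
  have "(\<lambda>x. - of_real \<kappa> * f (x \<circ> tr i l)) \<in> hom_polys n m"
    using assms by (intro hom_polys_cmult hom_polys_permute tr_permutes) auto
  thus ?thesis using False unfolding dunkl_comm_def by simp
qed

lemma dunkl_hom:
  assumes "f \<in> hom_polys n m" "i \<in> {1..n}"
  shows "(m = 0 \<longrightarrow> dunkl n \<kappa> i f = (\<lambda>x. 0)) \<and> (\<forall>k. m = Suc k \<longrightarrow> dunkl n \<kappa> i f \<in> hom_polys n k)"
  using assms(1)
proof (induction rule: hom_polys_induct)
  case (coord_mult m l f)
  have eq: "dunkl n \<kappa> i (\<lambda>x. of_real (x l) * f x) =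
     (\<lambda>x. of_real (x l) * dunkl n \<kappa> i f x + dunkl_comm n \<kappa> i l f x)"
    using coord_mult assms(2) by (intro dunkl_coord_mult) (auto dest: hom_polys_subset)
  have "dunkl_comm n \<kappa> i l f \<in> hom_polys n m" using coord_mult assms(2) by (intro dunkl_comm_hom)
  moreover have "(\<lambda>x. of_real (x l) * dunkl n \<kappa> i f x) \<in> hom_polys n m"
  proof (cases m)
    case 0
    with coord_mult show ?thesis by (simp add: hom_polys_zero)
  next
    case (Suc k)
    with coord_mult show ?thesis using hom_polys_coord_mult by simp
  qed
  ultimately show ?case unfolding eq by (auto intro: hom_polys_add)
next
  case (add m f g)
  have "dunkl n \<kappa> i (\<lambda>x. f x + g x) = (\<lambda>x. dunkl n \<kappa> i f x + dunkl n \<kappa> i g x)"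
    using add by (intro dunkl_add) (auto dest: hom_polys_subset)
  thus ?case using add by (auto intro: hom_polys_add)
qed (auto simp: dunkl_const hom_polys_zero)

lemma dunkl_hom_0: "f \<in> hom_polys n 0 \<Longrightarrow> i \<in> {1..n} \<Longrightarrow> dunkl n \<kappa> i f = (\<lambda>x. 0)"
  and dunkl_hom_Suc: "f \<in> hom_polys n (Suc m) \<Longrightarrow> i \<in> {1..n} \<Longrightarrow> dunkl n \<kappa> i f \<in> hom_polys n m"
  using dunkl_hom by blast+

lemma dunkl_polys:
  assumes "f \<in> polys n" "i \<in> {1..n}"
  shows "dunkl n \<kappa> i f \<in> polys n"
  using assms(1)
proof (induction rule: polys_induct_hom)
  case (hom m f)
  thus ?case using dunkl_hom_0[of f n i \<kappa>] dunkl_hom_Suc[of f n _ i \<kappa>] assms(2)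
    by (cases m) (auto simp: polys_zero intro: hom_polys_subset)
next
  case (add f g)
  thus ?case by (simp add: dunkl_add polys_add)
qed

text \<open>
  For \<open>\<kappa> = 0\<close> the Dunkl operators are the partial derivatives, so every fact about Dunkl operators
  specializes.
\<close>

lemma dunkl_zero_kappa: "dunkl n 0 i f = partial i f"
  by (simp add: dunkl_def fun_eq_iff)

lemma partial_swap:
  fixes f :: "(nat \<Rightarrow> real) \<Rightarrow> complex"
  shows "partial i (\<lambda>x. f (x \<circ> tr a b)) x = partial (tr a b i) f (x \<circ> tr a b)"
proof -
  have "(x \<circ> tr a b) (tr a b i) = x i" by (simp add: comp_apply)
  moreover
  have "x(i := t) \<circ> tr a b = (x \<circ> tr a b)(tr a b i := t)" for t
    by (auto simp: fun_eq_iff comp_apply Transposition.transpose_def)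
  ultimately show ?thesis unfolding partial_def by simp
qed

lemma diff_quot_swap:
  fixes f :: "(nat \<Rightarrow> real) \<Rightarrow> complex"
  shows "diff_quot i j (\<lambda>x. f (x \<circ> tr a b)) x = diff_quot (tr a b i) (tr a b j) f (x \<circ> tr a b)"
proof -
  have 1: "(x \<circ> tr i j) \<circ> tr a b = (x \<circ> tr a b) \<circ> tr (tr a b i) (tr a b j)"
    by (auto simp: fun_eq_iff comp_apply Transposition.transpose_def)
  have 2: "(x \<circ> tr a b) (tr a b k) = x k" for k by (simp add: comp_apply)
  show ?thesis unfolding diff_quot_def swap_coords partial_swap unfolding 1 unfolding 2 ..
qed

lemma dunkl_swap:
  fixes f :: "(nat \<Rightarrow> real) \<Rightarrow> complex"
  assumes "a \<in> {1..n}" "b \<in> {1..n}"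
  shows "dunkl n \<kappa> i (\<lambda>x. f (x \<circ> tr a b)) = (\<lambda>x. dunkl n \<kappa> (tr a b i) f (x \<circ> tr a b))"
proof
  fix x
  have "(\<Sum>j\<in>{1..n}-{i}. diff_quot (tr a b i) (tr a b j) f (x \<circ> tr a b)) =
     (\<Sum>j\<in>{1..n}-{tr a b i}. diff_quot (tr a b i) j f (x \<circ> tr a b))"
  proof (rule sum.reindex_bij_witness[of _ "tr a b" "tr a b"])
    have *: "tr a b j \<in> {1..n} \<longleftrightarrow> j \<in> {1..n}" for j
      using permutes_in_image[OF tr_permutes[OF assms]] .
    show "tr a b j \<in> {1..n} - {i}" if "j \<in> {1..n} - {tr a b i}" for j
      using that unfolding Diff_iff * by (metis insert_iff empty_iff transpose_involutory)
    show "tr a b j \<in> {1..n} - {tr a b i}" if "j \<in> {1..n} - {i}" for j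
      using that unfolding Diff_iff * by (metis insert_iff empty_iff transpose_involutory)
  qed simp_all
  thus "dunkl n \<kappa> i (\<lambda>x. f (x \<circ> tr a b)) x = dunkl n \<kappa> (tr a b i) f (x \<circ> tr a b)"
    unfolding dunkl_def partial_swap diff_quot_swap by simp
qed

lemma dunkl_dunkl_comm:
  assumes "f \<in> polys n" "i \<in> {1..n}" "j \<in> {1..n}" "l \<in> {1..n}"
  shows "dunkl n \<kappa> i (dunkl_comm n \<kappa> j l f) x =
    (if j = l then dunkl n \<kappa> i f x + of_real \<kappa> * (\<Sum>k\<in>{1..n}-{j}. dunkl n \<kappa> (tr j k i) f (x \<circ> tr j k))
     else - of_real \<kappa> * dunkl n \<kappa> (tr j l i) f (x \<circ> tr j l))"
proof (cases "j = l")
  case True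
  have p: "(\<lambda>x. f (x \<circ> tr j k)) \<in> polys n" if "k \<in> {1..n}" for k
    using assms that by (intro polys_permute tr_permutes)
  have "dunkl n \<kappa> i (\<lambda>x. f x + of_real \<kappa> * (\<Sum>k\<in>{1..n}-{j}. f (x \<circ> tr j k))) x =
    dunkl n \<kappa> i f x + of_real \<kappa> * (\<Sum>k\<in>{1..n}-{j}. dunkl n \<kappa> i (\<lambda>x. f (x \<circ> tr j k)) x)"
  proof -
    have q: "(\<lambda>x. \<Sum>k\<in>{1..n}-{j}. f (x \<circ> tr j k)) \<in> polys n"
      using p by (intro polys_sum) auto
    show ?thesis
      unfolding dunkl_add[OF assms(1) polys_cmult[OF q]] dunkl_cmult[OF q]
      using p by (subst dunkl_sum) auto
  qed
  also have "(\<Sum>k\<in>{1..n}-{j}. dunkl n \<kappa> i (\<lambda>x. f (x \<circ> tr j k)) x) =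
     (\<Sum>k\<in>{1..n}-{j}. dunkl n \<kappa> (tr j k i) f (x \<circ> tr j k))"
    using assms by (intro sum.cong refl) (subst dunkl_swap, auto)
  finally show ?thesis using True by (simp add: dunkl_comm_def[abs_def])
next
  case False
  have "dunkl n \<kappa> i (\<lambda>x. - of_real \<kappa> * f (x \<circ> tr j l)) x =
      - of_real \<kappa> * dunkl n \<kappa> i (\<lambda>x. f (x \<circ> tr j l)) x"
    using assms by (intro dunkl_cmult[THEN fun_cong] polys_permute tr_permutes)
  also have "dunkl n \<kappa> i (\<lambda>x. f (x \<circ> tr j l)) x = dunkl n \<kappa> (tr j l i) f (x \<circ> tr j l)"
    using assms by (subst dunkl_swap) auto
  finally show ?thesis using False by (simp add: dunkl_comm_def[abs_def])
qed

text \<open>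
  In terms of commutators this is \<open>[D\<^sub>i, [D\<^sub>j, x\<^sub>l]] = [D\<^sub>j, [D\<^sub>i, x\<^sub>l]]\<close>. By the Jacobi identity,
  \<open>[D\<^sub>i, D\<^sub>j]\<close> therefore commutes with all coordinates; since it also annihilates constants, it vanishes.
\<close>

lemma dunkl_comm_jacobi:
  assumes "f \<in> polys n" "i \<in> {1..n}" "j \<in> {1..n}" "l \<in> {1..n}" "i \<noteq> j"
  shows "dunkl_comm n \<kappa> i l (dunkl n \<kappa> j f) x + dunkl n \<kappa> i (dunkl_comm n \<kappa> j l f) x =
         dunkl_comm n \<kappa> j l (dunkl n \<kappa> i f) x + dunkl n \<kappa> j (dunkl_comm n \<kappa> i l f) x"
proof -
  have *: "dunkl_comm n \<kappa> i j (dunkl n \<kappa> j f) x + dunkl n \<kappa> i (dunkl_comm n \<kappa> j j f) x =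
         dunkl_comm n \<kappa> j j (dunkl n \<kappa> i f) x + dunkl n \<kappa> j (dunkl_comm n \<kappa> i j f) x"
    if "i \<in> {1..n}" "j \<in> {1..n}" "i \<noteq> j" for i j
  proof -
    have "(\<Sum>k\<in>{1..n}-{j}. dunkl n \<kappa> (tr j k i) f (x \<circ> tr j k)) =
       dunkl n \<kappa> j f (x \<circ> tr j i) + (\<Sum>k\<in>{1..n}-{j}-{i}. dunkl n \<kappa> (tr j k i) f (x \<circ> tr j k))"
      using that by (subst sum.remove[of _ i]) auto
    moreover have "(\<Sum>k\<in>{1..n}-{j}. dunkl n \<kappa> i f (x \<circ> tr j k)) =
       dunkl n \<kappa> i f (x \<circ> tr j i) + (\<Sum>k\<in>{1..n}-{j}-{i}. dunkl n \<kappa> i f (x \<circ> tr j k))"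
      using that by (subst sum.remove[of _ i]) auto
    moreover have "(\<Sum>k\<in>{1..n}-{j}-{i}. dunkl n \<kappa> (tr j k i) f (x \<circ> tr j k)) =
       (\<Sum>k\<in>{1..n}-{j}-{i}. dunkl n \<kappa> i f (x \<circ> tr j k))"
      using that by (intro sum.cong) auto
    moreover have "dunkl n \<kappa> i (dunkl_comm n \<kappa> j j f) x =
        dunkl n \<kappa> i f x + of_real \<kappa> * (\<Sum>k\<in>{1..n}-{j}. dunkl n \<kappa> (tr j k i) f (x \<circ> tr j k))"
      using dunkl_dunkl_comm[OF assms(1) that(1,2,2)] by (simp only: refl if_True)
    moreover have "dunkl n \<kappa> j (dunkl_comm n \<kappa> i j f) x = - of_real \<kappa> * dunkl n \<kappa> i f (x \<circ> tr j i)"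
      using dunkl_dunkl_comm[OF assms(1) that(2,1,2)] that(3)
      by (simp add: Transposition.transpose_commute[of i j])
    moreover have "dunkl_comm n \<kappa> i j (dunkl n \<kappa> j f) x = - of_real \<kappa> * dunkl n \<kappa> j f (x \<circ> tr j i)"
      using that(3) by (simp add: dunkl_comm_def Transposition.transpose_commute[of i j])
    moreover have "dunkl_comm n \<kappa> j j (dunkl n \<kappa> i f) x =
        dunkl n \<kappa> i f x + of_real \<kappa> * (\<Sum>k\<in>{1..n}-{j}. dunkl n \<kappa> i f (x \<circ> tr j k))"
      by (simp only: dunkl_comm_def refl if_True)
    ultimately show ?thesis by (simp only: distrib_left mult_minus_left) simp
  qed
  consider "l = j" | "l = i" | "l \<noteq> i" "l \<noteq> j" by blast
  thus ?thesis
  proof cases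
    case 1 thus ?thesis using *[OF assms(2,3,5)] by (simp only:)
  next
    case 2 thus ?thesis using *[OF assms(3,2) assms(5)[symmetric]] by (simp only:)
  next
    case 3
    thus ?thesis using assms(5) unfolding dunkl_dunkl_comm[OF assms(1,2,3,4)] dunkl_dunkl_comm[OF assms(1,3,2,4)]
      by (simp add: dunkl_comm_def)
  qed
qed

lemma dunkl_commute:
  assumes "f \<in> polys n" "i \<in> {1..n}" "j \<in> {1..n}"
  shows "dunkl n \<kappa> i (dunkl n \<kappa> j f) = dunkl n \<kappa> j (dunkl n \<kappa> i f)"
proof (cases "i = j")
  case False
  show ?thesis using assms(1)
  proof (induction rule: polys_induct)
    case (const c) thus ?case by (simp add: dunkl_const)
  next
    case (add f g)
    thus ?case using assms by (simp add: dunkl_add dunkl_polys)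
  next
    case (coord_mult l f)
    have C: "dunkl_comm n \<kappa> j l f \<in> polys n" if "j \<in> {1..n}" for j
      using coord_mult(2)
    proof (induction rule: polys_induct_hom)
      case (hom m f) thus ?case using coord_mult that by (intro hom_polys_subset[OF dunkl_comm_hom])
    next
      case (add f g)
      have "dunkl_comm n \<kappa> j l (\<lambda>x. f x + g x) = (\<lambda>x. dunkl_comm n \<kappa> j l f x + dunkl_comm n \<kappa> j l g x)"
        by (simp add: fun_eq_iff dunkl_comm_def sum.distrib algebra_simps)
      with add show ?case by (simp add: polys_add)
    qed
    have *: "dunkl n \<kappa> i (dunkl n \<kappa> j (\<lambda>x. of_real (x l) * f x)) x =
       of_real (x l) * dunkl n \<kappa> i (dunkl n \<kappa> j f) x
       + (dunkl_comm n \<kappa> i l (dunkl n \<kappa> j f) x + dunkl n \<kappa> i (dunkl_comm n \<kappa> j l f) x)"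
      if "i \<in> {1..n}" "j \<in> {1..n}" for i j x
      using coord_mult that C
      by (simp add: dunkl_coord_mult dunkl_add dunkl_polys polys_coord_mult)
    show ?case
      using coord_mult assms False dunkl_comm_jacobi[OF coord_mult(2) assms(2,3) coord_mult(1) False, of \<kappa>]
      by (intro ext) (simp add: *)
  qed
qed auto

lemma partial_polys: "f \<in> polys n \<Longrightarrow> i \<in> {1..n} \<Longrightarrow> partial i f \<in> polys n"
  using dunkl_polys[of f n i 0] by (simp add: dunkl_zero_kappa)

lemma partial_hom_0: "f \<in> hom_polys n 0 \<Longrightarrow> i \<in> {1..n} \<Longrightarrow> partial i f = (\<lambda>x. 0)"
  using dunkl_hom_0[of f n i 0] by (simp add: dunkl_zero_kappa)

lemma partial_hom_Suc: "f \<in> hom_polys n (Suc m) \<Longrightarrow> i \<in> {1..n} \<Longrightarrow> partial i f \<in> hom_polys n m"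
  using dunkl_hom_Suc[of f n m i 0] by (simp add: dunkl_zero_kappa)

lemma partial_commute:
  "f \<in> polys n \<Longrightarrow> i \<in> {1..n} \<Longrightarrow> j \<in> {1..n} \<Longrightarrow> partial i (partial j f) = partial j (partial i f)"
  using dunkl_commute[of f n i j 0] by (simp add: dunkl_zero_kappa)

section \<open>The Euler identity and the common kernel of the Dunkl operators\<close>

lemma euler_partial:
  assumes "f \<in> hom_polys n m"
  shows "(\<Sum>i=1..n. of_real (x i) * partial i f x) = of_nat m * f x"
  using assms
proof (induction rule: hom_polys_induct)
  case (coord_mult m l f)
  have "(\<Sum>i=1..n. of_real (x i) * partial i (\<lambda>x. of_real (x l) * f x) x) =
     (\<Sum>i=1..n. of_real (x l) * (of_real (x i) * partial i f x) + (if i = l then of_real (x l) * f x else 0))"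
    unfolding partial_coord_mult[OF hom_polys_subset[OF coord_mult(2)]]
    by (intro sum.cong) (auto simp: algebra_simps)
  also have "\<dots> = of_nat (Suc m) * (of_real (x l) * f x)"
    using coord_mult unfolding sum.distrib sum_distrib_left[symmetric] by (simp add: algebra_simps)
  finally show ?case .
next
  case (add m f g)
  have "partial i (\<lambda>x. f x + g x) x = partial i f x + partial i g x" for i
    using add by (intro partial_add) (auto dest: hom_polys_subset)
  thus ?case using add by (simp add: algebra_simps sum.distrib)
qed (auto simp: partial_const)

lemma sum_sum_antisym:
  fixes a :: "nat \<Rightarrow> nat \<Rightarrow> complex"
  assumes "\<And>i j. i \<in> A \<Longrightarrow> j \<in> A \<Longrightarrow> a j i = - a i j"
  shows "2 * (\<Sum>i\<in>A. \<Sum>j\<in>A. c i * a i j) = (\<Sum>i\<in>A. \<Sum>j\<in>A. (c i - c j) * a i j)"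
proof -
  have "(\<Sum>i\<in>A. \<Sum>j\<in>A. c i * a i j) = (\<Sum>i\<in>A. \<Sum>j\<in>A. c j * a j i)"
    by (rule sum.swap)
  also have "\<dots> = (\<Sum>i\<in>A. \<Sum>j\<in>A. - (c j * a i j))"
  proof (intro sum.cong refl)
    fix i j assume "i \<in> A" "j \<in> A"
    show "c j * a j i = - (c j * a i j)"
      unfolding assms[OF \<open>i \<in> A\<close> \<open>j \<in> A\<close>] by simp
  qed
  finally have "(\<Sum>i\<in>A. \<Sum>j\<in>A. c i * a i j) = (\<Sum>i\<in>A. \<Sum>j\<in>A. - (c j * a i j))" .
  hence "2 * (\<Sum>i\<in>A. \<Sum>j\<in>A. c i * a i j) = (\<Sum>i\<in>A. \<Sum>j\<in>A. c i * a i j) + (\<Sum>i\<in>A. \<Sum>j\<in>A. - (c j * a i j))"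
    by simp
  thus ?thesis by (simp only: sum.distrib[symmetric]) (simp add: left_diff_distrib)
qed

text \<open>
  The sum runs over ordered pairs, including the diagonal, on which the summand is zero; hence the
  factor \<open>\<kappa> / 2\<close>.
\<close>

lemma euler_dunkl:
  assumes "f \<in> hom_polys n m"
  shows "(\<Sum>i=1..n. of_real (x i) * dunkl n \<kappa> i f x) =
     of_nat m * f x + of_real \<kappa> / 2 * (\<Sum>i=1..n. \<Sum>j=1..n. f x - f (x \<circ> tr i j))"
proof -
  define a where "a i j = diff_quot i j f x" for i j
  have a0: "a i i = 0" for i by (simp add: a_def diff_quot_def)
  have anti: "a j i = - a i j" for i j
    unfolding a_def diff_quot_def swap_coords Transposition.transpose_commute[of j i]
    by (simp add: minus_divide_right)
  have ax: "of_real (x i - x j) * a i j = f x - f (x \<circ> tr i j)" for i j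
  proof (cases "x i = x j")
    case True
    hence "x \<circ> tr i j = x" by (auto simp: fun_eq_iff comp_apply Transposition.transpose_def)
    thus ?thesis using True by simp
  next
    case False
    thus ?thesis unfolding a_def diff_quot_def swap_coords by simp
  qed
  have "(\<Sum>i=1..n. of_real (x i) * dunkl n \<kappa> i f x) =
     (\<Sum>i=1..n. of_real (x i) * partial i f x) + of_real \<kappa> * (\<Sum>i=1..n. of_real (x i) * (\<Sum>j\<in>{1..n}-{i}. a i j))"
    unfolding dunkl_def a_def[symmetric] by (simp add: distrib_left sum.distrib sum_distrib_left mult.left_commute)
  also have "(\<Sum>i=1..n. of_real (x i) * (\<Sum>j\<in>{1..n}-{i}. a i j)) = (\<Sum>i=1..n. \<Sum>j=1..n. of_real (x i) * a i j)"
  proof (intro sum.cong refl)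
    fix i assume "i \<in> {1..n}"
    thus "of_real (x i) * (\<Sum>j\<in>{1..n}-{i}. a i j) = (\<Sum>j=1..n. of_real (x i) * a i j)"
      using sum.remove[of "{1..n}" i "\<lambda>j. of_real (x i) * a i j"] by (simp add: a0 sum_distrib_left)
  qed
  also have "\<dots> = (\<Sum>i=1..n. \<Sum>j=1..n. f x - f (x \<circ> tr i j)) / 2"
    using sum_sum_antisym[of "{1..n}" a "\<lambda>i. of_real (x i)", OF anti]
    unfolding of_real_diff[symmetric] ax by (simp add: mult.commute)
  finally show ?thesis using euler_partial[OF assms] by (simp add: algebra_simps)
qed

text \<open>
  A maximum principle: \<open>u\<close> is bounded by a proper fraction of its own maximum.
\<close>

lemma averaging_imp_zero:
  fixes u :: "'a \<Rightarrow> complex" and \<kappa> c :: real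
  assumes "finite S" "\<kappa> \<ge> 0" "c > \<kappa> / 2 * real (n * n)"
    and T: "\<And>i k s. i \<in> {1..n} \<Longrightarrow> k \<in> {1..n} \<Longrightarrow> s \<in> S \<Longrightarrow> T i k s \<in> S"
    and avg: "\<And>s. s \<in> S \<Longrightarrow> of_real c * u s = of_real (\<kappa> / 2) * (\<Sum>i=1..n. \<Sum>k=1..n. u (T i k s))"
    and "s \<in> S"
  shows "u s = 0"
proof -
  define M where "M = Max ((\<lambda>s. norm (u s)) ` S)"
  have le: "norm (u s) \<le> M" if "s \<in> S" for s
    unfolding M_def using assms(1) that by (intro Max_ge) auto
  have "M \<in> (\<lambda>s. norm (u s)) ` S"
    unfolding M_def using assms(1,6) by (intro Max_in) auto
  then obtain t where t: "t \<in> S" "M = norm (u t)" by auto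
  have c: "c > 0" using assms(2,3) by (smt (verit) mult_nonneg_nonneg of_nat_0_le_iff divide_nonneg_nonneg)
  have "c * M = norm (of_real c * u t)" using c t by (simp add: norm_mult)
  also have "\<dots> = \<kappa> / 2 * norm (\<Sum>i=1..n. \<Sum>k=1..n. u (T i k t))"
    unfolding avg[OF t(1)] norm_mult using assms(2) by simp
  also have "norm (\<Sum>i=1..n. \<Sum>k=1..n. u (T i k t)) \<le> (\<Sum>i=1..n. \<Sum>k=1..n. M)"
    by (intro sum_norm_le le T t) auto
  also have "(\<Sum>i=1..n. \<Sum>k=1..n. M) = real (n * n) * M" by simp
  finally have "c * M \<le> \<kappa> / 2 * (real (n * n) * M)" using assms(2) by (simp add: mult_left_mono)
  hence "(c - \<kappa> / 2 * real (n * n)) * M \<le> 0" by (simp add: algebra_simps)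
  hence "M \<le> 0" using assms(3) by (simp add: mult_le_0_iff)
  hence "norm (u s) \<le> 0" using le[OF assms(6)] by linarith
  thus ?thesis by simp
qed

lemma hom_poly_zero_if_dunkl_zero:
  assumes "\<kappa> \<ge> 0" and h: "h \<in> hom_polys n (Suc m)"
    and D: "\<And>i. i \<in> {1..n} \<Longrightarrow> dunkl n \<kappa> i h = (\<lambda>x. 0)"
  shows "h = (\<lambda>x. 0)"
proof
  fix x
  define c where "c = real (Suc m) + \<kappa> / 2 * real (n * n)"
  have eq: "of_real c * h y = of_real (\<kappa> / 2) * (\<Sum>i=1..n. \<Sum>k=1..n. h (y \<circ> tr i k))" for y
  proof -
    have "(0::complex) = of_nat (Suc m) * h y + of_real \<kappa> / 2 * (\<Sum>i=1..n. \<Sum>j=1..n. h y - h (y \<circ> tr i j))"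
      using euler_dunkl[OF h, of y \<kappa>] D by simp
    also have "(\<Sum>i=1..n. \<Sum>j=1..n. h y - h (y \<circ> tr i j)) =
       of_nat (n * n) * h y - (\<Sum>i=1..n. \<Sum>j=1..n. h (y \<circ> tr i j))"
      by (simp add: sum_subtractf)
    finally show ?thesis by (simp add: c_def algebra_simps)
  qed
  have "h (x \<circ> id) = 0"
  proof (rule averaging_imp_zero[where S = "{\<sigma>. \<sigma> permutes {1..n}}" and u = "\<lambda>\<sigma>. h (x \<circ> \<sigma>)"
        and T = "\<lambda>i k \<sigma>. \<sigma> \<circ> tr i k" and \<kappa> = \<kappa> and c = c and n = n])
    show "of_real c * h (x \<circ> s) = of_real (\<kappa> / 2) * (\<Sum>i=1..n. \<Sum>k=1..n. h (x \<circ> (s \<circ> tr i k)))" for s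
      using eq[of "x \<circ> s"] by (simp only: comp_assoc)
    show "s \<circ> tr i k \<in> {\<sigma>. \<sigma> permutes {1..n}}"
      if "i \<in> {1..n}" "k \<in> {1..n}" "s \<in> {\<sigma>. \<sigma> permutes {1..n}}" for i k s
      using that by (intro CollectI permutes_compose tr_permutes) auto
  qed (use assms in \<open>auto simp: c_def permutes_id intro: finite_permutations\<close>)
  thus "h x = 0" by simp
qed

section \<open>Inversion of the Euler operator\<close>

text \<open>
  The number of words of length \<open>k\<close> in the ordered pairs \<open>(i, j)\<close> whose product of exchanges is the
  permutation \<open>\<sigma>\<close>.
\<close>

primrec swap_words :: "nat \<Rightarrow> nat \<Rightarrow> (nat \<Rightarrow> nat) \<Rightarrow> real" where
  "swap_words n 0 \<sigma> = (if \<sigma> = id then 1 else 0)"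
| "swap_words n (Suc k) \<sigma> = (\<Sum>i=1..n. \<Sum>j=1..n. swap_words n k (tr i j \<circ> \<sigma>))"

lemma swap_words_bound: "\<bar>swap_words n k \<sigma>\<bar> \<le> real (n * n) ^ k"
proof (induction k arbitrary: \<sigma>)
  case (Suc k)
  have "\<bar>swap_words n (Suc k) \<sigma>\<bar> \<le> (\<Sum>i=1..n. \<Sum>j=1..n. real (n * n) ^ k)"
    unfolding swap_words.simps real_norm_def[symmetric]
    by (intro sum_norm_le) (use Suc in auto)
  thus ?case by simp
qed auto

text \<open>
  The coefficients of the inverse of \<open>c - \<kappa>/2 \<Sum>\<^sub>i\<^sub>,\<^sub>j s\<^sub>i\<^sub>j\<close> in the group algebra of the symmetric
  group, given by the Neumann series, which converges for \<open>c > \<kappa> n\<^sup>2 / 2\<close>.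
\<close>

definition neumann_coeff :: "nat \<Rightarrow> real \<Rightarrow> real \<Rightarrow> (nat \<Rightarrow> nat) \<Rightarrow> real" where
  "neumann_coeff n \<kappa> c \<sigma> = (\<Sum>k. (\<kappa> / 2) ^ k / c ^ Suc k * swap_words n k \<sigma>)"

lemma neumann_coeff_summable:
  assumes "\<kappa> \<ge> 0" "c > \<kappa> / 2 * real (n * n)"
  shows "summable (\<lambda>k. (\<kappa> / 2) ^ k / c ^ Suc k * swap_words n k \<sigma>)"
proof (rule summable_comparison_test')
  have c: "c > 0" using assms by (smt (verit) mult_nonneg_nonneg of_nat_0_le_iff divide_nonneg_nonneg)
  let ?r = "\<kappa> / 2 * real (n * n) / c"
  have "0 \<le> ?r" "?r < 1" using assms c by auto
  thus "summable (\<lambda>k. ?r ^ k * (1 / c))"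
    by (intro summable_mult2 summable_geometric) auto
  show "norm ((\<kappa> / 2) ^ k / c ^ Suc k * swap_words n k \<sigma>) \<le> ?r ^ k * (1 / c)" for k
  proof -
    have "norm ((\<kappa> / 2) ^ k / c ^ Suc k * swap_words n k \<sigma>) = (\<kappa> / 2) ^ k / c ^ Suc k * \<bar>swap_words n k \<sigma>\<bar>"
      using assms c by (simp add: abs_mult)
    also have "\<dots> \<le> (\<kappa> / 2) ^ k / c ^ Suc k * real (n * n) ^ k"
      using assms c by (intro mult_left_mono swap_words_bound) auto
    also have "\<dots> = ?r ^ k * (1 / c)"
      using c by (simp add: power_divide power_mult_distrib)
    finally show ?thesis .
  qed
qed

lemma neumann_coeff_eq:
  assumes "\<kappa> \<ge> 0" "c > \<kappa> / 2 * real (n * n)"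
  shows "c * neumann_coeff n \<kappa> c \<sigma> - \<kappa> / 2 * (\<Sum>i=1..n. \<Sum>j=1..n. neumann_coeff n \<kappa> c (tr i j \<circ> \<sigma>)) =
     (if \<sigma> = id then 1 else 0)"
proof -
  have c: "c > 0" using assms by (smt (verit) mult_nonneg_nonneg of_nat_0_le_iff divide_nonneg_nonneg)
  note sm = neumann_coeff_summable[OF assms]
  let ?a = "\<lambda>k. (\<kappa> / 2) ^ k / c ^ Suc k"
  have "(\<Sum>i=1..n. \<Sum>j=1..n. neumann_coeff n \<kappa> c (tr i j \<circ> \<sigma>)) =
     (\<Sum>k. \<Sum>i=1..n. \<Sum>j=1..n. ?a k * swap_words n k (tr i j \<circ> \<sigma>))"
  proof -
    have "(\<Sum>i=1..n. \<Sum>j=1..n. neumann_coeff n \<kappa> c (tr i j \<circ> \<sigma>)) =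
       (\<Sum>i=1..n. \<Sum>k. \<Sum>j=1..n. ?a k * swap_words n k (tr i j \<circ> \<sigma>))"
      unfolding neumann_coeff_def by (intro sum.cong refl suminf_sum[symmetric] sm)
    also have "\<dots> = (\<Sum>k. \<Sum>i=1..n. \<Sum>j=1..n. ?a k * swap_words n k (tr i j \<circ> \<sigma>))"
      by (intro suminf_sum[symmetric] summable_sum sm)
    finally show ?thesis .
  qed
  also have "\<dots> = (\<Sum>k. ?a k * swap_words n (Suc k) \<sigma>)"
    by (simp add: sum_distrib_left)
  finally have 1: "(\<Sum>i=1..n. \<Sum>j=1..n. neumann_coeff n \<kappa> c (tr i j \<circ> \<sigma>)) = (\<Sum>k. ?a k * swap_words n (Suc k) \<sigma>)" .
  have sm1: "summable (\<lambda>k. ?a k * swap_words n (Suc k) \<sigma>)"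
    using summable_sum[of "{1..n}" "\<lambda>i k. \<Sum>j=1..n. ?a k * swap_words n k (tr i j \<circ> \<sigma>)", OF summable_sum[OF sm]]
    by (simp add: sum_distrib_left)
  have "\<kappa> / 2 * (\<Sum>k. ?a k * swap_words n (Suc k) \<sigma>) = (\<Sum>k. \<kappa> / 2 * (?a k * swap_words n (Suc k) \<sigma>))"
    by (rule suminf_mult[OF sm1, symmetric])
  also have "\<dots> = (\<Sum>k. c * (?a (Suc k) * swap_words n (Suc k) \<sigma>))"
    using c by (intro suminf_cong) (simp add: field_simps)
  also have "\<dots> = c * (\<Sum>k. ?a (Suc k) * swap_words n (Suc k) \<sigma>)"
    using summable_ignore_initial_segment[OF sm[of \<sigma>], of 1] by (subst suminf_mult) (auto simp: One_nat_def)
  also have "(\<Sum>k. ?a (Suc k) * swap_words n (Suc k) \<sigma>) = neumann_coeff n \<kappa> c \<sigma> - ?a 0 * swap_words n 0 \<sigma>"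
    unfolding neumann_coeff_def by (rule suminf_split_head[OF sm])
  finally show ?thesis unfolding 1 using c by (simp add: algebra_simps)
qed

text \<open>
  The inverse of the operator \<open>m + \<kappa>/2 \<Sum>\<^sub>i\<^sub>,\<^sub>j (1 - s\<^sub>i\<^sub>j)\<close> of \<open>euler_dunkl\<close>.
\<close>

definition euler_inv :: "nat \<Rightarrow> real \<Rightarrow> nat \<Rightarrow> ((nat \<Rightarrow> real) \<Rightarrow> complex) \<Rightarrow> (nat \<Rightarrow> real) \<Rightarrow> complex" where
  "euler_inv n \<kappa> m g x =
     (\<Sum>\<sigma> | \<sigma> permutes {1..n}. of_real (neumann_coeff n \<kappa> (real m + \<kappa> / 2 * real (n * n)) \<sigma>) * g (x \<circ> \<sigma>))"

lemma euler_inv_hom: "g \<in> hom_polys n k \<Longrightarrow> euler_inv n \<kappa> m g \<in> hom_polys n k"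
  unfolding euler_inv_def[abs_def]
  by (intro hom_polys_sum hom_polys_cmult hom_polys_permute) auto

lemma euler_inv_linear:
  "euler_inv n \<kappa> m (\<lambda>x. a * f x + b * g x) = (\<lambda>x. a * euler_inv n \<kappa> m f x + b * euler_inv n \<kappa> m g x)"
  by (simp add: fun_eq_iff euler_inv_def sum_distrib_left sum.distrib algebra_simps)

lemma sum_swap_permutes:
  assumes "i \<in> {1..n}" "j \<in> {1..n}"
  shows "(\<Sum>\<sigma> | \<sigma> permutes {1..n}. f \<sigma>) = (\<Sum>\<sigma> | \<sigma> permutes {1..n}. f (tr i j \<circ> \<sigma>))"
  by (rule sum.reindex_bij_witness[of _ "\<lambda>\<sigma>. tr i j \<circ> \<sigma>" "\<lambda>\<sigma>. tr i j \<circ> \<sigma>"])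
     (use tr_permutes[OF assms] in \<open>auto simp: comp_assoc[symmetric] intro!: permutes_compose\<close>)

lemma euler_inv_eq:
  assumes "\<kappa> \<ge> 0" "m > 0"
  shows "of_nat m * euler_inv n \<kappa> m g x + of_real \<kappa> / 2 *
     (\<Sum>i=1..n. \<Sum>j=1..n. euler_inv n \<kappa> m g x - euler_inv n \<kappa> m g (x \<circ> tr i j)) = g x"
proof -
  define c where "c = real m + \<kappa> / 2 * real (n * n)"
  define b where "b = neumann_coeff n \<kappa> c"
  have c: "c > \<kappa> / 2 * real (n * n)" using assms by (simp add: c_def)
  let ?P = "{\<sigma>. \<sigma> permutes {1..n}}"
  have e: "euler_inv n \<kappa> m g x = (\<Sum>\<sigma>\<in>?P. of_real (b \<sigma>) * g (x \<circ> \<sigma>))" for x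
    by (simp add: euler_inv_def b_def c_def)
  have "(\<Sum>i=1..n. \<Sum>j=1..n. euler_inv n \<kappa> m g (x \<circ> tr i j)) =
     (\<Sum>i=1..n. \<Sum>j=1..n. \<Sum>\<sigma>\<in>?P. of_real (b (tr i j \<circ> \<sigma>)) * g (x \<circ> \<sigma>))"
  proof (intro sum.cong refl)
    fix i j assume ij: "i \<in> {1..n}" "j \<in> {1..n}"
    have "euler_inv n \<kappa> m g (x \<circ> tr i j) = (\<Sum>\<sigma>\<in>?P. of_real (b \<sigma>) * g (x \<circ> (tr i j \<circ> \<sigma>)))"
      by (simp only: e comp_assoc)
    also have "\<dots> = (\<Sum>\<sigma>\<in>?P. of_real (b (tr i j \<circ> \<sigma>)) * g (x \<circ> (tr i j \<circ> (tr i j \<circ> \<sigma>))))"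
      by (rule sum_swap_permutes[OF ij])
    also have "\<dots> = (\<Sum>\<sigma>\<in>?P. of_real (b (tr i j \<circ> \<sigma>)) * g (x \<circ> \<sigma>))"
      by (simp add: comp_assoc[symmetric, of "tr i j"])
    finally show "euler_inv n \<kappa> m g (x \<circ> tr i j) = \<dots>" .
  qed
  also have "\<dots> = (\<Sum>i=1..n. \<Sum>\<sigma>\<in>?P. \<Sum>j=1..n. of_real (b (tr i j \<circ> \<sigma>)) * g (x \<circ> \<sigma>))"
    by (intro sum.cong refl sum.swap)
  also have "\<dots> = (\<Sum>\<sigma>\<in>?P. \<Sum>i=1..n. \<Sum>j=1..n. of_real (b (tr i j \<circ> \<sigma>)) * g (x \<circ> \<sigma>))"
    by (rule sum.swap)
  also have "\<dots> = (\<Sum>\<sigma>\<in>?P. of_real (\<Sum>i=1..n. \<Sum>j=1..n. b (tr i j \<circ> \<sigma>)) * g (x \<circ> \<sigma>))"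
    by (simp add: sum_distrib_right)
  finally have 1: "(\<Sum>i=1..n. \<Sum>j=1..n. euler_inv n \<kappa> m g (x \<circ> tr i j)) =
     (\<Sum>\<sigma>\<in>?P. of_real (\<Sum>i=1..n. \<Sum>j=1..n. b (tr i j \<circ> \<sigma>)) * g (x \<circ> \<sigma>))" .
  have "of_nat m * euler_inv n \<kappa> m g x + of_real \<kappa> / 2 *
     (\<Sum>i=1..n. \<Sum>j=1..n. euler_inv n \<kappa> m g x - euler_inv n \<kappa> m g (x \<circ> tr i j)) =
     of_real c * euler_inv n \<kappa> m g x - of_real (\<kappa> / 2) * (\<Sum>i=1..n. \<Sum>j=1..n. euler_inv n \<kappa> m g (x \<circ> tr i j))"
    by (simp add: sum_subtractf c_def algebra_simps)
  also have "\<dots> = (\<Sum>\<sigma>\<in>?P. of_real (c * b \<sigma> - \<kappa> / 2 * (\<Sum>i=1..n. \<Sum>j=1..n. b (tr i j \<circ> \<sigma>))) * g (x \<circ> \<sigma>))"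
  proof -
    have "of_real c * euler_inv n \<kappa> m g x - of_real (\<kappa> / 2) * (\<Sum>i=1..n. \<Sum>j=1..n. euler_inv n \<kappa> m g (x \<circ> tr i j)) =
       (\<Sum>\<sigma>\<in>?P. of_real c * (of_real (b \<sigma>) * g (x \<circ> \<sigma>)) -
          of_real (\<kappa> / 2) * (of_real (\<Sum>i=1..n. \<Sum>j=1..n. b (tr i j \<circ> \<sigma>)) * g (x \<circ> \<sigma>)))"
      unfolding 1 unfolding e by (simp only: sum_distrib_left sum_subtractf)
    also have "\<dots> = (\<Sum>\<sigma>\<in>?P. of_real (c * b \<sigma> - \<kappa> / 2 * (\<Sum>i=1..n. \<Sum>j=1..n. b (tr i j \<circ> \<sigma>))) * g (x \<circ> \<sigma>))"
      by (intro sum.cong refl) (simp only: of_real_diff of_real_mult left_diff_distrib mult.assoc)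
    finally show ?thesis .
  qed
  also have "\<dots> = (\<Sum>\<sigma>\<in>?P. if \<sigma> = id then g x else 0)"
    unfolding b_def neumann_coeff_eq[OF assms(1) c] by (intro sum.cong) auto
  also have "\<dots> = g x" by (simp add: finite_permutations permutes_id)
  finally show ?thesis .
qed

section \<open>Existence of the intertwining operator\<close>

text \<open>
  The component of the intertwining operator in degree \<open>m\<close>. The recursion ends with the evaluation
  at the origin, so that only the homogeneous part of degree \<open>m\<close> of the argument contributes, and
  no decomposition of polynomials into homogeneous parts has to be chosen.
\<close>

primrec intertw_part :: "nat \<Rightarrow> real \<Rightarrow> nat \<Rightarrow> ((nat \<Rightarrow> real) \<Rightarrow> complex) \<Rightarrow> (nat \<Rightarrow> real) \<Rightarrow> complex" where
  "intertw_part n \<kappa> 0 f = (\<lambda>x. f (\<lambda>_. 0))"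
| "intertw_part n \<kappa> (Suc m) f = euler_inv n \<kappa> (Suc m) (\<lambda>x. \<Sum>i=1..n. of_real (x i) * intertw_part n \<kappa> m (partial i f) x)"

lemma intertw_part_hom: "f \<in> polys n \<Longrightarrow> intertw_part n \<kappa> m f \<in> hom_polys n m"
proof (induction m arbitrary: f)
  case (Suc m)
  thus ?case by (auto intro!: euler_inv_hom hom_polys_sum hom_polys_coord_mult partial_polys)
qed (auto intro: hom_polys_const)

lemma intertw_part_linear:
  "f \<in> polys n \<Longrightarrow> g \<in> polys n \<Longrightarrow>
     intertw_part n \<kappa> m (\<lambda>x. a * f x + b * g x) = (\<lambda>x. a * intertw_part n \<kappa> m f x + b * intertw_part n \<kappa> m g x)"
proof (induction m arbitrary: f g)
  case (Suc m)
  have eq: "partial i (\<lambda>x. a * f x + b * g x) = (\<lambda>x. a * partial i f x + b * partial i g x)" for i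
    unfolding partial_add[OF polys_cmult[OF Suc.prems(1)] polys_cmult[OF Suc.prems(2)]]
      partial_cmult[OF Suc.prems(1)] partial_cmult[OF Suc.prems(2)] ..
  have "(\<lambda>x. \<Sum>i=1..n. of_real (x i) * intertw_part n \<kappa> m (\<lambda>x. a * partial i f x + b * partial i g x) x) =
     (\<lambda>x. a * (\<Sum>i=1..n. of_real (x i) * intertw_part n \<kappa> m (partial i f) x)
       + b * (\<Sum>i=1..n. of_real (x i) * intertw_part n \<kappa> m (partial i g) x))"
    using Suc.prems
    by (simp add: fun_eq_iff Suc.IH partial_polys sum_distrib_left sum.distrib[symmetric] distrib_left mult_ac)
  thus ?case unfolding intertw_part.simps eq euler_inv_linear[symmetric] by simp
qed auto

lemma hom_polys_at_zero:
  assumes "f \<in> hom_polys n m" "m > 0"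
  shows "f (\<lambda>_. 0) = 0"
  using assms by (induction rule: hom_polys_induct) auto

lemma intertw_part_zero: "intertw_part n \<kappa> m (\<lambda>x. 0) = (\<lambda>x. 0)"
  using intertw_part_linear[of "\<lambda>x. 0" n "\<lambda>x. 0" \<kappa> m 0 0] by (simp add: polys_zero)

lemma intertw_part_hom_neq:
  "f \<in> hom_polys n k \<Longrightarrow> k \<noteq> m \<Longrightarrow> intertw_part n \<kappa> m f = (\<lambda>x. 0)"
proof (induction m arbitrary: f k)
  case 0 thus ?case by (simp add: hom_polys_at_zero)
next
  case (Suc m)
  have "intertw_part n \<kappa> m (partial i f) = (\<lambda>x. 0)" if "i \<in> {1..n}" for i
  proof (cases k)
    case 0
    thus ?thesis using partial_hom_0[of f n i] Suc.prems that by (simp add: intertw_part_zero)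
  next
    case (Suc k')
    thus ?thesis using partial_hom_Suc[of f n k' i] Suc.prems Suc.IH[of _ k'] that by simp
  qed
  thus ?case by (simp add: euler_inv_def fun_eq_iff)
qed

lemma dunkl_intertw_part_sym:
  assumes "f \<in> polys n" "i \<in> {1..n}" "j \<in> {1..n}" "\<And>f i. f \<in> polys n \<Longrightarrow> i \<in> {1..n} \<Longrightarrow>
     (m = 0 \<longrightarrow> dunkl n \<kappa> i (intertw_part n \<kappa> m f) = (\<lambda>x. 0)) \<and>
     (\<forall>k. m = Suc k \<longrightarrow> dunkl n \<kappa> i (intertw_part n \<kappa> m f) = intertw_part n \<kappa> k (partial i f))"
  shows "dunkl n \<kappa> i (intertw_part n \<kappa> m (partial j f)) = dunkl n \<kappa> j (intertw_part n \<kappa> m (partial i f))"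
  using assms(4)[OF partial_polys[OF assms(1,2)] assms(3)] assms(4)[OF partial_polys[OF assms(1,3)] assms(2)]
    partial_commute[OF assms(1-3)] by (cases m) auto

text \<open>
  The exchange of the index \<open>j\<close> under \<open>s\<^sub>i\<^sub>k\<close> only affects the pairs that contain \<open>j\<close>.
\<close>

lemma sum_swapped_index:
  fixes w :: "nat \<Rightarrow> nat \<Rightarrow> nat \<Rightarrow> complex"
  assumes "j \<in> {1..n}" and sym: "\<And>i k l. w i k l = w k i l"
  shows "(\<Sum>i=1..n. \<Sum>k=1..n. w i k (tr i k j)) =
     (\<Sum>i=1..n. \<Sum>k=1..n. w i k j) + 2 * (\<Sum>k\<in>{1..n}-{j}. w j k k - w j k j)"
proof -
  have eq: "w i k (tr i k j) = w i k j + (if i = j then w j k k - w j k j else 0)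
      + (if k = j then w j i i - w j i j else 0)" for i k
  proof -
    consider "i = j" | "k = j" "i \<noteq> j" | "i \<noteq> j" "k \<noteq> j" by blast
    thus ?thesis
    proof cases
      case 2 thus ?thesis using sym[of i j i] sym[of i j j] by simp
    qed auto
  qed
  have "(\<Sum>i=1..n. \<Sum>k=1..n. w i k (tr i k j)) = (\<Sum>i=1..n. \<Sum>k=1..n. w i k j)
      + (\<Sum>i=1..n. \<Sum>k=1..n. if i = j then w j k k - w j k j else 0)
      + (\<Sum>i=1..n. \<Sum>k=1..n. if k = j then w j i i - w j i j else 0)"
    unfolding eq by (simp add: sum.distrib)
  also have "(\<Sum>i=1..n. \<Sum>k=1..n. if i = j then w j k k - w j k j else 0) =
     (\<Sum>k=1..n. \<Sum>i=1..n. if i = j then w j k k - w j k j else 0)" by (rule sum.swap)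
  finally show ?thesis using assms(1)
    by (simp add: sum.delta sum.remove[of "{1..n}" j "\<lambda>k. w j k k - w j k j"])
qed

text \<open>
  The two implications treat the degrees \<open>0\<close> and \<open>m > 0\<close> together, in the form needed for the
  induction.
\<close>

lemma dunkl_intertw_part:
  assumes "\<kappa> \<ge> 0"
  shows "f \<in> polys n \<Longrightarrow> i \<in> {1..n} \<Longrightarrow>
     (m = 0 \<longrightarrow> dunkl n \<kappa> i (intertw_part n \<kappa> m f) = (\<lambda>x. 0)) \<and>
     (\<forall>k. m = Suc k \<longrightarrow> dunkl n \<kappa> i (intertw_part n \<kappa> m f) = intertw_part n \<kappa> k (partial i f))"
proof (induction m arbitrary: f i)
  case 0
  thus ?case by (simp add: dunkl_const)
next
  case (Suc m)
  define h where "h = intertw_part n \<kappa> (Suc m) f"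
  define g where "g i = intertw_part n \<kappa> m (partial i f)" for i
  \<comment> \<open>The defect of the intertwining relation, to be shown to vanish.\<close>
  define u where "u i = (\<lambda>x. dunkl n \<kappa> i h x - g i x)" for i
  have hh: "h \<in> hom_polys n (Suc m)" unfolding h_def using Suc.prems by (intro intertw_part_hom)
  have gh: "g i \<in> hom_polys n m" if "i \<in> {1..n}" for i
    unfolding g_def using Suc.prems that by (intro intertw_part_hom partial_polys)
  have Dh: "dunkl n \<kappa> i h \<in> hom_polys n m" if "i \<in> {1..n}" for i
    using dunkl_hom_Suc[OF hh that] .
  have uh: "u i \<in> hom_polys n m" if "i \<in> {1..n}" for i
    unfolding u_def using gh Dh that by (intro hom_polys_diff)
  note up = hom_polys_subset[OF uh]
  have usym: "dunkl n \<kappa> j (u i) = dunkl n \<kappa> i (u j)" if "i \<in> {1..n}" "j \<in> {1..n}" for i j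
  proof -
    have "dunkl n \<kappa> j (g i) = dunkl n \<kappa> i (g j)" unfolding g_def
      using dunkl_intertw_part_sym[OF Suc.prems(1) that(2,1) Suc.IH] .
    moreover have "dunkl n \<kappa> j (dunkl n \<kappa> i h) = dunkl n \<kappa> i (dunkl n \<kappa> j h)"
      using that hh by (intro dunkl_commute hom_polys_subset)
    ultimately show ?thesis
      unfolding u_def dunkl_diff[OF hom_polys_subset[OF Dh[OF that(1)]] hom_polys_subset[OF gh[OF that(1)]]]
          dunkl_diff[OF hom_polys_subset[OF Dh[OF that(2)]] hom_polys_subset[OF gh[OF that(2)]]] by simp
  qed
  \<comment> \<open>By construction of \<open>h\<close>. Applying \<open>D\<^sub>j\<close> to this yields an averaging equation for \<open>u\<close>.\<close>
  have u0: "(\<Sum>i=1..n. of_real (x i) * u i x) = 0" for x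
  proof -
    have "(\<Sum>i=1..n. of_real (x i) * dunkl n \<kappa> i h x) = (\<Sum>i=1..n. of_real (x i) * g i x)"
      unfolding euler_dunkl[OF hh] unfolding h_def intertw_part.simps g_def[symmetric]
      using euler_inv_eq[OF assms, of "Suc m" n] by simp
    thus ?thesis by (simp add: u_def right_diff_distrib sum_subtractf)
  qed
  define c where "c = real (Suc m) + \<kappa> / 2 * real (n * n)"
  have avg: "of_real c * u j x = of_real (\<kappa> / 2) * (\<Sum>i=1..n. \<Sum>k=1..n. u (tr i k j) (x \<circ> tr i k))"
    if j: "j \<in> {1..n}" for j x
  proof -
    have "dunkl n \<kappa> j (\<lambda>x. \<Sum>i=1..n. of_real (x i) * u i x) x =
       (\<Sum>i=1..n. dunkl n \<kappa> j (\<lambda>x. of_real (x i) * u i x) x)"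
      using up by (subst dunkl_sum) (auto intro: polys_coord_mult)
    hence "0 = (\<Sum>i=1..n. dunkl n \<kappa> j (\<lambda>x. of_real (x i) * u i x) x)"
      unfolding u0 dunkl_const by simp
    also have "\<dots> = (\<Sum>i=1..n. of_real (x i) * dunkl n \<kappa> i (u j) x + dunkl_comm n \<kappa> j i (u i) x)"
      using j up usym by (intro sum.cong refl) (simp add: dunkl_coord_mult)
    also have "\<dots> = (\<Sum>i=1..n. of_real (x i) * dunkl n \<kappa> i (u j) x) + (\<Sum>i=1..n. dunkl_comm n \<kappa> j i (u i) x)"
      by (rule sum.distrib)
    also have "(\<Sum>i=1..n. of_real (x i) * dunkl n \<kappa> i (u j) x) =
       of_nat m * u j x + of_real \<kappa> / 2 * (\<Sum>i=1..n. \<Sum>k=1..n. u j x - u j (x \<circ> tr i k))"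
      by (rule euler_dunkl[OF uh[OF j]])
    also have "(\<Sum>i=1..n. \<Sum>k=1..n. u j x - u j (x \<circ> tr i k)) =
       of_nat (n * n) * u j x - (\<Sum>i=1..n. \<Sum>k=1..n. u j (x \<circ> tr i k))"
      by (simp add: sum_subtractf)
    also have "(\<Sum>i=1..n. dunkl_comm n \<kappa> j i (u i) x) =
       u j x + of_real \<kappa> * (\<Sum>k\<in>{1..n}-{j}. u j (x \<circ> tr j k))
        + (\<Sum>i\<in>{1..n}-{j}. - of_real \<kappa> * u i (x \<circ> tr j i))"
      using j by (subst sum.remove[of _ j]) (auto simp: dunkl_comm_def intro!: sum.cong)
    also have "\<dots> = u j x - of_real \<kappa> * (\<Sum>k\<in>{1..n}-{j}. u k (x \<circ> tr j k) - u j (x \<circ> tr j k))"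
      by (simp only: sum_subtractf sum_distrib_left[symmetric]) (simp add: algebra_simps)
    also have "\<dots> = u j x - of_real \<kappa> / 2 * (2 * (\<Sum>k\<in>{1..n}-{j}. u k (x \<circ> tr j k) - u j (x \<circ> tr j k)))"
      by simp
    also have "2 * (\<Sum>k\<in>{1..n}-{j}. u k (x \<circ> tr j k) - u j (x \<circ> tr j k)) =
      (\<Sum>i=1..n. \<Sum>k=1..n. u (tr i k j) (x \<circ> tr i k)) - (\<Sum>i=1..n. \<Sum>k=1..n. u j (x \<circ> tr i k))"
      using sum_swapped_index[OF j, of "\<lambda>i k l. u l (x \<circ> tr i k)"]
      by (simp add: Transposition.transpose_commute)
    finally show ?thesis by (simp add: c_def algebra_simps)
  qed
  have "u i x = 0" if "i \<in> {1..n}" for i x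
  proof -
    have "(\<lambda>(\<sigma>, j). u j (x \<circ> \<sigma>)) (id, i) = 0"
    proof (rule averaging_imp_zero[where S = "{\<sigma>. \<sigma> permutes {1..n}} \<times> {1..n}" and u = "\<lambda>(\<sigma>, j). u j (x \<circ> \<sigma>)"
        and T = "\<lambda>i k (\<sigma>, j). (\<sigma> \<circ> tr i k, tr i k j)" and \<kappa> = \<kappa> and c = c and n = n])
      fix s assume s: "s \<in> {\<sigma>. \<sigma> permutes {1..n}} \<times> {1..n}"
      obtain \<sigma> j where sj: "s = (\<sigma>, j)" "j \<in> {1..n}" "\<sigma> permutes {1..n}" using s by auto
      show "of_real c * (case s of (\<sigma>, j) \<Rightarrow> u j (x \<circ> \<sigma>)) =
         of_real (\<kappa> / 2) * (\<Sum>i=1..n. \<Sum>k=1..n. case case s of (\<sigma>, j) \<Rightarrow> (\<sigma> \<circ> tr i k, tr i k j) of (\<sigma>, j) \<Rightarrow> u j (x \<circ> \<sigma>))"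
        using avg[OF sj(2), of "x \<circ> \<sigma>"] unfolding sj(1) prod.case comp_assoc .
      fix i k assume ik: "i \<in> {1..n}" "k \<in> {1..n}"
      show "(case s of (\<sigma>, j) \<Rightarrow> (\<sigma> \<circ> tr i k, tr i k j)) \<in> {\<sigma>. \<sigma> permutes {1..n}} \<times> {1..n}"
        unfolding sj(1) prod.case using permutes_in_image[OF tr_permutes[OF ik], of j] sj(2,3)
          permutes_compose[OF tr_permutes[OF ik] sj(3)] by blast
    qed (use assms that in \<open>auto simp: c_def permutes_id intro: finite_permutations\<close>)
    thus ?thesis by simp
  qed
  hence "dunkl n \<kappa> i h = g i" using Suc.prems(2) by (auto simp: u_def fun_eq_iff)
  thus ?case by (simp add: h_def g_def del: intertw_part.simps)
qed

lemma dunkl_intertw_part_Suc: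
  "\<kappa> \<ge> 0 \<Longrightarrow> f \<in> polys n \<Longrightarrow> i \<in> {1..n} \<Longrightarrow> dunkl n \<kappa> i (intertw_part n \<kappa> (Suc m) f) = intertw_part n \<kappa> m (partial i f)"
  using dunkl_intertw_part by blast

lemma dunkl_intertw_part_0: "dunkl n \<kappa> i (intertw_part n \<kappa> 0 f) = (\<lambda>x. 0)"
  by (simp add: dunkl_const)

lemma intertw_part_eventually_zero:
  assumes "f \<in> polys n"
  shows "\<exists>M. \<forall>m>M. intertw_part n \<kappa> m f = (\<lambda>x. 0)"
  using assms
proof (induction rule: polys_induct_hom)
  case (hom k f)
  thus ?case using intertw_part_hom_neq by (metis nat_neq_iff)
next
  case (add f g)
  then obtain M N where "\<forall>m>M. intertw_part n \<kappa> m f = (\<lambda>x. 0)" "\<forall>m>N. intertw_part n \<kappa> m g = (\<lambda>x. 0)" by blast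
  thus ?case using intertw_part_linear[OF add(1,2), of \<kappa> _ 1 1] by (intro exI[of _ "max M N"]) auto
qed

text \<open>
  The sum of the homogeneous components; only finitely many of them are nonzero on a polynomial.
\<close>

definition intertw :: "nat \<Rightarrow> real \<Rightarrow> ((nat \<Rightarrow> real) \<Rightarrow> complex) \<Rightarrow> (nat \<Rightarrow> real) \<Rightarrow> complex" where
  "intertw n \<kappa> = (\<lambda>f\<in>polys n. \<lambda>x. \<Sum>m | intertw_part n \<kappa> m f \<noteq> (\<lambda>x. 0). intertw_part n \<kappa> m f x)"

lemma intertw_eq:
  assumes "f \<in> polys n" "\<And>m. m > M \<Longrightarrow> intertw_part n \<kappa> m f = (\<lambda>x. 0)"
  shows "intertw n \<kappa> f = (\<lambda>x. \<Sum>m\<le>M. intertw_part n \<kappa> m f x)"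
proof
  fix x
  have "{m. intertw_part n \<kappa> m f \<noteq> (\<lambda>x. 0)} \<subseteq> {..M}"
  proof
    fix m assume "m \<in> {m. intertw_part n \<kappa> m f \<noteq> (\<lambda>x. 0)}"
    hence "\<not> m > M" using assms(2)[of m] by blast
    thus "m \<in> {..M}" by simp
  qed
  moreover have "intertw_part n \<kappa> m f x = 0" if "m \<notin> {m. intertw_part n \<kappa> m f \<noteq> (\<lambda>x. 0)}" for m
    using that by (simp add: fun_eq_iff)
  ultimately have "(\<Sum>m | intertw_part n \<kappa> m f \<noteq> (\<lambda>x. 0). intertw_part n \<kappa> m f x) = (\<Sum>m\<le>M. intertw_part n \<kappa> m f x)"
    by (intro sum.mono_neutral_left) blast+
  thus "intertw n \<kappa> f x = (\<Sum>m\<le>M. intertw_part n \<kappa> m f x)"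
    unfolding intertw_def using assms(1) by simp
qed

lemma intertw_hom:
  assumes "f \<in> hom_polys n m"
  shows "intertw n \<kappa> f = intertw_part n \<kappa> m f"
proof
  fix x
  have "intertw n \<kappa> f x = (\<Sum>k\<le>m. intertw_part n \<kappa> k f x)"
    using assms intertw_part_hom_neq[OF assms] by (subst intertw_eq[of _ _ m]) (auto intro: hom_polys_subset)
  also have "\<dots> = (\<Sum>k\<in>{m}. intertw_part n \<kappa> k f x)"
    using intertw_part_hom_neq[OF assms] by (intro sum.mono_neutral_right) auto
  finally show "intertw n \<kappa> f x = intertw_part n \<kappa> m f x" by simp
qed

lemma is_intertwining_intertw:
  assumes "\<kappa> \<ge> 0"
  shows "is_intertwining n \<kappa> (intertw n \<kappa>)"
  unfolding is_intertwining_def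
proof (intro conjI ballI allI)
  show "intertw n \<kappa> \<in> extensional (polys n)" by (simp add: intertw_def)
next
  fix f g a b assume fg: "f \<in> polys n" "g \<in> polys n"
  obtain M where M: "\<forall>m>M. intertw_part n \<kappa> m f = (\<lambda>x. 0)" using intertw_part_eventually_zero[OF fg(1)] by blast
  obtain N where N: "\<forall>m>N. intertw_part n \<kappa> m g = (\<lambda>x. 0)" using intertw_part_eventually_zero[OF fg(2)] by blast
  define K where "K = max M N"
  have K: "\<forall>m>K. intertw_part n \<kappa> m f = (\<lambda>x. 0)" "\<forall>m>K. intertw_part n \<kappa> m g = (\<lambda>x. 0)" using M N by (auto simp: K_def)
  have K': "\<forall>m>K. intertw_part n \<kappa> m (\<lambda>x. a * f x + b * g x) = (\<lambda>x. 0)" using K intertw_part_linear[OF fg] by auto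
  have p: "(\<lambda>x. a * f x + b * g x) \<in> polys n" using fg by (intro polys_add polys_cmult)
  show "intertw n \<kappa> (\<lambda>x. a * f x + b * g x) = (\<lambda>x. a * intertw n \<kappa> f x + b * intertw n \<kappa> g x)"
    using intertw_eq[OF p, of K] intertw_eq[OF fg(1), of K] intertw_eq[OF fg(2), of K] K K'
    by (simp add: intertw_part_linear[OF fg] sum.distrib sum_distrib_left)
next
  fix m
  show "intertw n \<kappa> ` hom_polys n m \<subseteq> hom_polys n m"
    by (auto simp: intertw_hom intro: intertw_part_hom hom_polys_subset)
next
  show "intertw n \<kappa> (\<lambda>x. 1) = (\<lambda>x. 1)" using intertw_hom[OF hom_polys_const[of 1], of n \<kappa>] by simp
next
  fix i f assume i: "i \<in> {1..n}" and f: "f \<in> polys n"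
  have pf: "partial i f \<in> polys n" using i f by (rule partial_polys[rotated])
  obtain M where M: "\<forall>m>M. intertw_part n \<kappa> m f = (\<lambda>x. 0)" using intertw_part_eventually_zero[OF f] by blast
  obtain N where N: "\<forall>m>N. intertw_part n \<kappa> m (partial i f) = (\<lambda>x. 0)" using intertw_part_eventually_zero[OF pf] by blast
  define K where "K = max M N"
  have "dunkl n \<kappa> i (intertw n \<kappa> f) = dunkl n \<kappa> i (\<lambda>x. \<Sum>m\<le>Suc K. intertw_part n \<kappa> m f x)"
    using M by (subst intertw_eq[OF f, of "Suc K"]) (auto simp: K_def)
  also have "\<dots> = (\<lambda>x. \<Sum>m\<le>Suc K. dunkl n \<kappa> i (intertw_part n \<kappa> m f) x)"
    using f by (intro dunkl_sum) (auto intro!: hom_polys_subset intertw_part_hom simp del: intertw_part.simps)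
  also have "\<dots> = (\<lambda>x. \<Sum>m\<le>K. intertw_part n \<kappa> m (partial i f) x)"
    unfolding sum.atMost_Suc_shift dunkl_intertw_part_0 dunkl_intertw_part_Suc[OF assms f i] by simp
  also have "\<dots> = intertw n \<kappa> (partial i f)"
    using N by (subst intertw_eq[OF pf, of K]) (auto simp: K_def)
  finally show "dunkl n \<kappa> i (intertw n \<kappa> f) = intertw n \<kappa> (partial i f)" .
qed

section \<open>Uniqueness of the intertwining operator\<close>

lemma
  assumes "is_intertwining n \<kappa> V"
  shows is_intertwining_linear: "f \<in> polys n \<Longrightarrow> g \<in> polys n \<Longrightarrow>
          V (\<lambda>x. a * f x + b * g x) = (\<lambda>x. a * V f x + b * V g x)"
    and is_intertwining_hom: "f \<in> hom_polys n m \<Longrightarrow> V f \<in> hom_polys n m"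
    and is_intertwining_one: "V (\<lambda>x. 1) = (\<lambda>x. 1)"
    and is_intertwining_dunkl: "f \<in> polys n \<Longrightarrow> i \<in> {1..n} \<Longrightarrow> dunkl n \<kappa> i (V f) = V (partial i f)"
    and is_intertwining_ext: "V \<in> extensional (polys n)"
  using assms unfolding is_intertwining_def by blast+

lemma is_intertwining_const:
  assumes "is_intertwining n \<kappa> V"
  shows "V (\<lambda>x. c) = (\<lambda>x. c)"
  using is_intertwining_linear[OF assms polys_const polys_const, of c 1 0 1] is_intertwining_one[OF assms]
  by simp

lemma is_intertwining_unique:
  assumes "\<kappa> \<ge> 0" "is_intertwining n \<kappa> V" "is_intertwining n \<kappa> W"
  shows "V = W"
proof -
  have hom: "V f = W f" if "f \<in> hom_polys n m" for f m
    using that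
  proof (induction m arbitrary: f)
    case 0
    then obtain c where "f = (\<lambda>x. c)" by (rule hom_polys_0_const)
    thus ?case using is_intertwining_const assms by metis
  next
    case (Suc m)
    note f = hom_polys_subset[OF Suc.prems]
    note VW = is_intertwining_hom[OF assms(2) Suc.prems] is_intertwining_hom[OF assms(3) Suc.prems]
    have "(\<lambda>x. V f x - W f x) = (\<lambda>x. 0)"
    proof (rule hom_poly_zero_if_dunkl_zero[OF assms(1)])
      show "(\<lambda>x. V f x - W f x) \<in> hom_polys n (Suc m)" using VW by (rule hom_polys_diff)
      fix i assume i: "i \<in> {1..n}"
      have "dunkl n \<kappa> i (\<lambda>x. V f x - W f x) = (\<lambda>x. V (partial i f) x - W (partial i f) x)"
        using VW is_intertwining_dunkl[OF assms(2) f i] is_intertwining_dunkl[OF assms(3) f i]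
        by (subst dunkl_diff) (auto intro: hom_polys_subset)
      thus "dunkl n \<kappa> i (\<lambda>x. V f x - W f x) = (\<lambda>x. 0)"
        using Suc.IH[OF partial_hom_Suc[OF Suc.prems i]] by simp
    qed
    thus ?case by (simp add: fun_eq_iff)
  qed
  show ?thesis
  proof (rule extensionalityI[OF is_intertwining_ext[OF assms(2)] is_intertwining_ext[OF assms(3)]])
    fix f assume "f \<in> polys n"
    thus "V f = W f"
    proof (induction rule: polys_induct_hom)
      case (hom m f) thus ?case using \<open>\<And>m f. f \<in> hom_polys n m \<Longrightarrow> V f = W f\<close> by blast
    next
      case (add f g)
      thus ?case using is_intertwining_linear[OF assms(2) add(1,2), of 1 1]
          is_intertwining_linear[OF assms(3) add(1,2), of 1 1] by simp
    qed
  qed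
qed

lemma is_intertwining_intertwining:
  assumes "\<kappa> \<ge> 0"
  shows "is_intertwining n \<kappa> (intertwining n \<kappa>)"
  unfolding intertwining_def
  using theI[of "is_intertwining n \<kappa>", OF is_intertwining_intertw[OF assms]]
    is_intertwining_unique[OF assms] is_intertwining_intertw[OF assms] by blast

section \<open>Binomial series\<close>

text \<open>
  The binomial series \<open>(1 - z X)\<^bsup>-b\<^esup>\<close>. In particular \<open>binom_fps 1 z\<close> is the geometric series.
\<close>

definition binom_fps :: "'a::field_char_0 \<Rightarrow> 'a \<Rightarrow> 'a fps" where
  "binom_fps b z = Abs_fps (\<lambda>m. pochhammer b m / fact m * z ^ m)"

lemma binom_fps_nth: "fps_nth (binom_fps b z) m = pochhammer b m / fact m * z ^ m"
  by (simp add: binom_fps_def)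

lemma binom_fps_1_nth: "fps_nth (binom_fps 1 z) m = z ^ m"
  by (simp add: binom_fps_nth pochhammer_fact[symmetric])

lemma nth_linear_times_deriv:
  fixes F :: "'a::field_char_0 fps"
  shows "fps_nth ((1 - fps_const z * fps_X) * fps_deriv F) m = of_nat (Suc m) * fps_nth F (Suc m) - z * of_nat m * fps_nth F m"
  by (cases m) (simp_all add: left_diff_distrib mult.assoc One_nat_def)

lemma binom_fps_ode:
  "(1 - fps_const z * fps_X) * fps_deriv (binom_fps b z) = fps_const (b * z) * binom_fps b z"
proof (rule fps_ext)
  fix m
  have "(of_nat (Suc m) :: 'a) \<noteq> 0" by (rule of_nat_neq_0)
  thus "fps_nth ((1 - fps_const z * fps_X) * fps_deriv (binom_fps b z)) m = fps_nth (fps_const (b * z) * binom_fps b z) m"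
    unfolding nth_linear_times_deriv by (simp add: binom_fps_nth pochhammer_Suc divide_simps del: of_nat_Suc) (simp add: algebra_simps)
qed

lemma binom_fps_unique:
  assumes "(1 - fps_const z * fps_X) * fps_deriv F = fps_const (b * z) * F" "fps_nth F 0 = 1"
  shows "F = binom_fps b z"
proof (rule fps_ext)
  fix m show "fps_nth F m = fps_nth (binom_fps b z) m"
  proof (induction m)
    case 0 thus ?case using assms(2) by (simp add: binom_fps_nth)
  next
    case (Suc m)
    have nz: "(of_nat (Suc m) :: 'a) \<noteq> 0" by (rule of_nat_neq_0)
    have "of_nat (Suc m) * fps_nth F (Suc m) = (z * of_nat m + b * z) * fps_nth F m"
      using arg_cong[OF assms(1), of "\<lambda>F. fps_nth F m"] unfolding nth_linear_times_deriv
      by (simp add: algebra_simps)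
    also have "\<dots> = of_nat (Suc m) * fps_nth (binom_fps b z) (Suc m)"
      using arg_cong[OF binom_fps_ode[of z b], of "\<lambda>F. fps_nth F m"] unfolding nth_linear_times_deriv Suc
      by (simp add: algebra_simps)
    finally show ?case using nz by (simp del: of_nat_Suc)
  qed
qed

lemma binom_fps_mult: "binom_fps a z * binom_fps b z = binom_fps (a + b) z"
proof (rule binom_fps_unique)
  let ?L = "1 - fps_const z * fps_X"
  have "?L * fps_deriv (binom_fps a z * binom_fps b z) =
     (?L * fps_deriv (binom_fps a z)) * binom_fps b z + binom_fps a z * (?L * fps_deriv (binom_fps b z))"
    by (simp add: algebra_simps)
  also have "\<dots> = fps_const ((a + b) * z) * (binom_fps a z * binom_fps b z)"
    unfolding binom_fps_ode by (simp add: algebra_simps flip: fps_const_add)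
  finally show "?L * fps_deriv (binom_fps a z * binom_fps b z) = fps_const ((a + b) * z) * (binom_fps a z * binom_fps b z)" .
qed (simp add: binom_fps_nth)

lemma binom_fps_0: "binom_fps 0 z = 1"
  by (rule binom_fps_unique[symmetric]) auto

lemma binom_fps_1_inverse: "(1 - fps_const z * fps_X) * binom_fps 1 z = 1"
proof (rule fps_ext)
  fix m show "fps_nth ((1 - fps_const z * fps_X) * binom_fps 1 z) m = fps_nth 1 m"
    by (cases m) (auto simp: left_diff_distrib mult.assoc binom_fps_1_nth One_nat_def)
qed

lemma X_deriv_binom_fps:
  "fps_X * fps_deriv (binom_fps b z) = fps_const b * (binom_fps 1 z - 1) * binom_fps b z"
proof -
  let ?L = "1 - fps_const z * fps_X" and ?G = "binom_fps 1 z"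
  have "fps_X * fps_deriv (binom_fps b z) = fps_X * ?G * (?L * fps_deriv (binom_fps b z))"
    using binom_fps_1_inverse[of z] by (metis (no_types, lifting) mult.assoc mult.commute mult_1)
  also have "\<dots> = fps_const b * (?G - ?L * ?G) * binom_fps b z"
    unfolding binom_fps_ode by (simp add: algebra_simps flip: fps_const_mult)
  finally show ?thesis by (simp add: binom_fps_1_inverse)
qed

lemma binom_fps_1_diff:
  "binom_fps 1 z - binom_fps 1 w = fps_const (z - w) * fps_X * binom_fps 1 z * binom_fps 1 w"
proof -
  have "binom_fps 1 z - binom_fps 1 w = binom_fps 1 z * ((1 - fps_const w * fps_X) * binom_fps 1 w)
      - ((1 - fps_const z * fps_X) * binom_fps 1 z) * binom_fps 1 w"
    by (simp add: binom_fps_1_inverse)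
  also have "\<dots> = fps_const (z - w) * fps_X * binom_fps 1 z * binom_fps 1 w"
    by (simp add: algebra_simps flip: fps_const_sub)
  finally show ?thesis .
qed

lemma X_deriv_prod_binom_fps:
  assumes "finite A"
  shows "fps_X * fps_deriv (\<Prod>j\<in>A. binom_fps (b j) (z j)) =
     (\<Sum>j\<in>A. fps_const (b j) * (binom_fps 1 (z j) - 1)) * (\<Prod>j\<in>A. binom_fps (b j) (z j))"
  using assms
proof (induction A)
  case (insert a A)
  let ?B = "\<lambda>j. binom_fps (b j) (z j)"
  have "fps_X * fps_deriv (?B a * prod ?B A) =
     (fps_X * fps_deriv (?B a)) * prod ?B A + ?B a * (fps_X * fps_deriv (prod ?B A))"
    by (simp add: algebra_simps)
  also have "\<dots> = (fps_const (b a) * (binom_fps 1 (z a) - 1) + (\<Sum>j\<in>A. fps_const (b j) * (binom_fps 1 (z j) - 1)))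
      * (?B a * prod ?B A)"
    unfolding insert.IH X_deriv_binom_fps by (simp only: distrib_right mult.assoc) (simp only: mult.left_commute mult.commute)
  finally show ?case using insert by simp
qed auto

lemma binom_fps_coord_hom:
  "l \<in> {1..n} \<Longrightarrow> (\<lambda>x. fps_nth (binom_fps b (of_real (x l))) m) \<in> hom_polys n m"
  unfolding binom_fps_nth by (intro hom_polys_cmult hom_polys_power hom_polys_coord)

lemma prod_binom_fps_hom:
  assumes "finite A" "A \<subseteq> {1..n}"
  shows "(\<lambda>x. fps_nth (\<Prod>j\<in>A. binom_fps (b j) (of_real (x j))) m) \<in> hom_polys n m"
  using assms
proof (induction A arbitrary: m)
  case empty
  thus ?case by (cases m) (auto intro: hom_polys_const hom_polys_zero)
next
  case (insert a A)
  have "(\<lambda>x. \<Sum>i=0..m. fps_nth (binom_fps (b a) (of_real (x a))) i *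
      fps_nth (\<Prod>j\<in>A. binom_fps (b j) (of_real (x j))) (m - i)) \<in> hom_polys n m"
  proof (intro hom_polys_sum)
    fix i assume "i \<in> {0..m}"
    thus "(\<lambda>x. fps_nth (binom_fps (b a) (of_real (x a))) i *
      fps_nth (\<Prod>j\<in>A. binom_fps (b j) (of_real (x j))) (m - i)) \<in> hom_polys n m"
      using hom_polys_mult[OF binom_fps_coord_hom[of a n "b a" i] insert.IH[of "m - i"]] insert by simp
  qed
  thus ?case using insert by (simp add: fps_mult_nth)
qed

lemma has_vector_derivative_of_real_power:
  "((\<lambda>t. complex_of_real (t ^ Suc k)) has_vector_derivative of_real (real (Suc k) * t ^ k)) (at t)"
  using DERIV_pow[of "Suc k" t]
  by (intro has_vector_derivative_of_real) (simp add: has_real_derivative_iff_has_vector_derivative)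

lemma has_derivative_binom_fps:
  "((\<lambda>t. fps_nth (binom_fps b (complex_of_real t)) m) has_vector_derivative
     fps_nth (fps_const b * fps_X * binom_fps 1 (of_real t) * binom_fps b (of_real t)) m) (at t)"
proof (cases m)
  case 0
  thus ?thesis by (simp add: binom_fps_nth)
next
  case (Suc k)
  have "((\<lambda>t. pochhammer b (Suc k) / fact (Suc k) * complex_of_real (t ^ Suc k)) has_vector_derivative
     pochhammer b (Suc k) / fact (Suc k) * of_real (real (Suc k) * t ^ k)) (at t)"
    by (intro has_vector_derivative_mult_right has_vector_derivative_of_real_power)
  moreover have "pochhammer b (Suc k) / fact (Suc k) * of_real (real (Suc k) * t ^ k) =
    fps_nth (fps_const b * fps_X * binom_fps 1 (of_real t) * binom_fps b (of_real t)) m"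
  proof -
    have "fps_nth (fps_const b * fps_X * binom_fps 1 (of_real t) * binom_fps b (of_real t)) m =
      fps_nth (fps_const b * (fps_X * binom_fps (1 + b) (of_real t))) (Suc k)"
      by (simp add: Suc mult.assoc binom_fps_mult)
    also have "\<dots> = b * fps_nth (binom_fps (b + 1) (of_real t)) k" by (simp add: add.commute)
    also have "\<dots> = pochhammer b (Suc k) / fact (Suc k) * of_real (real (Suc k) * t ^ k)"
      by (simp add: binom_fps_nth pochhammer_rec fact_Suc divide_simps del: of_nat_Suc)
    finally show ?thesis ..
  qed
  ultimately show ?thesis using Suc by (simp only: binom_fps_nth of_real_power)
qed

lemma partial_prod_binom_fps:
  assumes "i \<in> {1..n}"
  shows "partial i (\<lambda>x. fps_nth (\<Prod>j=1..n. binom_fps (b j) (of_real (x j))) m) x =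
     fps_nth (fps_const (b i) * fps_X * binom_fps 1 (of_real (x i)) * (\<Prod>j=1..n. binom_fps (b j) (of_real (x j)))) m"
proof (rule partial_eqI)
  define R where "R = (\<Prod>j\<in>{1..n}-{i}. binom_fps (b j) (complex_of_real (x j)))"
  define D where "D = fps_const (b i) * fps_X * binom_fps 1 (of_real (x i)) * binom_fps (b i) (complex_of_real (x i))"
  have e: "(\<Prod>j=1..n. binom_fps (b j) (complex_of_real ((x(i := t)) j))) = binom_fps (b i) (of_real t) * R" for t
  proof -
    have "(\<Prod>j\<in>{1..n}-{i}. binom_fps (b j) (complex_of_real ((x(i := t)) j))) = R"
      unfolding R_def by (intro prod.cong) auto
    thus ?thesis using assms by (subst prod.remove[of _ i]) auto
  qed
  have "((\<lambda>t. \<Sum>r=0..m. fps_nth (binom_fps (b i) (complex_of_real t)) r * fps_nth R (m - r)) has_vector_derivative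
      (\<Sum>r=0..m. fps_nth D r * fps_nth R (m - r))) (at (x i))"
    unfolding D_def
    by (intro has_vector_derivative_sum has_vector_derivative_mult_left has_derivative_binom_fps)
  moreover have DR: "D * R = fps_const (b i) * fps_X * binom_fps 1 (of_real (x i)) * (\<Prod>j=1..n. binom_fps (b j) (of_real (x j)))"
    using e[of "x i"] by (simp add: D_def mult.assoc)
  ultimately show "((\<lambda>t. fps_nth (\<Prod>j=1..n. binom_fps (b j) (of_real ((x(i := t)) j))) m) has_vector_derivative
     fps_nth (fps_const (b i) * fps_X * binom_fps 1 (of_real (x i)) * (\<Prod>j=1..n. binom_fps (b j) (of_real (x j)))) m) (at (x i))"
    unfolding e DR[symmetric] by (simp only: fps_mult_nth[of _ R])
qed

section \<open>Dunkl operators on the coefficients of the generating function\<close>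

text \<open>
  The product \<open>\<Prod>\<^sub>j (1 - x\<^sub>j X)\<^bsup>-\<kappa>\<^esup>\<close>, a symmetric function of \<open>x\<^sub>1, \<dots>, x\<^sub>n\<close>.
\<close>

definition sym_gen :: "nat \<Rightarrow> real \<Rightarrow> (nat \<Rightarrow> real) \<Rightarrow> complex fps" where
  "sym_gen n \<kappa> x = (\<Prod>j=1..n. binom_fps (of_real \<kappa>) (of_real (x j)))"

text \<open>
  The coefficient of \<open>X ^ m\<close> in \<open>(1 - x\<^sub>k X)\<^sup>-\<^sup>1 \<Prod>\<^sub>j (1 - x\<^sub>j X)\<^bsup>-\<kappa>\<^esup>\<close>. Up to a constant factor it is
  the image of \<open>z\<^sub>k ^ m\<close> under the intertwining operator.
\<close>

definition axis_poly :: "nat \<Rightarrow> real \<Rightarrow> nat \<Rightarrow> nat \<Rightarrow> (nat \<Rightarrow> real) \<Rightarrow> complex" where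
  "axis_poly n \<kappa> k m x = fps_nth (binom_fps 1 (of_real (x k)) * sym_gen n \<kappa> x) m"

lemma sym_gen_mult_binom_fps:
  assumes "k \<in> {1..n}"
  shows "binom_fps 1 (of_real (x k)) * sym_gen n \<kappa> x =
    (\<Prod>j=1..n. binom_fps (of_real \<kappa> + (if j = k then 1 else 0)) (of_real (x j)))"
proof -
  have "(\<Prod>j\<in>{1..n}-{k}. binom_fps (of_real \<kappa> + (if j = k then 1 else 0)) (complex_of_real (x j))) =
     (\<Prod>j\<in>{1..n}-{k}. binom_fps (of_real \<kappa>) (of_real (x j)))"
    by (intro prod.cong) auto
  moreover have "binom_fps (of_real \<kappa> + 1) (complex_of_real (x k)) =
      binom_fps 1 (complex_of_real (x k)) * binom_fps (of_real \<kappa>) (complex_of_real (x k))"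
    by (simp add: binom_fps_mult add.commute)
  ultimately show ?thesis
    using assms unfolding sym_gen_def
      prod.remove[OF _ assms, of "\<lambda>j. binom_fps (of_real \<kappa>) (complex_of_real (x j))", simplified]
      prod.remove[OF _ assms, of "\<lambda>j. binom_fps (of_real \<kappa> + (if j = k then 1 else 0)) (complex_of_real (x j))", simplified]
    by (simp add: mult.assoc)
qed

lemma axis_poly_hom: "k \<in> {1..n} \<Longrightarrow> axis_poly n \<kappa> k m \<in> hom_polys n m"
  unfolding axis_poly_def[abs_def] sym_gen_mult_binom_fps by (intro prod_binom_fps_hom) auto

lemma axis_poly_0: "axis_poly n \<kappa> k 0 = (\<lambda>x. 1)"
proof -
  have "fps_nth (prod f A) 0 = 1" if "\<And>j. fps_nth (f j) 0 = 1" for f :: "nat \<Rightarrow> complex fps" and A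
    using that by (induction A rule: infinite_finite_induct) auto
  hence "fps_nth (sym_gen n \<kappa> x) 0 = 1" for x unfolding sym_gen_def by (simp add: binom_fps_nth)
  thus ?thesis by (simp add: axis_poly_def fun_eq_iff binom_fps_nth)
qed

lemma partial_axis_poly:
  assumes "k \<in> {1..n}" "i \<in> {1..n}"
  shows "partial i (axis_poly n \<kappa> k m) x = fps_nth (fps_const (of_real \<kappa> + (if i = k then 1 else 0))
     * fps_X * binom_fps 1 (of_real (x i)) * (binom_fps 1 (of_real (x k)) * sym_gen n \<kappa> x)) m"
  unfolding axis_poly_def[abs_def] sym_gen_mult_binom_fps[OF assms(1)]
  by (rule partial_prod_binom_fps[OF assms(2)])

lemma sym_gen_swap:
  assumes "i \<in> {1..n}" "j \<in> {1..n}"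
  shows "sym_gen n \<kappa> (x \<circ> tr i j) = sym_gen n \<kappa> x"
  unfolding sym_gen_def comp_apply
  using prod.permute[OF tr_permutes[OF assms], of "\<lambda>j. binom_fps (of_real \<kappa>) (complex_of_real (x j))"]
  by (simp add: o_def)

lemma diff_quot_axis_poly:
  assumes "k \<in> {1..n}" "i \<in> {1..n}" "j \<in> {1..n}" "i \<noteq> j"
  shows "diff_quot i j (axis_poly n \<kappa> k m) x = fps_nth (fps_const ((if i = k then 1 else 0) - (if j = k then 1 else 0))
     * (fps_X * binom_fps 1 (of_real (x i)) * binom_fps 1 (of_real (x j)) * sym_gen n \<kappa> x)) m"
proof (cases "x i = x j")
  case True
  have "diff_quot i j (axis_poly n \<kappa> k m) x = fps_nth (fps_const ((if i = k then 1 else 0) - (if j = k then 1 else 0))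
     * (fps_X * binom_fps 1 (of_real (x i)) * binom_fps 1 (of_real (x k)) * sym_gen n \<kappa> x)) m"
    using assms True unfolding diff_quot_def
    by (simp add: partial_axis_poly mult.assoc left_diff_distrib[symmetric] flip: fps_sub_nth)
  thus ?thesis using True assms by auto
next
  case False
  let ?G = "\<lambda>i. binom_fps 1 (complex_of_real (x i))"
  have nz: "complex_of_real (x i - x j) \<noteq> 0" using False by simp
  have "diff_quot i j (axis_poly n \<kappa> k m) x = (axis_poly n \<kappa> k m x - axis_poly n \<kappa> k m (x \<circ> tr i j)) / of_real (x i - x j)"
    using False by (simp add: diff_quot_def swap_coords)
  also have "axis_poly n \<kappa> k m x - axis_poly n \<kappa> k m (x \<circ> tr i j) = fps_nth ((?G k - ?G (tr i j k)) * sym_gen n \<kappa> x) m"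
    unfolding axis_poly_def sym_gen_swap[OF assms(2,3)] by (simp add: comp_apply left_diff_distrib)
  also have "(?G k - ?G (tr i j k)) * sym_gen n \<kappa> x = fps_const (of_real (x i - x j)) *
     (fps_const ((if i = k then 1 else 0) - (if j = k then 1 else 0)) * (fps_X * ?G i * ?G j * sym_gen n \<kappa> x))"
  proof -
    consider "i = k" | "j = k" | "i \<noteq> k" "j \<noteq> k" by blast
    thus ?thesis
    proof cases
      case 1
      thus ?thesis using assms(4) binom_fps_1_diff[of "complex_of_real (x i)" "complex_of_real (x j)"]
        by (simp add: mult.assoc)
    next
      case 2
      have "?G j - ?G i = - (?G i - ?G j)" by simp
      also have "\<dots> = - (fps_const (of_real (x i - x j)) * fps_X * ?G i * ?G j)"
        unfolding binom_fps_1_diff by simp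
      finally show ?thesis using 2 assms(4)
        by (simp add: mult.assoc fps_const_neg[symmetric] del: fps_const_neg)
    qed auto
  qed
  finally show ?thesis using nz by simp
qed

text \<open>
  For \<open>i \<noteq> k\<close> the partial derivative cancels against the single nonzero difference quotient, the one
  with \<open>j = k\<close>.
\<close>

lemma dunkl_axis_poly_fps:
  assumes "k \<in> {1..n}" "i \<in> {1..n}"
  shows "dunkl n \<kappa> i (axis_poly n \<kappa> k m) x = (if i = k then
     fps_nth (fps_X * ((binom_fps 1 (of_real (x k)) + fps_const (of_real \<kappa>) * (\<Sum>j=1..n. binom_fps 1 (of_real (x j))))
       * (binom_fps 1 (of_real (x k)) * sym_gen n \<kappa> x))) m else 0)"
proof -
  let ?G = "\<lambda>i. binom_fps 1 (complex_of_real (x i))" and ?Q = "sym_gen n \<kappa> x"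
  let ?d = "\<lambda>i. if i = k then 1 else 0 :: complex"
  have "dunkl n \<kappa> i (axis_poly n \<kappa> k m) x = fps_nth (fps_const (of_real \<kappa> + ?d i) * fps_X * ?G i * (?G k * ?Q)
      + fps_const (of_real \<kappa>) * (\<Sum>j\<in>{1..n}-{i}. fps_const (?d i - ?d j) * (fps_X * ?G i * ?G j * ?Q))) m"
    unfolding dunkl_def partial_axis_poly[OF assms]
    using assms by (simp add: diff_quot_axis_poly fps_sum_nth)
  also have "fps_const (of_real \<kappa> + ?d i) * fps_X * ?G i * (?G k * ?Q)
      + fps_const (of_real \<kappa>) * (\<Sum>j\<in>{1..n}-{i}. fps_const (?d i - ?d j) * (fps_X * ?G i * ?G j * ?Q)) =
     (if i = k then fps_X * ((?G k + fps_const (of_real \<kappa>) * (\<Sum>j=1..n. ?G j)) * (?G k * ?Q)) else 0)"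
  proof (cases "i = k")
    case True
    have "(\<Sum>j\<in>{1..n}-{i}. fps_const (?d i - ?d j) * (fps_X * ?G i * ?G j * ?Q)) =
       (\<Sum>j\<in>{1..n}-{i}. fps_X * ?G i * ?Q * ?G j)"
      using True by (intro sum.cong refl) (auto simp: mult_ac)
    also have "\<dots> = fps_X * ?G i * ?Q * (\<Sum>j\<in>{1..n}-{i}. ?G j)"
      by (simp only: sum_distrib_left)
    finally show ?thesis
      using True sum.remove[OF _ assms(1), of ?G]
      by (simp add: algebra_simps flip: fps_const_add)
  next
    case False
    have "(\<Sum>j\<in>{1..n}-{i}. fps_const (?d i - ?d j) * (fps_X * ?G i * ?G j * ?Q)) =
       (\<Sum>j\<in>{1..n}-{i}. if j = k then - (fps_X * ?G i * ?G k * ?Q) else 0)"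
      using False by (intro sum.cong refl) (auto simp: fps_const_neg[symmetric] simp del: fps_const_neg)
    also have "\<dots> = - (fps_X * ?G i * ?G k * ?Q)" using False assms by simp
    finally show ?thesis using False by (simp add: mult_ac)
  qed
  finally show ?thesis by simp
qed

lemma X_deriv_axis_poly:
  assumes "k \<in> {1..n}"
  shows "(binom_fps 1 (of_real (x k)) + fps_const (of_real \<kappa>) * (\<Sum>j=1..n. binom_fps 1 (complex_of_real (x j))))
       * (binom_fps 1 (of_real (x k)) * sym_gen n \<kappa> x) =
     fps_X * fps_deriv (binom_fps 1 (of_real (x k)) * sym_gen n \<kappa> x)
      + fps_const (1 + of_nat n * of_real \<kappa>) * (binom_fps 1 (of_real (x k)) * sym_gen n \<kappa> x)"
proof -
  let ?G = "\<lambda>i. binom_fps 1 (complex_of_real (x i))" and ?Q = "sym_gen n \<kappa> x"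
  have "fps_X * fps_deriv (?G k * ?Q) = (fps_X * fps_deriv (?G k)) * ?Q + ?G k * (fps_X * fps_deriv ?Q)"
    by (simp add: algebra_simps)
  also have "fps_X * fps_deriv (?G k) = (?G k - 1) * ?G k"
    by (simp add: X_deriv_binom_fps)
  also have "fps_X * fps_deriv ?Q = (\<Sum>j=1..n. fps_const (of_real \<kappa>) * (?G j - 1)) * ?Q"
    unfolding sym_gen_def by (rule X_deriv_prod_binom_fps) simp
  also have "(\<Sum>j=1..n. fps_const (of_real \<kappa>) * (?G j - 1)) =
      fps_const (of_real \<kappa>) * (\<Sum>j=1..n. ?G j) - fps_const (of_nat n * of_real \<kappa>)"
    by (simp add: right_diff_distrib sum_subtractf sum_distrib_left flip: fps_const_mult fps_of_nat)
  finally show ?thesis by (simp add: algebra_simps flip: fps_const_add)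
qed

lemma dunkl_axis_poly_Suc:
  assumes "k \<in> {1..n}" "i \<in> {1..n}"
  shows "dunkl n \<kappa> i (axis_poly n \<kappa> k (Suc m)) = (\<lambda>x. if i = k then (of_nat (Suc m) + of_nat n * of_real \<kappa>) * axis_poly n \<kappa> k m x else 0)"
proof
  fix x
  have "fps_nth (fps_X * (fps_X * fps_deriv F + fps_const c * F)) (Suc m) = (of_nat m + c) * fps_nth F m"
    for F :: "complex fps" and c
    by (cases m) (simp_all add: One_nat_def distrib_right)
  thus "dunkl n \<kappa> i (axis_poly n \<kappa> k (Suc m)) x = (if i = k then (of_nat (Suc m) + of_nat n * of_real \<kappa>) * axis_poly n \<kappa> k m x else 0)"
    unfolding dunkl_axis_poly_fps[OF assms] X_deriv_axis_poly[OF assms(1)] axis_poly_def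
    by (simp only: of_nat_Suc add_ac)
qed

lemma sum_axis_poly:
  "of_real \<kappa> * (\<Sum>k=1..n. axis_poly n \<kappa> k m x) = (of_nat m + of_nat n * of_real \<kappa>) * fps_nth (sym_gen n \<kappa> x) m"
proof -
  let ?G = "\<lambda>i. binom_fps 1 (complex_of_real (x i))" and ?Q = "sym_gen n \<kappa> x"
  have "fps_X * fps_deriv ?Q = (\<Sum>j=1..n. fps_const (of_real \<kappa>) * (?G j - 1)) * ?Q"
    unfolding sym_gen_def by (rule X_deriv_prod_binom_fps) simp
  also have "(\<Sum>j=1..n. fps_const (of_real \<kappa>) * (?G j - 1)) =
      fps_const (of_real \<kappa>) * (\<Sum>j=1..n. ?G j) - fps_const (of_nat n * of_real \<kappa>)"
    by (simp add: right_diff_distrib sum_subtractf sum_distrib_left flip: fps_const_mult fps_of_nat)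
  finally have "fps_const (of_real \<kappa>) * (\<Sum>j=1..n. ?G j * ?Q) =
     fps_X * fps_deriv ?Q + fps_const (of_nat n * of_real \<kappa>) * ?Q"
    by (simp add: left_diff_distrib sum_distrib_right mult.assoc)
  hence "fps_nth (fps_const (of_real \<kappa>) * (\<Sum>j=1..n. ?G j * ?Q)) m =
     fps_nth (fps_X * fps_deriv ?Q + fps_const (of_nat n * of_real \<kappa>) * ?Q) m" by simp
  moreover have "fps_nth (fps_X * fps_deriv F) m = of_nat m * fps_nth F m" for F :: "complex fps"
    by (cases m) (auto simp: One_nat_def)
  ultimately show ?thesis by (simp add: axis_poly_def fps_sum_nth algebra_simps)
qed

section \<open>The intertwining operator on powers of linear forms\<close>

lemma pochhammer_Suc_kappa_neq_0:
  "\<kappa> \<ge> 0 \<Longrightarrow> pochhammer (of_nat n * of_real \<kappa> + 1 :: complex) m \<noteq> 0"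
proof -
  assume k: "\<kappa> \<ge> 0"
  have "pochhammer (of_nat n * of_real \<kappa> + 1 :: complex) m = of_real (pochhammer (real n * \<kappa> + 1) m)"
    by (simp add: pochhammer_of_real[symmetric])
  moreover have "pochhammer (real n * \<kappa> + 1) m > 0" using k by (intro pochhammer_pos) (simp add: add_nonneg_pos)
  ultimately show ?thesis by simp
qed

lemma intertwining_coord_power:
  assumes k: "\<kappa> \<ge> 0" "k \<in> {1..n}" and V: "is_intertwining n \<kappa> V"
  shows "V (\<lambda>z. of_real (z k) ^ m) = (\<lambda>x. fact m / pochhammer (of_nat n * of_real \<kappa> + 1) m * axis_poly n \<kappa> k m x)"
proof (induction m)
  case 0
  thus ?case using is_intertwining_one[OF V] by (simp add: axis_poly_0)
next
  case (Suc m)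
  let ?P = "\<lambda>m. pochhammer (of_nat n * of_real \<kappa> + 1 :: complex) m"
  let ?f = "\<lambda>z. complex_of_real (z k) ^ Suc m"
  let ?g = "\<lambda>x. fact (Suc m) / ?P (Suc m) * axis_poly n \<kappa> k (Suc m) x"
  have f: "?f \<in> hom_polys n (Suc m)" using k(2) by (intro hom_polys_power hom_polys_coord)
  have fm: "(\<lambda>z. complex_of_real (z k) ^ m) \<in> polys n" using k(2) by (intro hom_polys_subset[OF hom_polys_power] hom_polys_coord)
  have g: "?g \<in> hom_polys n (Suc m)" using k(2) by (intro hom_polys_cmult axis_poly_hom)
  have Vf: "V ?f \<in> hom_polys n (Suc m)" by (rule is_intertwining_hom[OF V f])
  have pf: "partial i ?f = (\<lambda>x. if i = k then of_nat (Suc m) * of_real (x k) ^ m else 0)" for i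
  proof
    fix x
    have "((\<lambda>t. complex_of_real ((x(i := t)) k) ^ Suc m) has_vector_derivative
          (if i = k then of_nat (Suc m) * of_real (x k) ^ m else 0)) (at (x i))"
    proof (cases "i = k")
      case True
      thus ?thesis using has_vector_derivative_of_real_power[of m "x k"] by (simp del: of_nat_Suc power_Suc)
    qed auto
    thus "partial i ?f x = (if i = k then of_nat (Suc m) * of_real (x k) ^ m else 0)"
      by (rule partial_eqI)
  qed
  have "(\<lambda>x. V ?f x - ?g x) = (\<lambda>x. 0)"
  proof (rule hom_poly_zero_if_dunkl_zero[OF k(1) hom_polys_diff[OF Vf g]])
    fix i assume i: "i \<in> {1..n}"
    have "dunkl n \<kappa> i (\<lambda>x. V ?f x - ?g x) = (\<lambda>x. dunkl n \<kappa> i (V ?f) x - dunkl n \<kappa> i ?g x)"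
      using Vf g by (intro dunkl_diff hom_polys_subset)
    also have "dunkl n \<kappa> i ?g = (\<lambda>x. fact (Suc m) / ?P (Suc m) * dunkl n \<kappa> i (axis_poly n \<kappa> k (Suc m)) x)"
      using k(2) by (intro dunkl_cmult hom_polys_subset[OF axis_poly_hom])
    also have "\<dots> = (\<lambda>x. if i = k then of_nat (Suc m) * (fact m / ?P m * axis_poly n \<kappa> k m x) else 0)"
    proof -
      have "?P (Suc m) = ?P m * (of_nat (Suc m) + of_nat n * of_real \<kappa>)"
        by (simp add: pochhammer_Suc add_ac)
      moreover have "?P m \<noteq> 0" "?P (Suc m) \<noteq> 0" using pochhammer_Suc_kappa_neq_0[OF k(1)] by blast+
      ultimately show ?thesis unfolding dunkl_axis_poly_Suc[OF k(2) i] fun_eq_iff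
        by (simp add: fact_Suc field_simps del: of_nat_Suc)
    qed
    also have "dunkl n \<kappa> i (V ?f) = V (partial i ?f)"
      by (rule is_intertwining_dunkl[OF V hom_polys_subset[OF f] i])
    also have "V (partial i ?f) = (\<lambda>x. if i = k then of_nat (Suc m) * (fact m / ?P m * axis_poly n \<kappa> k m x) else 0)"
    proof (cases "i = k")
      case True
      have "V (\<lambda>x. of_nat (Suc m) * of_real (x k) ^ m + 0 * 1) = (\<lambda>x. of_nat (Suc m) * V (\<lambda>x. of_real (x k) ^ m) x + 0 * V (\<lambda>x. 1) x)"
        using is_intertwining_linear[OF V fm polys_const[of 1], of "of_nat (Suc m)" 0] .
      thus ?thesis unfolding pf Suc using True by simp
    next
      case False
      thus ?thesis unfolding pf using is_intertwining_const[OF V, of 0] by simp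
    qed
    finally show "dunkl n \<kappa> i (\<lambda>x. V ?f x - ?g x) = (\<lambda>x. 0)" by simp
  qed
  thus ?case by (simp add: fun_eq_iff)
qed

lemma dunkl_coord_sum_mult:
  assumes "f \<in> polys n" "i \<in> {1..n}"
  shows "dunkl n \<kappa> i (\<lambda>x. (\<Sum>l=1..n. of_real (x l)) * f x) =
     (\<lambda>x. f x + (\<Sum>l=1..n. of_real (x l)) * dunkl n \<kappa> i f x)"
proof
  fix x
  have "dunkl n \<kappa> i (\<lambda>x. \<Sum>l=1..n. of_real (x l) * f x) x =
      (\<Sum>l=1..n. dunkl n \<kappa> i (\<lambda>x. of_real (x l) * f x) x)"
    using assms by (subst dunkl_sum) (auto intro: polys_coord_mult)
  also have "\<dots> = (\<Sum>l=1..n. of_real (x l) * dunkl n \<kappa> i f x + dunkl_comm n \<kappa> i l f x)"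
    using assms by (intro sum.cong refl) (simp add: dunkl_coord_mult)
  also have "\<dots> = (\<Sum>l=1..n. of_real (x l)) * dunkl n \<kappa> i f x + (\<Sum>l=1..n. dunkl_comm n \<kappa> i l f x)"
    by (simp only: sum.distrib sum_distrib_right)
  also have "(\<Sum>l=1..n. dunkl_comm n \<kappa> i l f x) = f x + of_real \<kappa> * (\<Sum>k\<in>{1..n}-{i}. f (x \<circ> tr i k))
      + (\<Sum>l\<in>{1..n}-{i}. - of_real \<kappa> * f (x \<circ> tr i l))"
    using assms by (subst sum.remove[of _ i]) (auto simp: dunkl_comm_def intro!: sum.cong)
  also have "\<dots> = f x" by (simp only: sum_distrib_left[symmetric]) simp
  finally show "dunkl n \<kappa> i (\<lambda>x. (\<Sum>l=1..n. of_real (x l)) * f x) x =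
      f x + (\<Sum>l=1..n. of_real (x l)) * dunkl n \<kappa> i f x"
    by (simp only: sum_distrib_right add.commute)
qed

lemma coord_sum_hom: "(\<lambda>x. \<Sum>l=1..n. complex_of_real (x l)) \<in> hom_polys n (Suc 0)"
  by (intro hom_polys_sum hom_polys_coord)

text \<open>
  The coordinate sum is symmetric, so Dunkl operators obey the Leibniz rule for the product with it;
  this is why \<open>V\<close> commutes with the multiplication by it.
\<close>

lemma intertwining_coord_sum_mult:
  assumes k: "\<kappa> \<ge> 0" and V: "is_intertwining n \<kappa> V" and "f \<in> polys n"
  shows "V (\<lambda>x. (\<Sum>l=1..n. of_real (x l)) * f x) = (\<lambda>x. (\<Sum>l=1..n. of_real (x l)) * V f x)"
proof -
  let ?e = "\<lambda>x. \<Sum>l=1..n. complex_of_real (x l)"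
  have step: "V (\<lambda>x. ?e x * f x) = (\<lambda>x. ?e x * V f x)"
    if f: "f \<in> hom_polys n m" and IH: "\<And>i. i \<in> {1..n} \<Longrightarrow> V (\<lambda>x. ?e x * partial i f x) = (\<lambda>x. ?e x * V (partial i f) x)" for f m
  proof -
    have ef: "(\<lambda>x. ?e x * g x) \<in> hom_polys n (Suc m)" if "g \<in> hom_polys n m" for g
      using hom_polys_mult[OF coord_sum_hom that] by simp
    note Vf = is_intertwining_hom[OF V f]
    note fp = hom_polys_subset[OF f]
    have "(\<lambda>x. V (\<lambda>x. ?e x * f x) x - ?e x * V f x) = (\<lambda>x. 0)"
    proof (rule hom_poly_zero_if_dunkl_zero[OF k hom_polys_diff[OF is_intertwining_hom[OF V ef[OF f]] ef[OF Vf]]])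
      fix i assume i: "i \<in> {1..n}"
      note pp = partial_polys[OF fp i]
      have epp: "(\<lambda>x. ?e x * partial i f x) \<in> polys n"
        using polys_mult[OF hom_polys_subset[OF coord_sum_hom] pp] .
      have "dunkl n \<kappa> i (\<lambda>x. V (\<lambda>x. ?e x * f x) x - ?e x * V f x) =
         (\<lambda>x. dunkl n \<kappa> i (V (\<lambda>x. ?e x * f x)) x - dunkl n \<kappa> i (\<lambda>x. ?e x * V f x) x)"
        by (intro dunkl_diff hom_polys_subset[OF is_intertwining_hom[OF V ef[OF f]]] hom_polys_subset[OF ef[OF Vf]])
      also have "dunkl n \<kappa> i (V (\<lambda>x. ?e x * f x)) = V (partial i (\<lambda>x. ?e x * f x))"
        by (rule is_intertwining_dunkl[OF V hom_polys_subset[OF ef[OF f]] i])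
      also have "partial i (\<lambda>x. ?e x * f x) = (\<lambda>x. 1 * f x + 1 * (?e x * partial i f x))"
        using dunkl_coord_sum_mult[OF fp i, of 0] by (simp add: dunkl_zero_kappa)
      also have "V \<dots> = (\<lambda>x. V f x + ?e x * V (partial i f) x)"
        unfolding is_intertwining_linear[OF V fp epp] IH[OF i] by simp
      also have "dunkl n \<kappa> i (\<lambda>x. ?e x * V f x) = (\<lambda>x. V f x + ?e x * V (partial i f) x)"
        unfolding dunkl_coord_sum_mult[OF hom_polys_subset[OF Vf] i] is_intertwining_dunkl[OF V fp i] ..
      finally show "dunkl n \<kappa> i (\<lambda>x. V (\<lambda>x. ?e x * f x) x - ?e x * V f x) = (\<lambda>x. 0)" by simp
    qed
    thus ?thesis by (simp add: fun_eq_iff)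
  qed
  have hom: "V (\<lambda>x. ?e x * f x) = (\<lambda>x. ?e x * V f x)" if "f \<in> hom_polys n m" for f m
    using that
  proof (induction m arbitrary: f)
    case 0
    show ?case using partial_hom_0[OF 0] is_intertwining_const[OF V, of 0] by (intro step[OF 0]) simp
  next
    case (Suc m)
    show ?case using partial_hom_Suc[OF Suc.prems] by (intro step[OF Suc.prems] Suc.IH)
  qed
  show ?thesis using assms(3)
  proof (induction rule: polys_induct_hom)
    case (hom m f)
    thus ?case by (rule \<open>\<And>m f. f \<in> hom_polys n m \<Longrightarrow> V (\<lambda>x. ?e x * f x) = (\<lambda>x. ?e x * V f x)\<close>)
  next
    case (add f g)
    have e: "(\<lambda>x. ?e x * h x) \<in> polys n" if "h \<in> polys n" for h
      using polys_mult[OF hom_polys_subset[OF coord_sum_hom] that] .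
    show ?case
      using is_intertwining_linear[OF V e[OF add(1)] e[OF add(2)], of 1 1] is_intertwining_linear[OF V add(1,2), of 1 1] add
      by (simp add: distrib_left)
  qed
qed

lemma power_diff_coord_sum:
  assumes "a \<in> polys n"
  shows "\<exists>g\<in>polys n. \<forall>z. (a z - c * (\<Sum>l=1..n. of_real (z l))) ^ m = a z ^ m + (\<Sum>l=1..n. of_real (z l)) * g z"
proof (induction m)
  case 0
  thus ?case by (intro bexI[of _ "\<lambda>x. 0"]) (auto simp: polys_zero)
next
  case (Suc m)
  let ?e = "\<lambda>x. \<Sum>l=1..n. complex_of_real (x l)"
  have e: "?e \<in> polys n" using hom_polys_subset[OF coord_sum_hom] .
  from Suc obtain g where g: "g \<in> polys n" "\<And>z. (a z - c * ?e z) ^ m = a z ^ m + ?e z * g z" by blast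
  define h where "h z = (a z - c * ?e z) * g z - c * a z ^ m" for z
  have "h \<in> polys n" unfolding h_def[abs_def] using assms g e
    by (intro polys_diff polys_mult polys_power polys_const)
  moreover have "(a z - c * ?e z) ^ Suc m = a z ^ Suc m + ?e z * h z" for z
    by (simp add: g(2) h_def algebra_simps)
  ultimately show ?case by blast
qed

lemma intertwining_on_hyperplane:
  assumes k: "\<kappa> \<ge> 0" "k \<in> {1..n}" and V: "is_intertwining n \<kappa> V" and x: "(\<Sum>l=1..n. x l) = 0"
  shows "V (\<lambda>z. (\<nu> * of_real (z k) - c * (\<Sum>l=1..n. of_real (z l))) ^ m) x =
     \<nu> ^ m * (fact m / pochhammer (of_nat n * of_real \<kappa> + 1) m * axis_poly n \<kappa> k m x)"
proof -
  let ?e = "\<lambda>x. \<Sum>l=1..n. complex_of_real (x l)"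
  have ck: "(\<lambda>z. complex_of_real (z k)) \<in> polys n" using k(2) by (intro hom_polys_subset[OF hom_polys_coord])
  obtain g where g: "g \<in> polys n" "\<And>z. (\<nu> * of_real (z k) - c * ?e z) ^ m = (\<nu> * of_real (z k)) ^ m + ?e z * g z"
    using power_diff_coord_sum[OF polys_cmult[OF ck], of \<nu> c m] by auto
  have ex: "?e x = 0" using x by (simp flip: of_real_sum)
  have 1: "(\<lambda>z. (\<nu> * of_real (z k) - c * ?e z) ^ m) = (\<lambda>z. \<nu> ^ m * of_real (z k) ^ m + 1 * (?e z * g z))"
    by (simp add: g(2) power_mult_distrib)
  have 2: "V (\<lambda>z. \<nu> ^ m * of_real (z k) ^ m + 1 * (?e z * g z)) = (\<lambda>x. \<nu> ^ m * V (\<lambda>z. of_real (z k) ^ m) x + 1 * V (\<lambda>z. ?e z * g z) x)"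
    by (intro is_intertwining_linear[OF V] polys_power ck polys_mult g hom_polys_subset[OF coord_sum_hom])
  show ?thesis
    unfolding 1 2 intertwining_coord_sum_mult[OF k(1) V g(1)] intertwining_coord_power[OF k V] ex by simp
qed

section \<open>The Humbert series by total degree\<close>

text \<open>
  The multi-indices of total degree \<open>m\<close>.
\<close>

definition multi_indices_deg :: "nat \<Rightarrow> nat \<Rightarrow> (nat \<Rightarrow> nat) set" where
  "multi_indices_deg n m = {a \<in> multi_indices n. (\<Sum>i=1..n. a i) = m}"

lemma finite_multi_indices_deg: "finite (multi_indices_deg n m)"
proof (rule finite_subset)
  show "multi_indices_deg n m \<subseteq> ({1..n} \<rightarrow>\<^sub>E {..m})"
  proof
    fix a assume a: "a \<in> multi_indices_deg n m"
    have "a i \<le> m" if "i \<in> {1..n}" for i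
      using a member_le_sum[of i "{1..n}" a] that by (auto simp: multi_indices_deg_def)
    thus "a \<in> ({1..n} \<rightarrow>\<^sub>E {..m})" using a by (auto simp: multi_indices_deg_def multi_indices_def PiE_iff)
  qed
qed (auto intro: finite_PiE)

lemma fps_nth_prod_multi_indices:
  fixes F :: "nat \<Rightarrow> 'a::comm_ring_1 fps"
  shows "fps_nth (\<Prod>i=1..n. F i) m = (\<Sum>a\<in>multi_indices_deg n m. \<Prod>i=1..n. fps_nth (F i) (a i))"
proof (induction n arbitrary: m)
  case 0
  have "multi_indices_deg 0 m = (if m = 0 then {\<lambda>_. undefined} else {})"
    by (auto simp: multi_indices_deg_def multi_indices_def)
  thus ?case by simp
next
  case (Suc n)
  have S: "{1..Suc n} = insert (Suc n) {1..n}" by auto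
  let ?t = "\<lambda>a. \<Prod>i=1..n. fps_nth (F i) (a i)"
  have "fps_nth (\<Prod>i=1..Suc n. F i) m = fps_nth ((\<Prod>i=1..n. F i) * F (Suc n)) m"
    unfolding S by (simp add: mult.commute)
  also have "\<dots> = (\<Sum>j=0..m. \<Sum>a\<in>multi_indices_deg n j. ?t a * fps_nth (F (Suc n)) (m - j))"
    by (simp add: fps_mult_nth Suc sum_distrib_right)
  also have "\<dots> = (\<Sum>(j, a)\<in>(SIGMA j:{0..m}. multi_indices_deg n j). ?t a * fps_nth (F (Suc n)) (m - j))"
    by (rule sum.Sigma) (auto simp: finite_multi_indices_deg)
  also have "\<dots> = (\<Sum>a\<in>multi_indices_deg (Suc n) m. ?t a * fps_nth (F (Suc n)) (a (Suc n)))"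
  proof (rule sum.reindex_bij_witness[of _ "\<lambda>b. (\<Sum>i=1..n. b i, b(Suc n := undefined))" "\<lambda>(j, a). a(Suc n := m - j)"])
    have u: "(\<Sum>i=1..n. (a(Suc n := v)) i) = (\<Sum>i=1..n. a i)" for a and v :: nat
      by (intro sum.cong) auto
    have t: "?t (a(Suc n := v)) = ?t a" for a v
      by (intro prod.cong) auto
    have s: "(\<Sum>i=1..Suc n. a i) = (\<Sum>i=1..n. a i) + a (Suc n)" for a :: "nat \<Rightarrow> nat" by simp
    fix p assume p: "p \<in> (SIGMA j:{0..m}. multi_indices_deg n j)"
    obtain j a where pj: "p = (j, a)" "j \<le> m" "a \<in> multi_indices_deg n j" using p by auto
    have au: "a (Suc n) = undefined" using pj(3) by (auto simp: multi_indices_deg_def multi_indices_def PiE_def extensional_def)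
    have aj: "(\<Sum>i=1..n. a i) = j" using pj by (simp add: multi_indices_deg_def)
    show "(\<lambda>b. (\<Sum>i=1..n. b i, b(Suc n := undefined))) (case p of (j, a) \<Rightarrow> a(Suc n := m - j)) = p"
      unfolding pj(1) prod.case u aj using au by auto
    show "(case p of (j, a) \<Rightarrow> a(Suc n := m - j)) \<in> multi_indices_deg (Suc n) m"
      unfolding pj(1) prod.case multi_indices_deg_def mem_Collect_eq s u aj using pj(2,3)
      by (auto simp: multi_indices_deg_def multi_indices_def PiE_def extensional_def)
    show "?t (case p of (j, a) \<Rightarrow> a(Suc n := m - j)) * fps_nth (F (Suc n)) ((case p of (j, a) \<Rightarrow> a(Suc n := m - j)) (Suc n)) =
       (case p of (j, a) \<Rightarrow> ?t a * fps_nth (F (Suc n)) (m - j))"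
      unfolding pj(1) prod.case t by simp
  next
    have u: "(\<Sum>i=1..n. (a(Suc n := v)) i) = (\<Sum>i=1..n. a i)" for a and v :: nat
      by (intro sum.cong) auto
    fix b assume b: "b \<in> multi_indices_deg (Suc n) m"
    hence bs: "(\<Sum>i=1..n. b i) + b (Suc n) = m" by (simp add: multi_indices_deg_def)
    show "(case (\<Sum>i=1..n. b i, b(Suc n := undefined)) of (j, a) \<Rightarrow> a(Suc n := m - j)) = b"
      using bs by auto
    show "(\<Sum>i=1..n. b i, b(Suc n := undefined)) \<in> (SIGMA j:{0..m}. multi_indices_deg n j)"
      using b bs unfolding mem_Sigma_iff multi_indices_deg_def mem_Collect_eq u
      by (auto simp: multi_indices_def PiE_def extensional_def)
  qed
  also have "\<dots> = (\<Sum>a\<in>multi_indices_deg (Suc n) m. \<Prod>i=1..Suc n. fps_nth (F i) (a i))"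
    unfolding S by (simp add: mult.commute)
  finally show ?case .
qed

lemma pochhammer_nonneg_real: "(0::real) \<le> b \<Longrightarrow> 0 \<le> pochhammer b m"
  by (induction m) (auto simp: pochhammer_Suc)

lemma pochhammer_mono: "(0::real) \<le> b \<Longrightarrow> b \<le> c \<Longrightarrow> pochhammer b m \<le> pochhammer c m"
  unfolding pochhammer_prod by (intro prod_mono) auto

lemma prod_binom_fps_same:
  "(\<Prod>i\<in>A. binom_fps (b i) z) = binom_fps (\<Sum>i\<in>A. b i) z"
  by (induction A rule: infinite_finite_induct) (auto simp: binom_fps_0 binom_fps_mult)

lemma norm_binom_fps_nth_le:
  assumes "\<beta> \<ge> 0" "norm z \<le> R"
  shows "norm (fps_nth (binom_fps (of_real \<beta>) (z::complex)) m) \<le> fps_nth (binom_fps \<beta> R) m"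
proof -
  have "norm (fps_nth (binom_fps (of_real \<beta>) z) m) = pochhammer \<beta> m / fact m * norm z ^ m"
    using pochhammer_nonneg_real[OF assms(1), of m]
    by (simp add: binom_fps_nth norm_mult norm_divide norm_power pochhammer_of_real)
  also have "\<dots> \<le> pochhammer \<beta> m / fact m * R ^ m"
    using assms pochhammer_nonneg_real[OF assms(1), of m] by (intro mult_left_mono power_mono) auto
  finally show ?thesis by (simp add: binom_fps_nth)
qed

text \<open>
  After the passage to absolute values the product is majorized by the single series
  \<open>(1 - R X)\<close> to the power \<open>- \<Sum>\<^sub>i \<beta>\<^sub>i\<close>.
\<close>

lemma sum_norm_prod_binom_fps_le:
  fixes z :: "nat \<Rightarrow> complex" and \<beta> :: "nat \<Rightarrow> real" and N :: nat
  assumes "\<And>i. i \<in> {1..N} \<Longrightarrow> \<beta> i \<ge> 0" "\<And>i. i \<in> {1..N} \<Longrightarrow> norm (z i :: complex) \<le> R"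
  shows "(\<Sum>a\<in>multi_indices_deg N m. norm (\<Prod>i=1..N. fps_nth (binom_fps (of_real (\<beta> i)) (z i)) (a i)))
     \<le> pochhammer (\<Sum>i=1..N. \<beta> i) m / fact m * R ^ m"
proof -
  have "(\<Sum>a\<in>multi_indices_deg N m. norm (\<Prod>i=1..N. fps_nth (binom_fps (of_real (\<beta> i)) (z i)) (a i))) \<le>
     (\<Sum>a\<in>multi_indices_deg N m. \<Prod>i=1..N. fps_nth (binom_fps (\<beta> i) R) (a i))"
    unfolding prod_norm[symmetric]
    using assms by (intro sum_mono prod_mono conjI norm_binom_fps_nth_le norm_ge_zero) auto
  also have "\<dots> = fps_nth (\<Prod>i=1..N. binom_fps (\<beta> i) R) m" by (rule fps_nth_prod_multi_indices[symmetric])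
  finally show ?thesis by (simp add: prod_binom_fps_same binom_fps_nth)
qed

lemma norm_prod_binom_fps_nth_le:
  fixes z :: "nat \<Rightarrow> complex" and \<beta> :: "nat \<Rightarrow> real" and N :: nat
  assumes "\<And>i. i \<in> {1..N} \<Longrightarrow> \<beta> i \<ge> 0" "\<And>i. i \<in> {1..N} \<Longrightarrow> norm (z i :: complex) \<le> R"
  shows "norm (fps_nth (\<Prod>i=1..N. binom_fps (of_real (\<beta> i)) (z i)) m)
     \<le> pochhammer (\<Sum>i=1..N. \<beta> i) m / fact m * R ^ m"
  unfolding fps_nth_prod_multi_indices
  using norm_sum sum_norm_prod_binom_fps_le[where N=N and \<beta>=\<beta> and z=z and R=R, OF assms] by (rule order_trans)

lemma norm_prod_binom_fps_ratio_le:
  fixes z :: "nat \<Rightarrow> complex" and \<beta> :: "nat \<Rightarrow> real" and N :: nat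
  assumes "\<And>i. i \<in> {1..N} \<Longrightarrow> \<beta> i \<ge> 0" "\<And>i. i \<in> {1..N} \<Longrightarrow> norm (z i :: complex) \<le> R"
    and "(\<Sum>i=1..N. \<beta> i) \<le> c" "c > 0" "R \<ge> 0"
  shows "(\<Sum>a\<in>multi_indices_deg N m. norm (\<Prod>i=1..N. fps_nth (binom_fps (of_real (\<beta> i)) (z i)) (a i))) / pochhammer c m \<le> R ^ m / fact m"
    and "norm (fps_nth (\<Prod>i=1..N. binom_fps (of_real (\<beta> i)) (z i)) m / pochhammer (of_real c) m) \<le> R ^ m / fact m"
proof -
  have c: "pochhammer c m > 0" using assms(4) by (rule pochhammer_pos)
  have "0 \<le> (\<Sum>i=1..N. \<beta> i)" using assms(1) by (intro sum_nonneg) auto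
  hence "pochhammer (\<Sum>i=1..N. \<beta> i) m \<le> pochhammer c m" using assms(3) by (rule pochhammer_mono)
  hence le: "pochhammer (\<Sum>i=1..N. \<beta> i) m / fact m * R ^ m \<le> pochhammer c m / fact m * R ^ m"
    using assms(5) by (intro mult_right_mono divide_right_mono) auto
  have le1: "(\<Sum>a\<in>multi_indices_deg N m. norm (\<Prod>i=1..N. fps_nth (binom_fps (of_real (\<beta> i)) (z i)) (a i))) \<le> pochhammer c m / fact m * R ^ m"
    using sum_norm_prod_binom_fps_le[where N=N and \<beta>=\<beta> and z=z and R=R, OF assms(1,2)] le by (rule order_trans)
  have le2: "norm (fps_nth (\<Prod>i=1..N. binom_fps (of_real (\<beta> i)) (z i)) m) \<le> pochhammer c m / fact m * R ^ m"
    using norm_prod_binom_fps_nth_le[where N=N and \<beta>=\<beta> and z=z and R=R, OF assms(1,2)] le by (rule order_trans)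
  show "(\<Sum>a\<in>multi_indices_deg N m. norm (\<Prod>i=1..N. fps_nth (binom_fps (of_real (\<beta> i)) (z i)) (a i))) / pochhammer c m \<le> R ^ m / fact m"
    using le1 c by (simp add: divide_le_eq mult_ac)
  show "norm (fps_nth (\<Prod>i=1..N. binom_fps (of_real (\<beta> i)) (z i)) m / pochhammer (of_real c) m) \<le> R ^ m / fact m"
    using le2 c by (simp add: norm_divide pochhammer_of_real divide_le_eq mult_ac)
qed

lemma summable_power_over_fact: "summable (\<lambda>m. R ^ m / fact m :: real)"
  using summable_exp[of R] by (simp add: field_simps)

text \<open>
  Summation of the Humbert series by total degree. The assumption on the sum of the \<open>\<beta>\<^sub>i\<close> bounds
  the part of degree \<open>m\<close> by \<open>R\<^sup>m / m!\<close> with \<open>R = \<Sum>\<^sub>i |z\<^sub>i|\<close>, which gives absolute convergence.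
\<close>

lemma humbert_eq_suminf:
  fixes z :: "nat \<Rightarrow> complex" and \<beta> :: "nat \<Rightarrow> real" and c :: real
  assumes \<beta>: "\<And>i. i \<in> {1..N} \<Longrightarrow> \<beta> i \<ge> 0" and c: "(\<Sum>i=1..N. \<beta> i) \<le> c" "c > 0"
  defines "q \<equiv> \<lambda>m. fps_nth (\<Prod>i=1..N. binom_fps (of_real (\<beta> i)) (z i)) m / pochhammer (of_real c) m"
  shows "summable (\<lambda>m. norm (q m))"
    and "humbert N (\<lambda>i. of_real (\<beta> i)) (of_real c) z = (\<Sum>m. q m)"
proof -
  define R where "R = (\<Sum>i=1..N. norm (z i))"
  have R: "norm (z i) \<le> R" if "i \<in> {1..N}" for i
    unfolding R_def using that by (intro member_le_sum) auto
  have R0: "R \<ge> 0" unfolding R_def by (intro sum_nonneg) auto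
  note b1 = norm_prod_binom_fps_ratio_le(1)[where N=N and \<beta>=\<beta> and z=z and R=R and c=c, OF \<beta> R c R0] and b2 = norm_prod_binom_fps_ratio_le(2)[where N=N and \<beta>=\<beta> and z=z and R=R and c=c, OF \<beta> R c R0]
  show "summable (\<lambda>m. norm (q m))"
    by (rule summable_comparison_test'[OF summable_power_over_fact[of R], of 0])
       (simp only: q_def real_norm_def abs_norm_cancel, rule b2)
  define t where "t a = (\<Prod>i=1..N. pochhammer (of_real (\<beta> i)) (a i)) / pochhammer (of_real c) (\<Sum>i=1..N. a i)
          * (\<Prod>i=1..N. z i ^ a i / fact (a i))" for a
  have t: "t a = (\<Prod>i=1..N. fps_nth (binom_fps (of_real (\<beta> i)) (z i)) (a i)) / pochhammer (of_real c) m"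
    if "a \<in> multi_indices_deg N m" for a m
    using that by (simp add: t_def multi_indices_deg_def binom_fps_nth prod.distrib prod_dividef)
  have qt: "q m = (\<Sum>a\<in>multi_indices_deg N m. t a)" for m
    by (simp add: q_def fps_nth_prod_multi_indices t sum_divide_distrib)
  have nt: "(\<Sum>a\<in>multi_indices_deg N m. norm (t a)) \<le> R ^ m / fact m" for m
    using b1[of m] pochhammer_pos[OF c(2), of m]
    by (simp add: t norm_divide pochhammer_of_real sum_divide_distrib)
  define A where "A M = (\<Union>m\<in>{..<M}. multi_indices_deg N m)" for M
  have A: "finite (A M)" "A M \<subseteq> multi_indices N" for M
    unfolding A_def by (intro finite_UN_I finite_multi_indices_deg finite_lessThan) (auto simp: multi_indices_deg_def)
  have sumA: "(\<Sum>a\<in>A M. f a) = (\<Sum>m<M. \<Sum>a\<in>multi_indices_deg N m. f a)" for M and f :: "(nat \<Rightarrow> nat) \<Rightarrow> 'b::comm_monoid_add"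
    unfolding A_def
  proof (rule sum.UNION_disjoint)
    show "\<forall>i\<in>{..<M}. \<forall>j\<in>{..<M}. i \<noteq> j \<longrightarrow> multi_indices_deg N i \<inter> multi_indices_deg N j = {}" by (auto simp: multi_indices_deg_def)
  qed (auto simp: finite_multi_indices_deg)
  have sub: "\<exists>M. X \<subseteq> A M" if X: "finite X" "X \<subseteq> multi_indices N" for X
  proof -
    have "(\<Sum>i=1..N. a i) < Suc (\<Sum>a\<in>X. \<Sum>i=1..N. a i)" if "a \<in> X" for a
      using member_le_sum[of a X "\<lambda>a. \<Sum>i=1..N. a i"] that X by auto
    thus ?thesis using X(2)
      by (intro exI[of _ "Suc (\<Sum>a\<in>X. \<Sum>i=1..N. a i)"]) (auto simp: A_def multi_indices_deg_def)
  qed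
  have Amono: "A M \<subseteq> A M'" if "M \<le> M'" for M M' using that by (force simp: A_def)
  have "(\<lambda>a. norm (t a)) summable_on multi_indices N"
  proof (rule nonneg_bdd_above_summable_on)
    show "bdd_above (sum (\<lambda>a. norm (t a)) ` {F. F \<subseteq> multi_indices N \<and> finite F})"
    proof (rule bdd_aboveI2)
      fix F assume "F \<in> {F. F \<subseteq> multi_indices N \<and> finite F}"
      then obtain M where M: "F \<subseteq> A M" using sub by blast
      have "(\<Sum>a\<in>F. norm (t a)) \<le> (\<Sum>a\<in>A M. norm (t a))"
        using M A by (intro sum_mono2) auto
      also have "\<dots> \<le> (\<Sum>m<M. R ^ m / fact m)" unfolding sumA by (intro sum_mono nt)
      also have "\<dots> \<le> (\<Sum>m. R ^ m / fact m)"
        using R0 by (intro sum_le_suminf summable_power_over_fact) auto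
      finally show "(\<Sum>a\<in>F. norm (t a)) \<le> (\<Sum>m. R ^ m / fact m)" .
    qed
  qed auto
  hence "t summable_on multi_indices N" by (rule abs_summable_summable)
  hence "(t has_sum infsum t (multi_indices N)) (multi_indices N)" by (rule has_sum_infsum)
  hence lim: "(sum t \<longlongrightarrow> infsum t (multi_indices N)) (finite_subsets_at_top (multi_indices N))"
    by (simp add: has_sum_def)
  have "filterlim A (finite_subsets_at_top (multi_indices N)) sequentially"
    unfolding filterlim_finite_subsets_at_top
  proof (intro allI impI)
    fix X assume X: "finite X \<and> X \<subseteq> multi_indices N"
    then obtain M where "X \<subseteq> A M" using sub by blast
    hence "X \<subseteq> A M'" if "M' \<ge> M" for M' using Amono[OF that] by blast
    thus "\<forall>\<^sub>F M in sequentially. finite (A M) \<and> X \<subseteq> A M \<and> A M \<subseteq> multi_indices N"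
      using A by (auto simp: eventually_sequentially)
  qed
  from filterlim_compose[OF lim this] have "(\<lambda>M. \<Sum>m<M. q m) \<longlonglongrightarrow> infsum t (multi_indices N)"
    by (simp add: sumA qt)
  hence "q sums infsum t (multi_indices N)" by (simp add: sums_def)
  thus "humbert N (\<lambda>i. of_real (\<beta> i)) (of_real c) z = (\<Sum>m. q m)"
    unfolding humbert_def t_def[symmetric] by (simp add: sums_iff)
qed

section \<open>Shift of the variables of the Humbert function\<close>

text \<open>
  This rests on \<open>1 - z X = (1 - w X) (1 - (z - w) S)\<close> with \<open>S = X / (1 - w X)\<close>.
\<close>

lemma binom_fps_shift:
  "binom_fps \<kappa> z = binom_fps \<kappa> w * (binom_fps \<kappa> (z - w) oo (fps_X * binom_fps 1 w))"
proof (rule binom_fps_unique[symmetric])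
  let ?G = "binom_fps 1 w" and ?S = "fps_X * binom_fps 1 w" and ?B = "binom_fps \<kappa> (z - w)" and ?H = "binom_fps \<kappa> w"
  let ?Lz = "1 - fps_const z * fps_X" and ?Lw = "1 - fps_const w * fps_X"
  have S0: "fps_nth ?S 0 = 0" by simp
  have GL: "?Lw * ?G = 1" by (rule binom_fps_1_inverse)
  have S': "fps_deriv ?S = ?G * ?G"
  proof -
    have "fps_deriv ?S = ?G + fps_X * fps_deriv ?G" by simp
    thus ?thesis unfolding X_deriv_binom_fps by (simp add: algebra_simps)
  qed
  have H': "fps_deriv ?H = fps_const (\<kappa> * w) * ?G * ?H"
  proof -
    have "fps_deriv ?H = (?Lw * ?G) * fps_deriv ?H" unfolding GL by simp
    also have "\<dots> = ?G * (?Lw * fps_deriv ?H)" by (simp only: mult_ac)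
    finally show ?thesis unfolding binom_fps_ode by (simp only: mult_ac)
  qed
  have comp: "(1 - fps_const (z - w) * ?S) * (fps_deriv ?B oo ?S) = fps_const (\<kappa> * (z - w)) * (?B oo ?S)"
  proof -
    have "((1 - fps_const (z - w) * fps_X) * fps_deriv ?B) oo ?S = (fps_const (\<kappa> * (z - w)) * ?B) oo ?S"
      unfolding binom_fps_ode ..
    thus ?thesis
      by (simp add: fps_compose_mult_distrib[OF S0] fps_compose_sub_distrib fps_X_fps_compose_startby0[OF S0])
  qed
  have L: "1 - fps_const (z - w) * ?S = ?G * ?Lz"
  proof -
    have "1 - fps_const (z - w) * ?S = ?Lw * ?G - fps_const (z - w) * ?S" using GL by simp
    also have "\<dots> = ?G * ?Lz" by (simp add: algebra_simps flip: fps_const_sub)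
    finally show ?thesis .
  qed
  have "?Lz * fps_deriv (?H * (?B oo ?S)) = ?Lz * fps_deriv ?H * (?B oo ?S) + ?H * (?Lz * (fps_deriv ?B oo ?S) * fps_deriv ?S)"
    by (simp only: fps_deriv_mult fps_compose_deriv[OF S0]) (simp add: algebra_simps)
  also have "\<dots> = ?Lz * (fps_const (\<kappa> * w) * ?G * ?H) * (?B oo ?S) + ?H * (?G * ((?G * ?Lz) * (fps_deriv ?B oo ?S)))"
    unfolding H' S' by (simp only: mult_ac)
  also have "\<dots> = ?Lz * (fps_const (\<kappa> * w) * ?G * ?H) * (?B oo ?S) + ?H * (?G * (fps_const (\<kappa> * (z - w)) * (?B oo ?S)))"
    unfolding L[symmetric] comp ..
  also have "\<dots> = fps_const (\<kappa> * z) * (?Lw * ?G) * (?H * (?B oo ?S))"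
    by (simp add: algebra_simps flip: fps_const_sub fps_const_mult)
  finally show "?Lz * fps_deriv (?H * (?B oo ?S)) = fps_const (\<kappa> * z) * (?H * (?B oo ?S))"
    unfolding GL by simp
  show "fps_nth (?H * (?B oo ?S)) 0 = 1" by (simp add: binom_fps_nth)
qed

lemma binom_fps_arg_0: "binom_fps b 0 = 1"
  by (rule fps_ext) (simp add: binom_fps_nth power_0_left)

lemma nth_mult_compose:
  fixes P :: "'a::comm_ring_1 fps"
  assumes "fps_nth S 0 = 0"
  shows "fps_nth (H * (P oo S)) m = (\<Sum>j=0..m. fps_nth P j * fps_nth (H * S ^ j) m)"
proof -
  have "fps_nth (H * (P oo S)) m = (\<Sum>r=0..m. fps_nth H r * (\<Sum>j=0..m - r. fps_nth P j * fps_nth (S ^ j) (m - r)))"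
    by (simp add: fps_mult_nth fps_compose_nth)
  also have "\<dots> = (\<Sum>r=0..m. fps_nth H r * (\<Sum>j=0..m. fps_nth P j * fps_nth (S ^ j) (m - r)))"
    using startsby_zero_power_prefix[OF assms]
    by (intro sum.cong refl arg_cong[where f = "(*) _"] sum.mono_neutral_left) auto
  also have "\<dots> = (\<Sum>r=0..m. \<Sum>j=0..m. fps_nth P j * (fps_nth H r * fps_nth (S ^ j) (m - r)))"
    by (simp add: sum_distrib_left mult_ac)
  also have "\<dots> = (\<Sum>j=0..m. \<Sum>r=0..m. fps_nth P j * (fps_nth H r * fps_nth (S ^ j) (m - r)))"
    by (rule sum.swap)
  finally show ?thesis by (simp add: fps_mult_nth sum_distrib_left)
qed

lemma prod_binom_fps_shift:
  fixes z :: "nat \<Rightarrow> 'a::field_char_0"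
  assumes "n \<ge> 1"
  shows "fps_nth (\<Prod>i=1..n. binom_fps \<kappa> (z i)) m =
     (\<Sum>j=0..m. fps_nth (\<Prod>i=1..n-1. binom_fps \<kappa> (z i - z n)) j *
        (pochhammer (of_nat n * \<kappa> + of_nat j) (m - j) / fact (m - j) * z n ^ (m - j)))"
proof -
  let ?w = "z n" and ?S = "fps_X * binom_fps 1 (z n)" and ?P = "\<Prod>i=1..n-1. binom_fps \<kappa> (z i - z n)"
  have S0: "fps_nth ?S 0 = 0" by simp
  have n: "{1..n} = insert n {1..n-1}" "n \<notin> {1..n-1}" using assms by auto
  have "(\<Prod>i=1..n. binom_fps \<kappa> (z i)) = (\<Prod>i=1..n. binom_fps \<kappa> ?w * (binom_fps \<kappa> (z i - ?w) oo ?S))"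
    by (intro prod.cong refl binom_fps_shift)
  also have "\<dots> = binom_fps (of_nat n * \<kappa>) ?w * (\<Prod>i=1..n. binom_fps \<kappa> (z i - ?w) oo ?S)"
    unfolding prod.distrib prod_binom_fps_same by simp
  also have "(\<Prod>i=1..n. binom_fps \<kappa> (z i - ?w) oo ?S) = ?P oo ?S"
    unfolding fps_compose_prod_distrib[OF S0] n(1) using n(2) by (simp add: binom_fps_arg_0)
  finally have 1: "(\<Prod>i=1..n. binom_fps \<kappa> (z i)) = binom_fps (of_nat n * \<kappa>) ?w * (?P oo ?S)" .
  have "fps_nth (binom_fps (of_nat n * \<kappa>) ?w * ?S ^ j) m =
     pochhammer (of_nat n * \<kappa> + of_nat j) (m - j) / fact (m - j) * z n ^ (m - j)" if "j \<le> m" for j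
  proof -
    have "binom_fps 1 ?w ^ j = binom_fps (of_nat j) ?w"
      using prod_binom_fps_same[of "\<lambda>_. 1" ?w "{1..j}"] by simp
    hence "binom_fps (of_nat n * \<kappa>) ?w * ?S ^ j = fps_X ^ j * binom_fps (of_nat n * \<kappa> + of_nat j) ?w"
      by (simp add: power_mult_distrib binom_fps_mult mult.left_commute)
    thus ?thesis using that by (simp add: fps_X_power_mult_nth binom_fps_nth)
  qed
  thus ?thesis unfolding 1 nth_mult_compose[OF S0] by (intro sum.cong) auto
qed

lemma humbert_shift:
  fixes z :: "nat \<Rightarrow> complex"
  assumes "n \<ge> 1" "k > 0"
  shows "humbert n (\<lambda>_. of_real k) (of_nat n * of_real k) z =
     exp (z n) * humbert (n - 1) (\<lambda>_. of_real k) (of_nat n * of_real k) (\<lambda>i. z i - z n)"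
proof -
  define c where "c = real n * k"
  have c: "c > 0" "(of_nat n * of_real k :: complex) = of_real c" using assms by (auto simp: c_def)
  have b1: "(\<Sum>i=1..n. k) \<le> c" by (simp add: c_def)
  have b2: "(\<Sum>i=1..n-1. k) \<le> c" using assms by (simp add: c_def)
  define p where "p m = fps_nth (\<Prod>i=1..n-1. binom_fps (of_real k) (z i - z n)) m / pochhammer (complex_of_real c) m" for m
  have nz: "pochhammer (complex_of_real c + of_nat j) m \<noteq> 0" for j m
  proof -
    have "pochhammer (complex_of_real c + of_nat j) m = of_real (pochhammer (c + real j) m)"
      by (simp add: pochhammer_of_real[symmetric])
    moreover have "pochhammer (c + real j) m > 0" using c by (intro pochhammer_pos) auto
    ultimately show ?thesis by simp
  qed
  have "humbert n (\<lambda>_. of_real k) (of_nat n * of_real k) z =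
     (\<Sum>m. fps_nth (\<Prod>i=1..n. binom_fps (of_real k) (z i)) m / pochhammer (complex_of_real c) m)"
    unfolding c(2) using assms by (intro humbert_eq_suminf b1 c) auto
  also have "\<dots> = (\<Sum>m. \<Sum>j\<le>m. p j * (z n ^ (m - j) /\<^sub>R fact (m - j)))"
  proof (intro suminf_cong)
    fix m
    have "fps_nth (\<Prod>i=1..n. binom_fps (of_real k) (z i)) m / pochhammer (complex_of_real c) m =
      (\<Sum>j=0..m. fps_nth (\<Prod>i=1..n-1. binom_fps (of_real k) (z i - z n)) j *
        (pochhammer (of_real c + of_nat j) (m - j) / fact (m - j) * z n ^ (m - j)) / pochhammer (complex_of_real c) m)"
      unfolding prod_binom_fps_shift[OF assms(1)] c(2) sum_divide_distrib ..
    also have "\<dots> = (\<Sum>j=0..m. p j * (z n ^ (m - j) /\<^sub>R fact (m - j)))"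
    proof (intro sum.cong refl)
      fix j assume "j \<in> {0..m}"
      hence "pochhammer (complex_of_real c) m = pochhammer (of_real c) j * pochhammer (of_real c + of_nat j) (m - j)"
        by (intro pochhammer_product) auto
      thus "fps_nth (\<Prod>i=1..n-1. binom_fps (of_real k) (z i - z n)) j *
        (pochhammer (of_real c + of_nat j) (m - j) / fact (m - j) * z n ^ (m - j)) / pochhammer (complex_of_real c) m =
         p j * (z n ^ (m - j) /\<^sub>R fact (m - j))"
        using nz[of j "m - j"] nz[of 0 j] by (simp add: p_def scaleR_conv_of_real field_simps)
    qed
    finally show "fps_nth (\<Prod>i=1..n. binom_fps (of_real k) (z i)) m / pochhammer (complex_of_real c) m =
       (\<Sum>j\<le>m. p j * (z n ^ (m - j) /\<^sub>R fact (m - j)))" by (simp add: atLeast0AtMost)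
  qed
  also have "\<dots> = (\<Sum>m. p m) * (\<Sum>m. z n ^ m /\<^sub>R fact m)"
  proof (rule Cauchy_product[symmetric])
    show "summable (\<lambda>m. norm (p m))"
      unfolding p_def using assms by (intro humbert_eq_suminf(1) b2 c) auto
  qed (rule summable_norm_exp)
  also have "(\<Sum>m. p m) = humbert (n - 1) (\<lambda>_. of_real k) (of_nat n * of_real k) (\<lambda>i. z i - z n)"
    unfolding c(2) p_def using assms by (intro humbert_eq_suminf(2)[symmetric] b2 c) auto
  finally show ?thesis by (simp add: exp_def mult.commute)
qed

section \<open>The Bessel function as a series\<close>

lemma prod_binom_fps_nth_scale:
  fixes b z :: "nat \<Rightarrow> 'a::field_char_0" and n :: nat
  shows
  "fps_nth (\<Prod>i=1..n. binom_fps (b i) (\<nu> * z i)) m = \<nu> ^ m * fps_nth (\<Prod>i=1..n. binom_fps (b i) (z i)) m"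
proof -
  have "(\<Prod>i=1..n. fps_nth (binom_fps (b i) (\<nu> * z i)) (a i)) = \<nu> ^ m * (\<Prod>i=1..n. fps_nth (binom_fps (b i) (z i)) (a i))"
    if "a \<in> multi_indices_deg n m" for a
  proof -
    have "(\<Prod>i=1..n. fps_nth (binom_fps (b i) (\<nu> * z i)) (a i)) = (\<Prod>i=1..n. \<nu> ^ a i * fps_nth (binom_fps (b i) (z i)) (a i))"
      by (intro prod.cong) (auto simp: binom_fps_nth power_mult_distrib)
    also have "\<dots> = \<nu> ^ (\<Sum>i=1..n. a i) * (\<Prod>i=1..n. fps_nth (binom_fps (b i) (z i)) (a i))"
      by (simp only: prod.distrib power_sum)
    finally show ?thesis using that by (simp add: multi_indices_deg_def)
  qed
  thus ?thesis by (simp add: fps_nth_prod_multi_indices sum_distrib_left)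
qed

text \<open>
  The contribution of the \<open>k\<close>-th coordinate to the Bessel function; it makes sense at \<open>\<kappa> = 0\<close> as
  well.
\<close>

definition bessel_series :: "nat \<Rightarrow> real \<Rightarrow> complex \<Rightarrow> (nat \<Rightarrow> real) \<Rightarrow> nat \<Rightarrow> complex" where
  "bessel_series n \<kappa> \<nu> x k = (\<Sum>m. \<nu> ^ m * axis_poly n \<kappa> k m x / pochhammer (of_nat n * of_real \<kappa> + 1) m)"

lemma norm_bessel_series_term_le:
  assumes "\<kappa> \<ge> 0" "k \<in> {1..n}"
  shows "norm (\<nu> ^ m * axis_poly n \<kappa> k m x / pochhammer (of_nat n * of_real \<kappa> + 1) m) \<le> (norm \<nu> * (\<Sum>i=1..n. \<bar>x i\<bar>)) ^ m / fact m"
proof -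
  define \<beta> where "\<beta> j = \<kappa> + (if j = k then 1 else 0)" for j
  define R where "R = (\<Sum>i=1..n. \<bar>x i\<bar>)"
  have axis_poly: "axis_poly n \<kappa> k m x = fps_nth (\<Prod>i=1..n. binom_fps (of_real (\<beta> i)) (of_real (x i))) m"
    unfolding axis_poly_def sym_gen_mult_binom_fps[OF assms(2)] by (simp add: \<beta>_def if_distrib cong: if_cong)
  have p: "pochhammer (of_nat n * of_real \<kappa> + 1 :: complex) m = pochhammer (of_real (real n * \<kappa> + 1)) m" by simp
  have le: "norm (axis_poly n \<kappa> k m x / pochhammer (of_nat n * of_real \<kappa> + 1) m) \<le> R ^ m / fact m"
    unfolding axis_poly p
  proof (rule norm_prod_binom_fps_ratio_le(2))
    show "sum \<beta> {1..n} \<le> real n * \<kappa> + 1" using assms(2) by (simp add: \<beta>_def sum.distrib)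
    show "real n * \<kappa> + 1 > 0" using assms(1) by (simp add: add_nonneg_pos)
    show "R \<ge> 0" unfolding R_def by (intro sum_nonneg) auto
    show "norm (complex_of_real (x i)) \<le> R" if "i \<in> {1..n}" for i
      using that member_le_sum[of i "{1..n}" "\<lambda>i. \<bar>x i\<bar>"] by (simp add: R_def)
  qed (use assms(1) in \<open>auto simp: \<beta>_def\<close>)
  have "norm (\<nu> ^ m * axis_poly n \<kappa> k m x / pochhammer (of_nat n * of_real \<kappa> + 1) m) =
     norm \<nu> ^ m * norm (axis_poly n \<kappa> k m x / pochhammer (of_nat n * of_real \<kappa> + 1) m)"
    by (simp add: norm_mult norm_divide norm_power)
  also have "\<dots> \<le> norm \<nu> ^ m * (R ^ m / fact m)" using le by (intro mult_left_mono) auto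
  finally show ?thesis by (simp add: R_def power_mult_distrib)
qed

lemma summable_bessel_series:
  assumes "\<kappa> \<ge> 0" "k \<in> {1..n}"
  shows "summable (\<lambda>m. \<nu> ^ m * axis_poly n \<kappa> k m x / pochhammer (of_nat n * of_real \<kappa> + 1) m)"
  by (rule summable_comparison_test'[OF summable_power_over_fact, of 0]) (rule norm_bessel_series_term_le[OF assms])

lemma sum_permutes_apply:
  fixes g :: "nat \<Rightarrow> complex"
  assumes "n \<ge> 1"
  shows "of_nat n * (\<Sum>\<sigma> | \<sigma> permutes {1..n}. g (\<sigma> n)) = fact n * (\<Sum>k=1..n. g k)"
proof -
  let ?P = "{\<sigma>. \<sigma> permutes {1..n}}"
  have n: "n \<in> {1..n}" using assms by auto
  \<comment> \<open>Composition with the exchange of \<open>k\<close> and \<open>n\<close> permutes the summands.\<close>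
  have eq: "(\<Sum>\<sigma>\<in>?P. g (\<sigma> n)) = (\<Sum>\<sigma>\<in>?P. g (\<sigma> k))" if "k \<in> {1..n}" for k
    by (rule sum.reindex_bij_witness[of _ "\<lambda>\<sigma>. \<sigma> \<circ> tr k n" "\<lambda>\<sigma>. \<sigma> \<circ> tr k n"])
       (use tr_permutes[OF that n] in \<open>auto simp: comp_assoc comp_apply intro!: permutes_compose\<close>)
  have "of_nat n * (\<Sum>\<sigma>\<in>?P. g (\<sigma> n)) = (\<Sum>k=1..n. \<Sum>\<sigma>\<in>?P. g (\<sigma> n))" by simp
  also have "\<dots> = (\<Sum>k=1..n. \<Sum>\<sigma>\<in>?P. g (\<sigma> k))" by (rule sum.cong[OF refl eq])
  also have "\<dots> = (\<Sum>\<sigma>\<in>?P. \<Sum>k=1..n. g (\<sigma> k))" by (rule sum.swap)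
  also have "\<dots> = (\<Sum>\<sigma>\<in>?P. \<Sum>k=1..n. g k)"
  proof (rule sum.cong[OF refl])
    fix \<sigma> assume "\<sigma> \<in> ?P"
    hence "\<sigma> permutes {1..n}" by simp
    from sum.permute[OF this, of g] show "(\<Sum>k=1..n. g (\<sigma> k)) = (\<Sum>k=1..n. g k)" by (simp add: o_def)
  qed
  also have "\<dots> = fact n * (\<Sum>k=1..n. g k)" using card_permutations[of "{1..n}" n] by simp
  finally show ?thesis .
qed

lemma bessel_eq_series:
  assumes n: "n \<ge> 1" and \<kappa>: "\<kappa> \<ge> 0" and x: "(\<Sum>i=1..n. x i) = 0"
    and l: "l = (\<lambda>i. if i = n then (of_nat n - 1) * \<nu> / of_nat n else - \<nu> / of_nat n)"
  shows "bessel n \<kappa> l x = (\<Sum>k=1..n. bessel_series n \<kappa> \<nu> x k) / of_nat n"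
proof -
  let ?P = "{\<sigma>. \<sigma> permutes {1..n}}"
  have nz: "(of_nat n :: complex) \<noteq> 0" using n by simp
  have kern: "dunkl_kernel n \<kappa> x (l \<circ> \<sigma>) = bessel_series n \<kappa> \<nu> x (inv \<sigma> n)" if s: "\<sigma> permutes {1..n}" for \<sigma>
  proof -
    define k where "k = inv \<sigma> n"
    have k: "k \<in> {1..n}" using permutes_in_image[OF permutes_inv[OF s], of n] n by (simp add: k_def)
    \<comment> \<open>Only the coordinate \<open>k\<close> is paired with the entry of \<open>l\<close> that differs from \<open>- \<nu> / n\<close>.\<close>
    have sk: "\<sigma> i = n \<longleftrightarrow> i = k" for i using s by (metis k_def permutes_inverses)
    have "(\<Sum>i=1..n. complex_of_real (z i) * (l \<circ> \<sigma>) i) = \<nu> * of_real (z k) - \<nu> / of_nat n * (\<Sum>i=1..n. of_real (z i))" for z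
    proof -
      have "of_real (z i) * (l \<circ> \<sigma>) i = (if i = k then \<nu> * of_real (z k) else 0) - \<nu> / of_nat n * of_real (z i)" for i
        using nz by (simp add: l comp_apply sk field_simps)
      thus ?thesis using k by (simp only: sum_subtractf sum_distrib_left[symmetric]) simp
    qed
    hence "dunkl_kernel n \<kappa> x (l \<circ> \<sigma>) =
      (\<Sum>m. 1 / fact m * intertwining n \<kappa> (\<lambda>z. (\<nu> * of_real (z k) - \<nu> / of_nat n * (\<Sum>i=1..n. of_real (z i))) ^ m) x)"
      unfolding dunkl_kernel_def by simp
    thus ?thesis
      unfolding intertwining_on_hyperplane[OF \<kappa> k is_intertwining_intertwining[OF \<kappa>] x] bessel_series_def k_def[symmetric]
      by (simp add: mult.assoc mult.left_commute)
  qed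
  have "bessel n \<kappa> l x = 1 / fact n * (\<Sum>\<sigma>\<in>?P. bessel_series n \<kappa> \<nu> x (inv \<sigma> n))"
    unfolding bessel_def using kern by simp
  also have "(\<Sum>\<sigma>\<in>?P. bessel_series n \<kappa> \<nu> x (inv \<sigma> n)) = (\<Sum>\<sigma>\<in>?P. bessel_series n \<kappa> \<nu> x (\<sigma> n))"
    by (rule sum_permutations_inverse[symmetric])
  also have "\<dots> = fact n * (\<Sum>k=1..n. bessel_series n \<kappa> \<nu> x k) / of_nat n"
    using sum_permutes_apply[OF n, of "bessel_series n \<kappa> \<nu> x"] nz by (simp add: field_simps)
  finally show ?thesis by simp
qed

lemma humbert_eq_series:
  assumes n: "n \<ge> 1" and \<kappa>: "\<kappa> > 0"
  shows "humbert n (\<lambda>_. of_real \<kappa>) (of_nat n * of_real \<kappa>) (\<lambda>i. \<nu> * of_real (x i)) =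
     (\<Sum>k=1..n. bessel_series n \<kappa> \<nu> x k) / of_nat n"
proof -
  have nz: "(of_nat n :: complex) \<noteq> 0" "complex_of_real \<kappa> \<noteq> 0" using n \<kappa> by auto
  define c where "c = real n * \<kappa>"
  have c: "of_nat n * of_real \<kappa> = complex_of_real c" "c > 0" using n \<kappa> by (auto simp: c_def)
  let ?t = "\<lambda>k m. \<nu> ^ m * axis_poly n \<kappa> k m x / pochhammer (of_nat n * of_real \<kappa> + 1) m"
  have trm: "fps_nth (\<Prod>i=1..n. binom_fps (of_real \<kappa>) (\<nu> * of_real (x i))) m / pochhammer (complex_of_real c) m
     = (\<Sum>k=1..n. ?t k m) / of_nat n" for m
  proof -
    have k0: "\<kappa> \<ge> 0" using \<kappa> by simp
    let ?q = "fps_nth (sym_gen n \<kappa> x) m" and ?P = "pochhammer (complex_of_real c + 1) m"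
    have "fps_nth (\<Prod>i=1..n. binom_fps (of_real \<kappa>) (\<nu> * of_real (x i))) m = \<nu> ^ m * ?q"
      by (simp add: prod_binom_fps_nth_scale sym_gen_def)
    moreover have "(\<Sum>k=1..n. ?t k m) = \<nu> ^ m * (\<Sum>k=1..n. axis_poly n \<kappa> k m x) / ?P"
      by (simp add: sum_distrib_left sum_divide_distrib c)
    moreover have "of_real \<kappa> * (\<Sum>k=1..n. axis_poly n \<kappa> k m x) = (of_nat m + of_real c) * ?q"
      using sum_axis_poly[of \<kappa> n m x] by (simp add: c)
    hence "(\<Sum>k=1..n. axis_poly n \<kappa> k m x) = (of_nat m + of_real c) * ?q / of_real \<kappa>"
      using nz by (simp add: field_simps)
    moreover have "pochhammer (complex_of_real c) m * (of_real c + of_nat m) = of_real c * ?P"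
      using pochhammer_Suc[of "complex_of_real c" m] pochhammer_rec[of "complex_of_real c" m] by simp
    moreover have "?P \<noteq> 0" using pochhammer_Suc_kappa_neq_0[OF k0, of n m] by (simp add: c)
    moreover have "pochhammer (complex_of_real c) m \<noteq> 0"
    proof -
      have "pochhammer c m > 0" using c(2) by (rule pochhammer_pos)
      thus ?thesis by (simp add: pochhammer_of_real)
    qed
    moreover have "complex_of_real c = of_nat n * of_real \<kappa>" using c(1) by simp
    ultimately show ?thesis using nz by (simp add: frac_eq_eq) (simp add: algebra_simps)
  qed
  have "humbert n (\<lambda>_. of_real \<kappa>) (of_nat n * of_real \<kappa>) (\<lambda>i. \<nu> * of_real (x i)) =
     (\<Sum>m. (\<Sum>k=1..n. ?t k m) / of_nat n)"
    unfolding c(1) trm[unfolded c(1), symmetric] using \<kappa> c(2)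
    by (intro humbert_eq_suminf(2)) (auto simp: c_def)
  also have "\<dots> = (\<Sum>m. \<Sum>k=1..n. ?t k m) / of_nat n"
    using \<kappa> by (intro suminf_divide summable_sum summable_bessel_series) auto
  also have "(\<Sum>m. \<Sum>k=1..n. ?t k m) = (\<Sum>k=1..n. \<Sum>m. ?t k m)"
    using \<kappa> by (intro suminf_sum summable_bessel_series) auto
  finally show ?thesis by (simp only: bessel_series_def)
qed

lemma tendsto_pochhammer:
  assumes "(f \<longlongrightarrow> (a::complex)) F"
  shows "((\<lambda>y. pochhammer (f y) m) \<longlongrightarrow> pochhammer a m) F"
  unfolding pochhammer_prod by (intro tendsto_intros assms)

lemma tendsto_bessel_series:
  assumes k: "k \<in> {1..n}"
  shows "((\<lambda>\<kappa>. bessel_series n \<kappa> \<nu> x k) \<longlongrightarrow> bessel_series n 0 \<nu> x k) (at_right 0)"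
proof -
  define M where "M m = (norm \<nu> * (\<Sum>i=1..n. \<bar>x i\<bar>)) ^ m / fact m" for m
  have id: "((\<lambda>\<kappa>. complex_of_real \<kappa>) \<longlongrightarrow> of_real 0) (at_right 0)"
    by (intro tendsto_of_real tendsto_ident_at)
  have lim: "((\<lambda>\<kappa>. \<nu> ^ m * axis_poly n \<kappa> k m x / pochhammer (of_nat n * of_real \<kappa> + 1) m) \<longlongrightarrow>
      \<nu> ^ m * axis_poly n 0 k m x / pochhammer (of_nat n * of_real 0 + 1) m) (at_right 0)" for m
    unfolding axis_poly_def sym_gen_mult_binom_fps[OF k] fps_nth_prod_multi_indices binom_fps_nth
    using pochhammer_Suc_kappa_neq_0[of 0 n m]
    by (intro tendsto_intros tendsto_pochhammer id) auto
  have "\<forall>\<^sub>F \<kappa> in at_right (0::real). \<kappa> > 0" by (rule eventually_at_right_less)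
  hence "\<forall>\<^sub>F \<kappa> in at_right 0. \<forall>m. norm (\<nu> ^ m * axis_poly n \<kappa> k m x / pochhammer (of_nat n * of_real \<kappa> + 1) m) \<le> M m"
    by eventually_elim (auto simp: M_def intro!: norm_bessel_series_term_le[OF _ k, THEN order_trans])
  hence "\<forall>\<^sub>F (m, \<kappa>) in at_top \<times>\<^sub>F at_right 0. norm (\<nu> ^ m * axis_poly n \<kappa> k m x / pochhammer (of_nat n * of_real \<kappa> + 1) m) \<le> M m"
    unfolding eventually_prod_filter
    by (intro exI[of _ "\<lambda>_. True"] exI[of _ "\<lambda>\<kappa>. \<forall>m. norm (\<nu> ^ m * axis_poly n \<kappa> k m x / pochhammer (of_nat n * of_real \<kappa> + 1) m) \<le> M m"]) auto
  moreover have "summable M" unfolding M_def by (rule summable_power_over_fact)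
  ultimately show ?thesis
    unfolding bessel_series_def using tannerys_theorem[OF lim] by simp
qed

theorem theorem3p1:
  fixes n :: nat and \<kappa> :: real and \<nu> :: complex and x :: "nat \<Rightarrow> real"
    and l :: "nat \<Rightarrow> complex"
    and \<Phi> \<Psi> :: "real \<Rightarrow> complex"
  assumes "n \<ge> 1" and "\<kappa> \<ge> 0"
    and "(\<Sum>i=1..n. x i) = 0"
    and "l = (\<lambda>i. if i = n then (of_nat n - 1) * \<nu> / of_nat n else - \<nu> / of_nat n)"
    and "\<Phi> = (\<lambda>k. humbert n (\<lambda>_. of_real k) (of_nat n * of_real k) (\<lambda>i. \<nu> * of_real (x i)))"
    and "\<Psi> = (\<lambda>k. exp (\<nu> * of_real (x n)) *
               humbert (n - 1) (\<lambda>_. of_real k) (of_nat n * of_real k)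
                 (\<lambda>i. \<nu> * of_real (x i - x n)))"
  shows "(\<kappa> > 0 \<longrightarrow> bessel n \<kappa> l x = \<Phi> \<kappa> \<and> \<Phi> \<kappa> = \<Psi> \<kappa>) \<and>
         (\<kappa> = 0 \<longrightarrow> (\<Phi> \<longlongrightarrow> bessel n \<kappa> l x) (at_right 0) \<and>
                    (\<Psi> \<longlongrightarrow> bessel n \<kappa> l x) (at_right 0))"
proof -
  have \<Phi>: "\<Phi> k = (\<Sum>j=1..n. bessel_series n k \<nu> x j) / of_nat n" if "k > 0" for k
    unfolding assms(5) using humbert_eq_series[OF assms(1) that] .
  have \<Psi>: "\<Psi> k = \<Phi> k" if "k > 0" for k
    unfolding assms(5,6) using humbert_shift[OF assms(1) that, of "\<lambda>i. \<nu> * of_real (x i)"]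
    by (simp add: right_diff_distrib)
  have b: "bessel n k l x = (\<Sum>j=1..n. bessel_series n k \<nu> x j) / of_nat n" if "k \<ge> 0" for k
    using bessel_eq_series[OF assms(1) that assms(3,4)] .
  have lim: "((\<lambda>k. (\<Sum>j=1..n. bessel_series n k \<nu> x j) / of_nat n) \<longlongrightarrow> bessel n 0 l x) (at_right 0)"
    unfolding b[OF order_refl] using assms(1) by (intro tendsto_intros tendsto_bessel_series) auto
  have pos: "\<forall>\<^sub>F k in at_right (0::real). k > 0" by (rule eventually_at_right_less)
  have "(\<Phi> \<longlongrightarrow> bessel n 0 l x) (at_right 0)"
    by (rule Lim_transform_eventually[OF lim]) (use pos in eventually_elim, simp add: \<Phi>)
  moreover have "(\<Psi> \<longlongrightarrow> bessel n 0 l x) (at_right 0)"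
    by (rule Lim_transform_eventually[OF lim]) (use pos in eventually_elim, simp add: \<Psi> \<Phi>)
  ultimately show ?thesis using \<Phi> \<Psi> b assms(2) by auto
qed

end
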